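(* Let $\mathcal{A}$ be an abelian category and $\mathcal{D}$ an additive category. Assume we have adjunctions $f_!\dashv f^*\dashv f_*$ where $f^*\colon\mathcal{A}\to\mathcal{D}$ is a faithful functor. Let $\nu_1$ and $\nu_2$ be Nakayama functors relative to $f_!\dashv f^*$ satisfying $\nu_1\circ f_!=f_*=\nu_2\circ f_!$. The following holds: (1) There exists an equivalence $\Phi\colon\mathcal{A}\to\mathcal{A}$ satisfying $\Phi\circ f_!=f_!$ and a unique natural isomorphism $\xi\colon\nu_1\circ\Phi\to\nu_2$ satisfying $\xi_{f_!}=1_{f_*}$. Furthermore, if $\Psi$ is another such equivalence, then there exists a unique natural isomorphism $\zeta\colon\Phi\to\Psi$ satisfying $\zeta_{f_!}=1_{f_!}$. (2) There exists an equivalence $\Phi'\colon\mathcal{A}\to\mathcal{A}$ satisfying $\Phi'\circ f_*=f_*$ and a unique natural isomorphism $\xi'\colon\Phi'\circ\nu_1\to\nu_2$ satisfying $\xi'_{f_!}=1_{f_*}$. Furthermore, if $\Psi'$ is another such equivalence, then there exists a unique natural isomorphism $\zeta\colon\Phi'\to\Psi'$ satisfying $\zeta_{f_*}=1_{f_*}$.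
   Context: All categories are preadditive and all functors additive. For a natural transformation $\eta\colon F\to F'$ and a functor $G$, $\eta_G\colon F\circ G\to F'\circ G$ denotes the natural transformation obtained by precomposing with $G$. A Nakayama functor relative to $f_!\dashv f^*$ is a functor $\nu\colon\mathcal{A}\to\mathcal{A}$ with a right adjoint $\nu^-$ such that (1) $\nu\circ f_!$ is right adjoint to $f^*$; (2) the unit of $\nu\dashv\nu^-$ precomposed with $f_!$ is an isomorphism $f_!\to\nu^-\circ\nu\circ f_!$. In the statement, "another such equivalence $\Psi$" means an equivalence $\Psi\colon\mathcal{A}\to\mathcal{A}$ with $\Psi\circ f_!=f_!$ admitting a natural isomorphism $\nu_1\circ\Psi\to\nu_2$ which restricts to $1_{f_*}$ when precomposed with $f_!$; similarly, $\Psi'$ is an equivalence with $\Psi'\circ f_*=f_*$ admitting a natural isomorphism $\Psi'\circ\nu_1\to\nu_2$ which restricts to $1_{f_*}$ when precomposed with $f_!$.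
   Formalization: Part (2) with strict equality Φ'∘f_*=f_* assumes: if f_*d=f_*d' and ν_1 sends u:f_!d→f_!d' to the identity, so does ν_2 (a necessary condition; (2) can fail without it). Without it, (2) is stated with Φ'∘f_*=f_* replaced by a specified natural isomorphism. *)

theory Defs
  imports "HOL-Algebra.Group" "HOL-Library.FuncSet"
begin

section \<open>Preadditive, additive and abelian categories\<close>

text \<open>
  The operations are total functions whose values matter only on composable, respectively
  parallel, arrows. \<open>g \<cdot> f\<close> is \<open>f\<close> followed by \<open>g\<close>.
\<close>

record ('o, 'a) precat =
  Ob :: "'o set"
  Ar :: "'a set"
  Dom :: "'a \<Rightarrow> 'o"
  Cod :: "'a \<Rightarrow> 'o"
  Idn :: "'o \<Rightarrow> 'a"
  Comp :: "'a \<Rightarrow> 'a \<Rightarrow> 'a"  (infixl "\<cdot>\<index>" 70)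
  Plus :: "'a \<Rightarrow> 'a \<Rightarrow> 'a"
  Zero :: "'o \<Rightarrow> 'o \<Rightarrow> 'a"

definition Hom :: "('o, 'a) precat \<Rightarrow> 'o \<Rightarrow> 'o \<Rightarrow> 'a set" where
  "Hom C x y = {f \<in> Ar C. Dom C f = x \<and> Cod C f = y}"

definition Hom_group :: "('o, 'a) precat \<Rightarrow> 'o \<Rightarrow> 'o \<Rightarrow> 'a monoid" where
  "Hom_group C x y = \<lparr>carrier = Hom C x y, monoid.mult = Plus C, one = Zero C x y\<rparr>"

locale preadditive_category =
  fixes C :: "('o, 'a) precat" (structure)
  assumes Dom_closed: "f \<in> Ar C \<Longrightarrow> Dom C f \<in> Ob C"
    and Cod_closed: "f \<in> Ar C \<Longrightarrow> Cod C f \<in> Ob C"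
    and Idn_closed: "x \<in> Ob C \<Longrightarrow> Idn C x \<in> Hom C x x"
    and Comp_closed: "\<lbrakk>f \<in> Hom C x y; g \<in> Hom C y z\<rbrakk> \<Longrightarrow> g \<cdot> f \<in> Hom C x z"
    and Idn_left: "f \<in> Hom C x y \<Longrightarrow> Idn C y \<cdot> f = f"
    and Idn_right: "f \<in> Hom C x y \<Longrightarrow> f \<cdot> Idn C x = f"
    and Comp_assoc:
      "\<lbrakk>f \<in> Hom C w x; g \<in> Hom C x y; h \<in> Hom C y z\<rbrakk> \<Longrightarrow> (h \<cdot> g) \<cdot> f = h \<cdot> (g \<cdot> f)"
    and Hom_comm_group: "\<lbrakk>x \<in> Ob C; y \<in> Ob C\<rbrakk> \<Longrightarrow> comm_group (Hom_group C x y)"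
    and Comp_Plus_left:
      "\<lbrakk>f \<in> Hom C x y; g \<in> Hom C y z; g' \<in> Hom C y z\<rbrakk>
        \<Longrightarrow> Plus C g g' \<cdot> f = Plus C (g \<cdot> f) (g' \<cdot> f)"
    and Comp_Plus_right:
      "\<lbrakk>f \<in> Hom C x y; f' \<in> Hom C x y; g \<in> Hom C y z\<rbrakk>
        \<Longrightarrow> g \<cdot> Plus C f f' = Plus C (g \<cdot> f) (g \<cdot> f')"

definition zero_object :: "('o, 'a) precat \<Rightarrow> 'o \<Rightarrow> bool" where
  "zero_object C z \<longleftrightarrow> z \<in> Ob C \<and>
    (\<forall>x\<in>Ob C. (\<exists>!f. f \<in> Hom C x z) \<and> (\<exists>!f. f \<in> Hom C z x))"

definition biproduct ::
  "('o, 'a) precat \<Rightarrow> 'o \<Rightarrow> 'o \<Rightarrow> 'o \<Rightarrow> 'a \<Rightarrow> 'a \<Rightarrow> 'a \<Rightarrow> 'a \<Rightarrow> bool" where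
  "biproduct C x y s i j p q \<longleftrightarrow> s \<in> Ob C \<and>
    i \<in> Hom C x s \<and> j \<in> Hom C y s \<and> p \<in> Hom C s x \<and> q \<in> Hom C s y \<and>
    p \<cdot>\<^bsub>C\<^esub> i = Idn C x \<and> q \<cdot>\<^bsub>C\<^esub> j = Idn C y \<and>
    p \<cdot>\<^bsub>C\<^esub> j = Zero C y x \<and> q \<cdot>\<^bsub>C\<^esub> i = Zero C x y \<and>
    Plus C (i \<cdot>\<^bsub>C\<^esub> p) (j \<cdot>\<^bsub>C\<^esub> q) = Idn C s"

locale additive_category = preadditive_category +
  assumes ex_zero_object: "\<exists>z. zero_object C z"
    and ex_biproduct: "\<lbrakk>x \<in> Ob C; y \<in> Ob C\<rbrakk> \<Longrightarrow> \<exists>s i j p q. biproduct C x y s i j p q"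

definition monic :: "('o, 'a) precat \<Rightarrow> 'a \<Rightarrow> bool" where
  "monic C f \<longleftrightarrow> f \<in> Ar C \<and>
    (\<forall>w\<in>Ob C. \<forall>g\<in>Hom C w (Dom C f). \<forall>h\<in>Hom C w (Dom C f). f \<cdot>\<^bsub>C\<^esub> g = f \<cdot>\<^bsub>C\<^esub> h \<longrightarrow> g = h)"

definition epic :: "('o, 'a) precat \<Rightarrow> 'a \<Rightarrow> bool" where
  "epic C f \<longleftrightarrow> f \<in> Ar C \<and>
    (\<forall>z\<in>Ob C. \<forall>g\<in>Hom C (Cod C f) z. \<forall>h\<in>Hom C (Cod C f) z. g \<cdot>\<^bsub>C\<^esub> f = h \<cdot>\<^bsub>C\<^esub> f \<longrightarrow> g = h)"

definition is_iso :: "('o, 'a) precat \<Rightarrow> 'a \<Rightarrow> bool" where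
  "is_iso C f \<longleftrightarrow> f \<in> Ar C \<and>
    (\<exists>g\<in>Hom C (Cod C f) (Dom C f). g \<cdot>\<^bsub>C\<^esub> f = Idn C (Dom C f) \<and> f \<cdot>\<^bsub>C\<^esub> g = Idn C (Cod C f))"

definition is_kernel :: "('o, 'a) precat \<Rightarrow> 'a \<Rightarrow> 'a \<Rightarrow> bool" where
  "is_kernel C f k \<longleftrightarrow> f \<in> Ar C \<and> k \<in> Ar C \<and> Cod C k = Dom C f \<and>
    f \<cdot>\<^bsub>C\<^esub> k = Zero C (Dom C k) (Cod C f) \<and>
    (\<forall>w\<in>Ob C. \<forall>t\<in>Hom C w (Dom C f). f \<cdot>\<^bsub>C\<^esub> t = Zero C w (Cod C f) \<longrightarrow>
      (\<exists>!u. u \<in> Hom C w (Dom C k) \<and> k \<cdot>\<^bsub>C\<^esub> u = t))"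

definition is_cokernel :: "('o, 'a) precat \<Rightarrow> 'a \<Rightarrow> 'a \<Rightarrow> bool" where
  "is_cokernel C f c \<longleftrightarrow> f \<in> Ar C \<and> c \<in> Ar C \<and> Dom C c = Cod C f \<and>
    c \<cdot>\<^bsub>C\<^esub> f = Zero C (Dom C f) (Cod C c) \<and>
    (\<forall>z\<in>Ob C. \<forall>t\<in>Hom C (Cod C f) z. t \<cdot>\<^bsub>C\<^esub> f = Zero C (Dom C f) z \<longrightarrow>
      (\<exists>!u. u \<in> Hom C (Cod C c) z \<and> u \<cdot>\<^bsub>C\<^esub> c = t))"

locale abelian_category = additive_category +
  assumes ex_kernel: "f \<in> Ar C \<Longrightarrow> \<exists>k. is_kernel C f k"
    and ex_cokernel: "f \<in> Ar C \<Longrightarrow> \<exists>c. is_cokernel C f c"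
    and monic_is_kernel: "monic C m \<Longrightarrow> \<exists>f. is_kernel C f m"
    and epic_is_cokernel: "epic C e \<Longrightarrow> \<exists>f. is_cokernel C f e"

section \<open>Additive functors and natural transformations\<close>

text \<open>
  The maps of a functor, and the family of components of a natural transformation, are
  extensional (\<open>undefined\<close> off the source category). Hence HOL equality is equality of functors
  and of natural transformations, and unique existence has its intended meaning. Composites
  restrict to their source category, which is why they take it as an argument.
\<close>

record ('o, 'a, 'p, 'b) fctr =
  FOb :: "'o \<Rightarrow> 'p"
  FAr :: "'a \<Rightarrow> 'b"

definition additive_functor ::
  "('o, 'a) precat \<Rightarrow> ('p, 'b) precat \<Rightarrow> ('o, 'a, 'p, 'b) fctr \<Rightarrow> bool" where
  "additive_functor C D F \<longleftrightarrow>
    FOb F \<in> Ob C \<rightarrow>\<^sub>E Ob D \<and> FAr F \<in> Ar C \<rightarrow>\<^sub>E Ar D \<and>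
    (\<forall>f\<in>Ar C. Dom D (FAr F f) = FOb F (Dom C f) \<and> Cod D (FAr F f) = FOb F (Cod C f)) \<and>
    (\<forall>x\<in>Ob C. FAr F (Idn C x) = Idn D (FOb F x)) \<and>
    (\<forall>f\<in>Ar C. \<forall>g\<in>Ar C. Dom C g = Cod C f \<longrightarrow>
      FAr F (g \<cdot>\<^bsub>C\<^esub> f) = FAr F g \<cdot>\<^bsub>D\<^esub> FAr F f) \<and>
    (\<forall>f\<in>Ar C. \<forall>g\<in>Ar C. Dom C f = Dom C g \<and> Cod C f = Cod C g \<longrightarrow>
      FAr F (Plus C f g) = Plus D (FAr F f) (FAr F g))"

definition idfun :: "('o, 'a) precat \<Rightarrow> ('o, 'a, 'o, 'a) fctr" where
  "idfun C = \<lparr>FOb = (\<lambda>x\<in>Ob C. x), FAr = (\<lambda>f\<in>Ar C. f)\<rparr>"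

definition fcomp ::
  "('o, 'a) precat \<Rightarrow> ('p, 'b, 'q, 'c) fctr \<Rightarrow> ('o, 'a, 'p, 'b) fctr \<Rightarrow> ('o, 'a, 'q, 'c) fctr"
    (infixl "\<odot>\<index>" 75) where
  "G \<odot>\<^bsub>C\<^esub> F = \<lparr>FOb = compose (Ob C) (FOb G) (FOb F), FAr = compose (Ar C) (FAr G) (FAr F)\<rparr>"

definition faithful :: "('o, 'a) precat \<Rightarrow> ('o, 'a, 'p, 'b) fctr \<Rightarrow> bool" where
  "faithful C F \<longleftrightarrow> (\<forall>x\<in>Ob C. \<forall>y\<in>Ob C. inj_on (FAr F) (Hom C x y))"

definition nat_trans ::
  "('o, 'a) precat \<Rightarrow> ('p, 'b) precat \<Rightarrow> ('o, 'a, 'p, 'b) fctr \<Rightarrow> ('o, 'a, 'p, 'b) fctr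
    \<Rightarrow> ('o \<Rightarrow> 'b) \<Rightarrow> bool" where
  "nat_trans C D F G \<tau> \<longleftrightarrow>
    additive_functor C D F \<and> additive_functor C D G \<and>
    \<tau> \<in> (\<Pi>\<^sub>E x\<in>Ob C. Hom D (FOb F x) (FOb G x)) \<and>
    (\<forall>f\<in>Ar C. \<tau> (Cod C f) \<cdot>\<^bsub>D\<^esub> FAr F f = FAr G f \<cdot>\<^bsub>D\<^esub> \<tau> (Dom C f))"

definition nat_iso ::
  "('o, 'a) precat \<Rightarrow> ('p, 'b) precat \<Rightarrow> ('o, 'a, 'p, 'b) fctr \<Rightarrow> ('o, 'a, 'p, 'b) fctr
    \<Rightarrow> ('o \<Rightarrow> 'b) \<Rightarrow> bool" where
  "nat_iso C D F G \<tau> \<longleftrightarrow> nat_trans C D F G \<tau> \<and> (\<forall>x\<in>Ob C. is_iso D (\<tau> x))"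

definition id_trans ::
  "('o, 'a) precat \<Rightarrow> ('p, 'b) precat \<Rightarrow> ('o, 'a, 'p, 'b) fctr \<Rightarrow> 'o \<Rightarrow> 'b" where
  "id_trans C D F = (\<lambda>x\<in>Ob C. Idn D (FOb F x))"

definition vcomp ::
  "('o, 'a) precat \<Rightarrow> ('p, 'b) precat \<Rightarrow> ('o \<Rightarrow> 'b) \<Rightarrow> ('o \<Rightarrow> 'b) \<Rightarrow> 'o \<Rightarrow> 'b" where
  "vcomp C D \<sigma> \<tau> = (\<lambda>x\<in>Ob C. \<sigma> x \<cdot>\<^bsub>D\<^esub> \<tau> x)"

text \<open>\<open>precomp B \<eta> G\<close> is \<open>\<eta>\<^sub>G\<close>, where \<open>B\<close> is the source of \<open>G\<close>.\<close>

definition precomp ::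
  "('o, 'a) precat \<Rightarrow> ('p \<Rightarrow> 'c) \<Rightarrow> ('o, 'a, 'p, 'b) fctr \<Rightarrow> 'o \<Rightarrow> 'c" where
  "precomp B \<eta> G = compose (Ob B) \<eta> (FOb G)"

section \<open>Adjunctions, equivalences and Nakayama functors\<close>

definition adjunction ::
  "('o, 'a) precat \<Rightarrow> ('p, 'b) precat \<Rightarrow> ('o, 'a, 'p, 'b) fctr \<Rightarrow> ('p, 'b, 'o, 'a) fctr
    \<Rightarrow> ('o \<Rightarrow> 'a) \<Rightarrow> ('p \<Rightarrow> 'b) \<Rightarrow> bool" where
  "adjunction C D L R \<eta> \<epsilon> \<longleftrightarrow>
    additive_functor C D L \<and> additive_functor D C R \<and>
    nat_trans C C (idfun C) (R \<odot>\<^bsub>C\<^esub> L) \<eta> \<and> nat_trans D D (L \<odot>\<^bsub>D\<^esub> R) (idfun D) \<epsilon> \<and>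
    (\<forall>x\<in>Ob C. \<epsilon> (FOb L x) \<cdot>\<^bsub>D\<^esub> FAr L (\<eta> x) = Idn D (FOb L x)) \<and>
    (\<forall>y\<in>Ob D. FAr R (\<epsilon> y) \<cdot>\<^bsub>C\<^esub> \<eta> (FOb R y) = Idn C (FOb R y))"

definition adjoint_pair ::
  "('o, 'a) precat \<Rightarrow> ('p, 'b) precat \<Rightarrow> ('o, 'a, 'p, 'b) fctr \<Rightarrow> ('p, 'b, 'o, 'a) fctr
    \<Rightarrow> bool" where
  "adjoint_pair C D L R \<longleftrightarrow> (\<exists>\<eta> \<epsilon>. adjunction C D L R \<eta> \<epsilon>)"

definition is_equivalence ::
  "('o, 'a) precat \<Rightarrow> ('p, 'b) precat \<Rightarrow> ('o, 'a, 'p, 'b) fctr \<Rightarrow> bool" where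
  "is_equivalence C D F \<longleftrightarrow> additive_functor C D F \<and>
    (\<exists>G \<sigma> \<tau>. additive_functor D C G \<and>
      nat_iso C C (idfun C) (G \<odot>\<^bsub>C\<^esub> F) \<sigma> \<and> nat_iso D D (F \<odot>\<^bsub>D\<^esub> G) (idfun D) \<tau>)"

definition nakayama_functor ::
  "('o, 'a) precat \<Rightarrow> ('p, 'b) precat \<Rightarrow> ('p, 'b, 'o, 'a) fctr \<Rightarrow> ('o, 'a, 'p, 'b) fctr
    \<Rightarrow> ('o, 'a, 'o, 'a) fctr \<Rightarrow> bool" where
  "nakayama_functor A D f_shriek f_star \<nu> \<longleftrightarrow>
    (\<exists>\<nu>_minus \<eta> \<epsilon>. adjunction A A \<nu> \<nu>_minus \<eta> \<epsilon> \<and>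
      adjoint_pair A D f_star (\<nu> \<odot>\<^bsub>D\<^esub> f_shriek) \<and>
      nat_iso D A f_shriek ((\<nu>_minus \<odot>\<^bsub>A\<^esub> \<nu>) \<odot>\<^bsub>D\<^esub> f_shriek) (precomp D \<eta> f_shriek))"

section \<open>Strict equalities on the image of the right adjoint\<close>

text \<open>
  \<open>f_low\<close> may take equal values at \<open>d\<close> and \<open>d'\<close> although \<open>f_shriek\<close> does not, and then the
  arrow \<open>u\<close> from \<open>f_shriek d\<close> to \<open>f_shriek d'\<close> which \<open>\<nu>1\<close> sends to the identity need not be
  sent to the identity by \<open>\<nu>2\<close>. This obstructs the strict equality of \<open>\<Phi>' \<circ> f_low\<close> with \<open>f_low\<close>
  (lemma \<open>fibre_compatible_necessary\<close>). The obstruction is absent when \<open>f_low\<close> is injective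
  on objects (lemma \<open>fibre_compatible_if_inj\<close>).
\<close>

definition fibre_compatible ::
  "('o, 'a) precat \<Rightarrow> ('p, 'b) precat \<Rightarrow> ('p, 'b, 'o, 'a) fctr \<Rightarrow> ('p, 'b, 'o, 'a) fctr
    \<Rightarrow> ('o, 'a, 'o, 'a) fctr \<Rightarrow> ('o, 'a, 'o, 'a) fctr \<Rightarrow> bool" where
  "fibre_compatible A D f_shriek f_low \<nu>1 \<nu>2 \<longleftrightarrow>
    (\<forall>d\<in>Ob D. \<forall>d'\<in>Ob D. FOb f_low d = FOb f_low d' \<longrightarrow>
      (\<forall>u\<in>Hom A (FOb f_shriek d) (FOb f_shriek d').
        FAr \<nu>1 u = Idn A (FOb f_low d) \<longrightarrow> FAr \<nu>2 u = Idn A (FOb f_low d)))"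

lemma FOb_fcomp: "x \<in> Ob C \<Longrightarrow> FOb (G \<odot>\<^bsub>C\<^esub> F) x = FOb G (FOb F x)"
  by (simp add: fcomp_def compose_def)

lemma FAr_fcomp: "f \<in> Ar C \<Longrightarrow> FAr (G \<odot>\<^bsub>C\<^esub> F) f = FAr G (FAr F f)"
  by (simp add: fcomp_def compose_def)

lemma fibre_compatible_necessary:
  assumes A: "preadditive_category A"
    and Phi: "additive_functor A A \<Phi>'" "\<Phi>' \<odot>\<^bsub>D\<^esub> f_low = f_low"
    and xi: "nat_trans A A (\<Phi>' \<odot>\<^bsub>A\<^esub> \<nu>1) \<nu>2 \<xi>" "precomp D \<xi> f_shriek = id_trans D A f_low"
    and nu: "\<nu>2 \<odot>\<^bsub>D\<^esub> f_shriek = f_low"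
    and low: "FOb f_low \<in> Ob D \<rightarrow> Ob A"
  shows "fibre_compatible A D f_shriek f_low \<nu>1 \<nu>2"
  unfolding fibre_compatible_def
proof (intro ballI impI)
  interpret preadditive_category A by (rule A)
  fix d d' u
  assume d: "d \<in> Ob D" and d': "d' \<in> Ob D" and eq: "FOb f_low d = FOb f_low d'"
    and u: "u \<in> Hom A (FOb f_shriek d) (FOb f_shriek d')"
    and nu1: "FAr \<nu>1 u = Idn A (FOb f_low d)"
  let ?X = "FOb f_low d"
  have X: "?X \<in> Ob A" using low d by blast
  have uA: "u \<in> Ar A" "Dom A u = FOb f_shriek d" "Cod A u = FOb f_shriek d'"
    using u by (auto simp: Hom_def)
  have xid: "\<xi> (FOb f_shriek e) = Idn A (FOb f_low e)" if "e \<in> Ob D" for e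
    using fun_cong[OF xi(2), of e] that by (simp add: precomp_def compose_def id_trans_def)
  have nu2ob: "FOb \<nu>2 (FOb f_shriek e) = FOb f_low e" if "e \<in> Ob D" for e
    using FOb_fcomp[OF that, of \<nu>2 f_shriek] nu by simp
  have PhiX: "FOb \<Phi>' ?X = ?X" using FOb_fcomp[OF d, of \<Phi>' f_low] Phi(2) by simp
  have "additive_functor A A \<nu>2" using xi(1) by (simp add: nat_trans_def)
  then have nu2u: "FAr \<nu>2 u \<in> Hom A ?X ?X"
    using uA nu2ob d d' eq by (auto simp: additive_functor_def Hom_def)
  have "FAr (\<Phi>' \<odot>\<^bsub>A\<^esub> \<nu>1) u = Idn A ?X"
    using uA nu1 Phi(1) X PhiX by (simp add: FAr_fcomp additive_functor_def)
  moreover have "\<xi> (Cod A u) \<cdot>\<^bsub>A\<^esub> FAr (\<Phi>' \<odot>\<^bsub>A\<^esub> \<nu>1) u = FAr \<nu>2 u \<cdot>\<^bsub>A\<^esub> \<xi> (Dom A u)"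
    using xi(1) uA(1) by (simp add: nat_trans_def)
  ultimately have "Idn A ?X \<cdot>\<^bsub>A\<^esub> Idn A ?X = FAr \<nu>2 u \<cdot>\<^bsub>A\<^esub> Idn A ?X"
    using uA xid d d' eq by simp
  then show "FAr \<nu>2 u = Idn A ?X"
    using Idn_left[OF Idn_closed[OF X]] Idn_right[OF nu2u] by simp
qed

lemma fibre_compatible_if_inj:
  assumes A: "preadditive_category A"
    and fs: "additive_functor D A f_shriek"
    and N: "nakayama_functor A D f_shriek f_star \<nu>1"
    and nu2: "additive_functor A A \<nu>2" "\<nu>2 \<odot>\<^bsub>D\<^esub> f_shriek = f_low"
    and nu1: "\<nu>1 \<odot>\<^bsub>D\<^esub> f_shriek = f_low"
    and inj: "inj_on (FOb f_low) (Ob D)"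
  shows "fibre_compatible A D f_shriek f_low \<nu>1 \<nu>2"
  unfolding fibre_compatible_def
proof (intro ballI impI)
  interpret preadditive_category A by (rule A)
  fix d d' u
  assume d: "d \<in> Ob D" and d': "d' \<in> Ob D" and eq: "FOb f_low d = FOb f_low d'"
    and u': "u \<in> Hom A (FOb f_shriek d) (FOb f_shriek d')"
    and nu1u: "FAr \<nu>1 u = Idn A (FOb f_low d)"
  let ?Y = "FOb f_shriek d"
  have u: "u \<in> Hom A ?Y ?Y" using u' inj_onD[OF inj eq d d'] by simp
  have uA: "u \<in> Ar A" "Dom A u = ?Y" "Cod A u = ?Y" using u by (auto simp: Hom_def)
  have Y: "?Y \<in> Ob A" using fs d by (auto simp: additive_functor_def)
  obtain \<nu>m \<eta> \<epsilon> where adj: "adjunction A A \<nu>1 \<nu>m \<eta> \<epsilon>"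
    and ni: "nat_iso D A f_shriek ((\<nu>m \<odot>\<^bsub>A\<^esub> \<nu>1) \<odot>\<^bsub>D\<^esub> f_shriek) (precomp D \<eta> f_shriek)"
    using N by (auto simp: nakayama_functor_def)
  have "is_iso A (precomp D \<eta> f_shriek d)" using ni d by (simp add: nat_iso_def)
  then have iso: "is_iso A (\<eta> ?Y)" using d by (simp add: precomp_def compose_def)
  have fun1: "additive_functor A A \<nu>1" "additive_functor A A \<nu>m"
    and nt: "nat_trans A A (idfun A) (\<nu>m \<odot>\<^bsub>A\<^esub> \<nu>1) \<eta>"
    using adj by (auto simp: adjunction_def)
  have ob1: "FOb \<nu>1 ?Y = FOb f_low d" using FOb_fcomp[OF d, of \<nu>1 f_shriek] nu1 by simp
  have ob2: "FOb \<nu>2 ?Y = FOb f_low d" using FOb_fcomp[OF d, of \<nu>2 f_shriek] nu2(2) by simp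
  have X: "FOb f_low d \<in> Ob A" using fun1(1) Y PiE_mem[of "FOb \<nu>1" "Ob A" "\<lambda>_. Ob A" ?Y] ob1
    by (simp add: additive_functor_def)
  have eta: "\<eta> ?Y \<in> Hom A ?Y (FOb \<nu>m (FOb f_low d))"
    using PiE_mem[of \<eta> "Ob A" "\<lambda>x. Hom A (FOb (idfun A) x) (FOb (\<nu>m \<odot>\<^bsub>A\<^esub> \<nu>1) x)" ?Y] nt Y ob1
    by (simp add: nat_trans_def idfun_def FOb_fcomp)
  have "\<eta> (Cod A u) \<cdot>\<^bsub>A\<^esub> FAr (idfun A) u = FAr (\<nu>m \<odot>\<^bsub>A\<^esub> \<nu>1) u \<cdot>\<^bsub>A\<^esub> \<eta> (Dom A u)"
    using nt uA(1) by (simp add: nat_trans_def)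
  then have "\<eta> ?Y \<cdot>\<^bsub>A\<^esub> FAr (idfun A) u = FAr (\<nu>m \<odot>\<^bsub>A\<^esub> \<nu>1) u \<cdot>\<^bsub>A\<^esub> \<eta> ?Y"
    using uA by simp
  also have "FAr (\<nu>m \<odot>\<^bsub>A\<^esub> \<nu>1) u = Idn A (FOb \<nu>m (FOb f_low d))"
    using uA nu1u fun1(2) X by (simp add: FAr_fcomp additive_functor_def)
  finally have e: "\<eta> ?Y \<cdot>\<^bsub>A\<^esub> u = \<eta> ?Y" using uA Idn_left[OF eta] by (simp add: idfun_def)
  obtain g where g: "g \<in> Hom A (FOb \<nu>m (FOb f_low d)) ?Y" "g \<cdot>\<^bsub>A\<^esub> \<eta> ?Y = Idn A ?Y"
    using iso eta by (auto simp: is_iso_def Hom_def)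
  have "u = (g \<cdot>\<^bsub>A\<^esub> \<eta> ?Y) \<cdot>\<^bsub>A\<^esub> u" using g Idn_left[OF u] by simp
  also have "\<dots> = Idn A ?Y" using Comp_assoc[OF u eta g(1)] e g(2) by simp
  finally show "FAr \<nu>2 u = Idn A (FOb f_low d)"
    using nu2(1) Y ob2 by (simp add: additive_functor_def)
qed

end

theory Submission
  imports Defs
begin

text \<open>
  Write \<open>L \<stileturn> R \<stileturn> S\<close> for the three given adjoints. Since \<open>R\<close> is faithful, the counit
  \<open>\<epsilon>\<^sub>X : L R X \<rightarrow> X\<close> is an epimorphism, and in an abelian category this makes \<open>X\<close> the coequalizer
  of \<open>L R \<epsilon>\<^sub>X\<close> and \<open>\<epsilon>\<^sub>L\<^sub>R\<^sub>X\<close> (lemma \<open>presentation\<close>). Every object thus has a functorial presentation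
  by the \<^emph>\<open>free\<close> objects \<open>L d\<close>, and natural isomorphisms between functors that preserve coequalizers
  extend uniquely from the full subcategory of free objects (\<open>ex1_nat_iso_extending\<close>). This yields
  every uniqueness claim and the comparison isomorphisms. Left adjoints and equivalences preserve
  coequalizers, so the extension applies to \<open>\<nu>\<^sub>i\<close> and to composites with an equivalence.

  For the existence of \<open>\<Phi>\<close>, the unit condition makes each \<open>\<nu>\<^sub>i\<close> fully faithful from the free objects
  onto the objects \<open>S d\<close>. Hence \<open>\<nu>\<^sub>1 (F w) = \<nu>\<^sub>2 w\<close> defines an automorphism \<open>F\<close> of the category of free
  objects, and \<open>F\<close> fixes the arrows \<open>L g\<close> because \<open>\<nu>\<^sub>1 \<circ> L = S = \<nu>\<^sub>2 \<circ> L\<close>. Fixing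
  these arrows is what makes \<open>F\<close> extend to the whole category: such an \<open>F\<close> amounts to an automorphism
  of the monad \<open>R L\<close>, and the category is that of algebras over this monad, as \<open>R\<close> is monadic.
  The proof avoids monads: the object \<open>\<Phi> X\<close> is
  characterised by bijections \<open>\<alpha>\<^sub>d : Hom(L d, X) \<rightarrow> Hom(L d, \<Phi> X)\<close> with \<open>\<alpha>(x w) = \<alpha>(x) F(w)\<close>, a
  \<^emph>\<open>twist\<close> of \<open>X\<close>. Twists exist (\<open>ex_twist\<close>, where the right adjoint \<open>S\<close> enters, as it makes \<open>R\<close>
  preserve the coequalizer defining \<open>\<Phi> X\<close>), they are unique and functorial because maps out of
  \<open>X\<close> are determined by the elements \<open>x\<close>, and twisting by \<open>F\<close> and then by its inverse gives
  back \<open>X\<close>. So twisting is an equivalence (\<open>ex_twist_equivalence\<close>).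

  The second part is the same argument in the opposite category, where \<open>S \<stileturn> R \<stileturn> L\<close> and the free objects
  are the \<open>S d\<close>. The automorphism is now \<open>\<nu>\<^sub>1 v \<mapsto> \<nu>\<^sub>2 v\<close>. As a map on arrows between the indices \<open>d\<close> it is
  always defined. As a map on arrows between the objects \<open>S d\<close> it is defined only under
  \<open>fibre_compatible\<close>, which is what allows the strict equality \<open>\<Phi>' \<circ> S = S\<close> in place of an
  isomorphism \<open>\<iota>\<close>.
\<close>

section \<open>Arrows and functors\<close>

lemma Hom_iff: "f \<in> Hom C x y \<longleftrightarrow> f \<in> Ar C \<and> Dom C f = x \<and> Cod C f = y"
  by (auto simp: Hom_def)

context preadditive_category
begin

lemma Ar_Hom: "f \<in> Ar C \<Longrightarrow> f \<in> Hom C (Dom C f) (Cod C f)"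
  by (simp add: Hom_iff)

lemma Hom_Ob: "f \<in> Hom C x y \<Longrightarrow> x \<in> Ob C" "f \<in> Hom C x y \<Longrightarrow> y \<in> Ob C"
  using Dom_closed Cod_closed by (auto simp: Hom_iff)

lemma Idn_simps [simp]:
  assumes "x \<in> Ob C"
  shows "Idn C x \<in> Ar C" "Dom C (Idn C x) = x" "Cod C (Idn C x) = x"
  using Idn_closed[OF assms] by (auto simp: Hom_iff)

lemma Comp_simps [simp]:
  assumes "f \<in> Ar C" "g \<in> Ar C" "Dom C g = Cod C f"
  shows "g \<cdot> f \<in> Ar C" "Dom C (g \<cdot> f) = Dom C f" "Cod C (g \<cdot> f) = Cod C g"
  using Comp_closed[of f "Dom C f" "Cod C f" g "Cod C g"] assms by (auto simp: Hom_iff)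

lemma assoc [simp]:
  assumes "f \<in> Ar C" "g \<in> Ar C" "h \<in> Ar C" "Dom C g = Cod C f" "Dom C h = Cod C g"
  shows "(h \<cdot> g) \<cdot> f = h \<cdot> (g \<cdot> f)"
  using Comp_assoc[of f "Dom C f" "Cod C f" g "Cod C g" h "Cod C h"] assms by (auto simp: Hom_iff)

lemma Idn_comp [simp]:
  "\<lbrakk>f \<in> Ar C; Cod C f = y\<rbrakk> \<Longrightarrow> Idn C y \<cdot> f = f"
  "\<lbrakk>f \<in> Ar C; Dom C f = x\<rbrakk> \<Longrightarrow> f \<cdot> Idn C x = f"
  using Idn_left Idn_right by (auto simp: Hom_iff)

lemma Plus_closed:
  assumes "f \<in> Hom C x y" "g \<in> Hom C x y"
  shows "Plus C f g \<in> Hom C x y"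
proof -
  interpret G: comm_group "Hom_group C x y"
    using Hom_comm_group Hom_Ob[OF assms(1)] by blast
  show ?thesis using G.m_closed[of f g] assms by (simp add: Hom_group_def)
qed

lemma Zero_closed: "\<lbrakk>x \<in> Ob C; y \<in> Ob C\<rbrakk> \<Longrightarrow> Zero C x y \<in> Hom C x y"
  using monoid.one_closed[OF group.is_monoid[OF comm_group.axioms(2)[OF Hom_comm_group]]]
  by (simp add: Hom_group_def)

lemma Plus_eq_self_iff:
  assumes "f \<in> Hom C x y" "g \<in> Hom C x y"
  shows "Plus C f g = f \<longleftrightarrow> g = Zero C x y"
proof -
  interpret G: comm_group "Hom_group C x y"
    using Hom_comm_group Hom_Ob[OF assms(1)] by blast
  show ?thesis using G.l_cancel_one[of f g] assms by (auto simp: Hom_group_def)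
qed

lemma ex_difference:
  assumes "f \<in> Hom C x y" "g \<in> Hom C x y"
  shows "\<exists>h\<in>Hom C x y. Plus C g h = f"
proof -
  interpret G: comm_group "Hom_group C x y"
    using Hom_comm_group Hom_Ob[OF assms(1)] by blast
  let ?h = "inv\<^bsub>Hom_group C x y\<^esub> g \<otimes>\<^bsub>Hom_group C x y\<^esub> f"
  have c: "f \<in> carrier (Hom_group C x y)" "g \<in> carrier (Hom_group C x y)"
    using assms by (auto simp: Hom_group_def)
  have "g \<otimes>\<^bsub>Hom_group C x y\<^esub> ?h = f"
    using c by (simp add: G.m_assoc[symmetric])
  moreover have "?h \<in> carrier (Hom_group C x y)" using c by simp
  ultimately show ?thesis by (auto simp: Hom_group_def)
qed

lemma Comp_Zero:
  assumes "x \<in> Ob C" "f \<in> Hom C y z"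
  shows "f \<cdot> Zero C x y = Zero C x z"
proof -
  have y: "y \<in> Ob C" using Hom_Ob assms by blast
  let ?o = "Zero C x y"
  have o: "?o \<in> Hom C x y" using Zero_closed assms y by blast
  have "Plus C ?o ?o = ?o" using Plus_eq_self_iff[OF o o] by simp
  then have "Plus C (f \<cdot> ?o) (f \<cdot> ?o) = f \<cdot> ?o" using Comp_Plus_right[OF o o assms(2)] by simp
  then show ?thesis using Plus_eq_self_iff[OF Comp_closed[OF o assms(2)] Comp_closed[OF o assms(2)]] by simp
qed

lemma Zero_Comp:
  assumes "z \<in> Ob C" "f \<in> Hom C x y"
  shows "Zero C y z \<cdot> f = Zero C x z"
proof -
  have y: "y \<in> Ob C" using Hom_Ob assms by blast
  let ?o = "Zero C y z"
  have o: "?o \<in> Hom C y z" using Zero_closed assms y by blast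
  have "Plus C ?o ?o = ?o" using Plus_eq_self_iff[OF o o] by simp
  then have "Plus C (?o \<cdot> f) (?o \<cdot> f) = ?o \<cdot> f" using Comp_Plus_left[OF assms(2) o o] by simp
  then show ?thesis using Plus_eq_self_iff[OF Comp_closed[OF assms(2) o] Comp_closed[OF assms(2) o]] by simp
qed

lemma is_isoI:
  assumes "f \<in> Hom C x y" "g \<in> Hom C y x" "g \<cdot> f = Idn C x" "f \<cdot> g = Idn C y"
  shows "is_iso C f"
  using assms by (auto simp: is_iso_def Hom_iff)

lemma is_isoE:
  assumes "is_iso C f" "f \<in> Hom C x y"
  obtains g where "g \<in> Hom C y x" "g \<cdot> f = Idn C x" "f \<cdot> g = Idn C y"
  using assms by (auto simp: is_iso_def Hom_iff)

lemma is_iso_Idn: "x \<in> Ob C \<Longrightarrow> is_iso C (Idn C x)"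
  by (rule is_isoI[of _ x x "Idn C x"]) (auto simp: Hom_iff)

lemma iso_cancel_left:
  assumes "is_iso C f" "f \<in> Hom C y z" "g \<in> Hom C x y" "h \<in> Hom C x y" "f \<cdot> g = f \<cdot> h"
  shows "g = h"
proof -
  obtain k where k: "k \<in> Hom C z y" "k \<cdot> f = Idn C y" using is_isoE assms(1,2) by blast
  have "(k \<cdot> f) \<cdot> g = (k \<cdot> f) \<cdot> h" using assms k(1) by (simp add: Hom_iff)
  then show ?thesis using k assms by (auto simp: Hom_iff)
qed

lemma iso_cancel_right:
  assumes "is_iso C f" "f \<in> Hom C x y" "g \<in> Hom C y z" "h \<in> Hom C y z" "g \<cdot> f = h \<cdot> f"
  shows "g = h"
proof -
  obtain k where k: "k \<in> Hom C y x" "f \<cdot> k = Idn C y" using is_isoE assms(1,2) by blast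
  have "g \<cdot> (f \<cdot> k) = (g \<cdot> f) \<cdot> k" using assms(2,3) k(1) by (simp add: Hom_iff)
  also have "\<dots> = (h \<cdot> f) \<cdot> k" by (simp only: assms(5))
  also have "\<dots> = h \<cdot> (f \<cdot> k)" using assms(2,4) k(1) by (simp add: Hom_iff)
  finally show ?thesis using k assms by (auto simp: Hom_iff)
qed

lemma is_iso_Comp:
  assumes "is_iso C f" "is_iso C g" "f \<in> Hom C x y" "g \<in> Hom C y z"
  shows "is_iso C (g \<cdot> f)"
proof -
  obtain f' where f': "f' \<in> Hom C y x" "f' \<cdot> f = Idn C x" "f \<cdot> f' = Idn C y"
    using is_isoE assms(1,3) by blast
  obtain g' where g': "g' \<in> Hom C z y" "g' \<cdot> g = Idn C y" "g \<cdot> g' = Idn C z"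
    using is_isoE assms(2,4) by blast
  have "(f' \<cdot> g') \<cdot> (g \<cdot> f) = f' \<cdot> ((g' \<cdot> g) \<cdot> f)" "(g \<cdot> f) \<cdot> (f' \<cdot> g') = g \<cdot> ((f \<cdot> f') \<cdot> g')"
    using assms f'(1) g'(1) by (simp_all add: Hom_iff del: f' g')
  then show ?thesis
    using assms f' g' by (intro is_isoI[of _ x z "f' \<cdot> g'"]) (auto simp: Hom_iff)
qed

end

definition inverse_arrow :: "('o, 'a) precat \<Rightarrow> 'a \<Rightarrow> 'a" where
  "inverse_arrow C f = (SOME g. g \<in> Hom C (Cod C f) (Dom C f) \<and>
     g \<cdot>\<^bsub>C\<^esub> f = Idn C (Dom C f) \<and> f \<cdot>\<^bsub>C\<^esub> g = Idn C (Cod C f))"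

lemma (in preadditive_category) inverse_arrow:
  assumes "is_iso C f" "f \<in> Hom C x y"
  shows "inverse_arrow C f \<in> Hom C y x" "inverse_arrow C f \<cdot> f = Idn C x"
    "f \<cdot> inverse_arrow C f = Idn C y" "is_iso C (inverse_arrow C f)"
proof -
  have "\<exists>g. g \<in> Hom C (Cod C f) (Dom C f) \<and>
     g \<cdot>\<^bsub>C\<^esub> f = Idn C (Dom C f) \<and> f \<cdot>\<^bsub>C\<^esub> g = Idn C (Cod C f)"
    using assms(1) by (auto simp: is_iso_def)
  from someI_ex[OF this] assms(2)
  show *: "inverse_arrow C f \<in> Hom C y x" "inverse_arrow C f \<cdot> f = Idn C x"
    "f \<cdot> inverse_arrow C f = Idn C y"
    by (auto simp: inverse_arrow_def Hom_iff)
  show "is_iso C (inverse_arrow C f)" using is_isoI[OF *(1) assms(2) *(3,2)] .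
qed

text \<open>Bundles the categories with the functor, so that closure and typing of its values become
  rewrite rules.\<close>

locale afunctor = C: preadditive_category C + D: preadditive_category D
  for C :: "('o, 'a) precat" and D :: "('p, 'b) precat" +
  fixes F :: "('o, 'a, 'p, 'b) fctr"
  assumes F: "additive_functor C D F"
begin

lemma Ob_closed [simp]: "x \<in> Ob C \<Longrightarrow> FOb F x \<in> Ob D"
  using F by (auto simp: additive_functor_def)

lemma Ar_simps [simp]:
  assumes "f \<in> Ar C"
  shows "FAr F f \<in> Ar D" "Dom D (FAr F f) = FOb F (Dom C f)" "Cod D (FAr F f) = FOb F (Cod C f)"
  using F assms by (auto simp: additive_functor_def)

lemma Hom_closed: "f \<in> Hom C x y \<Longrightarrow> FAr F f \<in> Hom D (FOb F x) (FOb F y)"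
  by (auto simp: Hom_iff)

lemma Idn [simp]: "x \<in> Ob C \<Longrightarrow> FAr F (Idn C x) = Idn D (FOb F x)"
  using F by (auto simp: additive_functor_def)

lemma Comp:
  "\<lbrakk>f \<in> Ar C; g \<in> Ar C; Dom C g = Cod C f\<rbrakk> \<Longrightarrow> FAr F (g \<cdot>\<^bsub>C\<^esub> f) = FAr F g \<cdot>\<^bsub>D\<^esub> FAr F f"
  using F by (auto simp: additive_functor_def)

lemma Plus:
  "\<lbrakk>f \<in> Hom C x y; g \<in> Hom C x y\<rbrakk> \<Longrightarrow> FAr F (Plus C f g) = Plus D (FAr F f) (FAr F g)"
  using F by (auto simp: additive_functor_def Hom_iff)

lemma Zero:
  assumes "x \<in> Ob C" "y \<in> Ob C"
  shows "FAr F (Zero C x y) = Zero D (FOb F x) (FOb F y)"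
proof -
  have o: "Zero C x y \<in> Hom C x y" using C.Zero_closed assms .
  have "Plus D (FAr F (Zero C x y)) (FAr F (Zero C x y)) = FAr F (Zero C x y)"
    using Plus[OF o o] C.Plus_eq_self_iff[OF o o] by simp
  then show ?thesis using D.Plus_eq_self_iff[OF Hom_closed[OF o] Hom_closed[OF o]] by simp
qed

end

lemma additive_functor_fcomp:
  assumes "preadditive_category C" "preadditive_category D" "preadditive_category E"
    and "additive_functor C D F" "additive_functor D E G"
  shows "additive_functor C E (G \<odot>\<^bsub>C\<^esub> F)"
proof -
  interpret C: preadditive_category C by fact
  interpret F: afunctor C D F using assms by (intro afunctor.intro afunctor_axioms.intro)
  interpret G: afunctor D E G using assms by (intro afunctor.intro afunctor_axioms.intro)
  show ?thesis
    unfolding additive_functor_def fcomp_def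
    by (auto simp: compose_def F.Comp G.Comp F.Plus[OF C.Ar_Hom] G.Plus[OF F.Hom_closed[OF C.Ar_Hom]]
        Hom_iff C.Dom_closed C.Cod_closed C.Plus_closed[unfolded Hom_iff]
        F.Plus[unfolded Hom_iff] G.Plus[unfolded Hom_iff])
qed

lemma additive_functor_idfun:
  assumes "preadditive_category C" shows "additive_functor C C (idfun C)"
proof -
  interpret preadditive_category C by fact
  show ?thesis
    unfolding additive_functor_def idfun_def
    using Plus_closed by (auto simp: Dom_closed Cod_closed Hom_iff)
qed

lemma idfun_simps [simp]:
  "x \<in> Ob C \<Longrightarrow> FOb (idfun C) x = x" "f \<in> Ar C \<Longrightarrow> FAr (idfun C) f = f"
  by (auto simp: idfun_def)

lemma nat_transD:
  assumes "nat_trans C D F G \<tau>"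
  shows "additive_functor C D F" "additive_functor C D G"
    "x \<in> Ob C \<Longrightarrow> \<tau> x \<in> Hom D (FOb F x) (FOb G x)"
    "f \<in> Hom C x y \<Longrightarrow> \<tau> y \<cdot>\<^bsub>D\<^esub> FAr F f = FAr G f \<cdot>\<^bsub>D\<^esub> \<tau> x"
    "\<tau> \<in> extensional (Ob C)"
  using assms by (auto simp: nat_trans_def Hom_iff PiE_iff)

lemma nat_transI:
  assumes "additive_functor C D F" "additive_functor C D G"
    and "\<And>x. x \<in> Ob C \<Longrightarrow> \<tau> x \<in> Hom D (FOb F x) (FOb G x)"
    and "\<And>x y f. f \<in> Hom C x y \<Longrightarrow> \<tau> y \<cdot>\<^bsub>D\<^esub> FAr F f = FAr G f \<cdot>\<^bsub>D\<^esub> \<tau> x"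
    and "\<tau> \<in> extensional (Ob C)"
  shows "nat_trans C D F G \<tau>"
  using assms by (auto simp: nat_trans_def Hom_iff PiE_iff)

lemma nat_iso_inverse:
  assumes "preadditive_category C" "preadditive_category D" "nat_iso C D F G \<tau>"
  shows "nat_iso C D G F (\<lambda>x\<in>Ob C. inverse_arrow D (\<tau> x))"
proof -
  interpret C: preadditive_category C by fact
  interpret D: preadditive_category D by fact
  have nt: "nat_trans C D F G \<tau>" and iso: "\<And>x. x \<in> Ob C \<Longrightarrow> is_iso D (\<tau> x)"
    using assms by (auto simp: nat_iso_def)
  interpret F: afunctor C D F by standard (rule nat_transD[OF nt])
  interpret G: afunctor C D G by standard (rule nat_transD[OF nt])
  note inv = D.inverse_arrow[OF iso nat_transD(3)[OF nt]]
  have "nat_trans C D G F (\<lambda>x\<in>Ob C. inverse_arrow D (\<tau> x))"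
  proof (rule nat_transI[OF nat_transD(2)[OF nt] nat_transD(1)[OF nt]])
    fix x y f assume f: "f \<in> Hom C x y"
    then have x: "x \<in> Ob C" and y: "y \<in> Ob C" using C.Hom_Ob by blast+
    let ?i = "inverse_arrow D (\<tau> x)" and ?j = "inverse_arrow D (\<tau> y)"
    note tx = nat_transD(3)[OF nt x, unfolded Hom_iff] nat_transD(3)[OF nt y, unfolded Hom_iff]
    note i = inv(1)[OF x x, unfolded Hom_iff] inv(1)[OF y y, unfolded Hom_iff]
    have "?j \<cdot>\<^bsub>D\<^esub> FAr G f = ?j \<cdot>\<^bsub>D\<^esub> (FAr G f \<cdot>\<^bsub>D\<^esub> (\<tau> x \<cdot>\<^bsub>D\<^esub> ?i))"
      using f x inv(3)[OF x x] by (simp add: Hom_iff)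
    also have "\<dots> = ?j \<cdot>\<^bsub>D\<^esub> ((FAr G f \<cdot>\<^bsub>D\<^esub> \<tau> x) \<cdot>\<^bsub>D\<^esub> ?i)"
      using f tx i by (simp add: Hom_iff)
    also have "\<dots> = ?j \<cdot>\<^bsub>D\<^esub> ((\<tau> y \<cdot>\<^bsub>D\<^esub> FAr F f) \<cdot>\<^bsub>D\<^esub> ?i)"
      using nat_transD(4)[OF nt f] by simp
    also have "\<dots> = (?j \<cdot>\<^bsub>D\<^esub> \<tau> y) \<cdot>\<^bsub>D\<^esub> (FAr F f \<cdot>\<^bsub>D\<^esub> ?i)"
      using f tx i by (simp add: Hom_iff)
    also have "\<dots> = FAr F f \<cdot>\<^bsub>D\<^esub> ?i"
      using f y i inv(2)[OF y y] by (simp add: Hom_iff)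
    finally show "restrict (\<lambda>x. inverse_arrow D (\<tau> x)) (Ob C) y \<cdot>\<^bsub>D\<^esub> FAr G f =
        FAr F f \<cdot>\<^bsub>D\<^esub> restrict (\<lambda>x. inverse_arrow D (\<tau> x)) (Ob C) x"
      using x y by simp
  qed (use inv in auto)
  then show ?thesis using inv(4) by (auto simp: nat_iso_def)
qed

section \<open>Coequalizers\<close>

text \<open>The objects are arguments although the arrows determine them: the functor images of a
  coequalizer then get their types by substitution alone.\<close>

definition coequalizer :: "('o, 'a) precat \<Rightarrow> 'o \<Rightarrow> 'o \<Rightarrow> 'o \<Rightarrow> 'a \<Rightarrow> 'a \<Rightarrow> 'a \<Rightarrow> bool" where
  "coequalizer C x y z f g c \<longleftrightarrow> f \<in> Hom C x y \<and> g \<in> Hom C x y \<and> c \<in> Hom C y z \<and>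
    c \<cdot>\<^bsub>C\<^esub> f = c \<cdot>\<^bsub>C\<^esub> g \<and>
    (\<forall>w. \<forall>t\<in>Hom C y w. t \<cdot>\<^bsub>C\<^esub> f = t \<cdot>\<^bsub>C\<^esub> g \<longrightarrow> (\<exists>!u. u \<in> Hom C z w \<and> u \<cdot>\<^bsub>C\<^esub> c = t))"

lemma coequalizer_factor:
  assumes "coequalizer C x y z f g c" "t \<in> Hom C y w" "t \<cdot>\<^bsub>C\<^esub> f = t \<cdot>\<^bsub>C\<^esub> g"
  obtains u where "u \<in> Hom C z w" "u \<cdot>\<^bsub>C\<^esub> c = t"
  using assms unfolding coequalizer_def by blast

lemma (in preadditive_category) coequalizer_cancel:
  assumes c: "coequalizer C x y z f g c"
    and u: "u \<in> Hom C z w" and v: "v \<in> Hom C z w" and eq: "u \<cdot> c = v \<cdot> c"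
  shows "u = v"
proof -
  have t: "f \<in> Hom C x y" "g \<in> Hom C x y" "c \<in> Hom C y z" "c \<cdot> f = c \<cdot> g"
    using c by (auto simp: coequalizer_def)
  have "(u \<cdot> c) \<cdot> f = (u \<cdot> c) \<cdot> g" using t u by (simp add: Hom_iff)
  then have "\<exists>!k. k \<in> Hom C z w \<and> k \<cdot> c = u \<cdot> c"
    using c Comp_closed[OF t(3) u] unfolding coequalizer_def by blast
  then show ?thesis using u v eq by metis
qed

definition preserves_coequalizers ::
  "('o, 'a) precat \<Rightarrow> ('p, 'b) precat \<Rightarrow> ('o, 'a, 'p, 'b) fctr \<Rightarrow> bool" where
  "preserves_coequalizers C D F \<longleftrightarrow> (\<forall>x y z f g c. coequalizer C x y z f g c \<longrightarrow>
     coequalizer D (FOb F x) (FOb F y) (FOb F z) (FAr F f) (FAr F g) (FAr F c))"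

lemma (in afunctor) preserves_coequalizersI:
  assumes "\<And>x y z f g c w t. \<lbrakk>coequalizer C x y z f g c; t \<in> Hom D (FOb F y) w;
      t \<cdot>\<^bsub>D\<^esub> FAr F f = t \<cdot>\<^bsub>D\<^esub> FAr F g\<rbrakk> \<Longrightarrow> \<exists>!u. u \<in> Hom D (FOb F z) w \<and> u \<cdot>\<^bsub>D\<^esub> FAr F c = t"
  shows "preserves_coequalizers C D F"
  unfolding preserves_coequalizers_def
proof (intro allI impI)
  fix x y z f g c
  assume c: "coequalizer C x y z f g c"
  then have t: "f \<in> Hom C x y" "g \<in> Hom C x y" "c \<in> Hom C y z" "c \<cdot>\<^bsub>C\<^esub> f = c \<cdot>\<^bsub>C\<^esub> g"
    by (auto simp: coequalizer_def)
  have "FAr F c \<cdot>\<^bsub>D\<^esub> FAr F f = FAr F c \<cdot>\<^bsub>D\<^esub> FAr F g"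
    using t Comp[of f c] Comp[of g c] by (auto simp: Hom_iff)
  then show "coequalizer D (FOb F x) (FOb F y) (FOb F z) (FAr F f) (FAr F g) (FAr F c)"
    using t Hom_closed assms[OF c] by (auto simp: coequalizer_def)
qed

lemma preserves_coequalizers_fcomp:
  assumes "preadditive_category C"
    and "preserves_coequalizers C D F" "preserves_coequalizers D E G"
  shows "preserves_coequalizers C E (G \<odot>\<^bsub>C\<^esub> F)"
  unfolding preserves_coequalizers_def
proof (intro allI impI)
  interpret preadditive_category C by fact
  fix x y z f g c
  assume c: "coequalizer C x y z f g c"
  then have "f \<in> Hom C x y" "g \<in> Hom C x y" "c \<in> Hom C y z" by (auto simp: coequalizer_def)
  then have t: "f \<in> Ar C" "g \<in> Ar C" "c \<in> Ar C" "x \<in> Ob C" "y \<in> Ob C" "z \<in> Ob C"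
    using Hom_Ob by (auto simp: Hom_iff)
  show "coequalizer E (FOb (G \<odot>\<^bsub>C\<^esub> F) x) (FOb (G \<odot>\<^bsub>C\<^esub> F) y) (FOb (G \<odot>\<^bsub>C\<^esub> F) z)
     (FAr (G \<odot>\<^bsub>C\<^esub> F) f) (FAr (G \<odot>\<^bsub>C\<^esub> F) g) (FAr (G \<odot>\<^bsub>C\<^esub> F) c)"
    using c assms t by (simp add: FOb_fcomp FAr_fcomp preserves_coequalizers_def)
qed

section \<open>Adjunctions\<close>

locale adjoint_functors = L: afunctor C D L + R: afunctor D C R
  for C :: "('o, 'a) precat" and D :: "('p, 'b) precat" and L R +
  fixes \<eta> :: "'o \<Rightarrow> 'a" and \<epsilon> :: "'p \<Rightarrow> 'b"
  assumes adj: "adjunction C D L R \<eta> \<epsilon>"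
begin

lemma unit_Hom: "x \<in> Ob C \<Longrightarrow> \<eta> x \<in> Hom C x (FOb R (FOb L x))"
  using adj nat_transD(3)[of C C "idfun C" "R \<odot>\<^bsub>C\<^esub> L" \<eta> x]
  by (simp add: adjunction_def FOb_fcomp)

lemma counit_Hom: "y \<in> Ob D \<Longrightarrow> \<epsilon> y \<in> Hom D (FOb L (FOb R y)) y"
  using adj nat_transD(3)[of D D "L \<odot>\<^bsub>D\<^esub> R" "idfun D" \<epsilon> y]
  by (simp add: adjunction_def FOb_fcomp)

lemma unit_simps [simp]:
  assumes "x \<in> Ob C"
  shows "\<eta> x \<in> Ar C" "Dom C (\<eta> x) = x" "Cod C (\<eta> x) = FOb R (FOb L x)"
  using unit_Hom[OF assms] by (auto simp: Hom_iff)

lemma counit_simps [simp]: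
  assumes "y \<in> Ob D"
  shows "\<epsilon> y \<in> Ar D" "Dom D (\<epsilon> y) = FOb L (FOb R y)" "Cod D (\<epsilon> y) = y"
  using counit_Hom[OF assms] by (auto simp: Hom_iff)

lemma unit_natural:
  "f \<in> Hom C x y \<Longrightarrow> \<eta> y \<cdot>\<^bsub>C\<^esub> f = FAr R (FAr L f) \<cdot>\<^bsub>C\<^esub> \<eta> x"
  using adj nat_transD(4)[of C C "idfun C" "R \<odot>\<^bsub>C\<^esub> L" \<eta> f x y]
  by (auto simp: adjunction_def FAr_fcomp Hom_iff)

lemma counit_natural:
  "f \<in> Hom D x y \<Longrightarrow> \<epsilon> y \<cdot>\<^bsub>D\<^esub> FAr L (FAr R f) = f \<cdot>\<^bsub>D\<^esub> \<epsilon> x"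
  using adj nat_transD(4)[of D D "L \<odot>\<^bsub>D\<^esub> R" "idfun D" \<epsilon> f x y]
  by (auto simp: adjunction_def FAr_fcomp Hom_iff)

lemma triangle_left: "x \<in> Ob C \<Longrightarrow> \<epsilon> (FOb L x) \<cdot>\<^bsub>D\<^esub> FAr L (\<eta> x) = Idn D (FOb L x)"
  using adj by (simp add: adjunction_def)

lemma triangle_right: "y \<in> Ob D \<Longrightarrow> FAr R (\<epsilon> y) \<cdot>\<^bsub>C\<^esub> \<eta> (FOb R y) = Idn C (FOb R y)"
  using adj by (simp add: adjunction_def)

text \<open>The source \<open>x\<close> cannot be recovered from the arrow \<open>f\<close>, whose domain is \<open>FOb L x\<close>.\<close>

definition transpose :: "'o \<Rightarrow> 'b \<Rightarrow> 'a" where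
  "transpose x f = FAr R f \<cdot>\<^bsub>C\<^esub> \<eta> x"

lemma transpose_Hom:
  "\<lbrakk>x \<in> Ob C; f \<in> Hom D (FOb L x) y\<rbrakk> \<Longrightarrow> transpose x f \<in> Hom C x (FOb R y)"
  by (simp add: transpose_def Hom_iff)

lemma counit_transpose:
  assumes x: "x \<in> Ob C" and f: "f \<in> Hom D (FOb L x) y"
  shows "\<epsilon> y \<cdot>\<^bsub>D\<^esub> FAr L (transpose x f) = f"
proof -
  have y: "y \<in> Ob D" using f L.D.Hom_Ob by blast
  have "\<epsilon> y \<cdot>\<^bsub>D\<^esub> FAr L (transpose x f) = (\<epsilon> y \<cdot>\<^bsub>D\<^esub> FAr L (FAr R f)) \<cdot>\<^bsub>D\<^esub> FAr L (\<eta> x)"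
    using x y f by (simp add: transpose_def L.Comp Hom_iff)
  also have "\<dots> = f \<cdot>\<^bsub>D\<^esub> (\<epsilon> (FOb L x) \<cdot>\<^bsub>D\<^esub> FAr L (\<eta> x))"
    using x y f counit_natural[OF f] by (simp add: Hom_iff)
  finally show ?thesis using x f by (simp add: triangle_left Hom_iff)
qed

lemma transpose_Comp_left:
  "\<lbrakk>x \<in> Ob C; f \<in> Hom D (FOb L x) y; u \<in> Hom D y z\<rbrakk>
    \<Longrightarrow> transpose x (u \<cdot>\<^bsub>D\<^esub> f) = FAr R u \<cdot>\<^bsub>C\<^esub> transpose x f"
  by (auto simp: transpose_def R.Comp Hom_iff)

lemma transpose_Comp_right:
  assumes "f \<in> Hom D (FOb L x) y" "g \<in> Hom C w x"
  shows "transpose w (f \<cdot>\<^bsub>D\<^esub> FAr L g) = transpose x f \<cdot>\<^bsub>C\<^esub> g"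
proof -
  have "x \<in> Ob C" "w \<in> Ob C" using assms L.C.Hom_Ob by blast+
  then show ?thesis
    using assms unit_natural[OF assms(2)] by (auto simp: transpose_def R.Comp Hom_iff)
qed

lemma transpose_counit: "y \<in> Ob D \<Longrightarrow> transpose (FOb R y) (\<epsilon> y) = Idn C (FOb R y)"
  by (simp add: transpose_def triangle_right)

lemma transpose_counit_Comp:
  assumes "g \<in> Hom C x (FOb R y)" "y \<in> Ob D"
  shows "transpose x (\<epsilon> y \<cdot>\<^bsub>D\<^esub> FAr L g) = g"
  using transpose_Comp_right[OF counit_Hom[OF assms(2)] assms(1)] assms
  by (simp add: transpose_counit Hom_iff)

lemma transpose_inject:
  assumes "x \<in> Ob C" "f \<in> Hom D (FOb L x) y" "g \<in> Hom D (FOb L x) y" "transpose x f = transpose x g"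
  shows "f = g"
  using counit_transpose[OF assms(1,2)] counit_transpose[OF assms(1,3)] assms(4) by metis

lemma transpose_Plus:
  assumes x: "x \<in> Ob C" and f: "f \<in> Hom D (FOb L x) y" and g: "g \<in> Hom D (FOb L x) y"
  shows "transpose x (Plus D f g) = Plus C (transpose x f) (transpose x g)"
  unfolding transpose_def R.Plus[OF f g]
  using L.C.Comp_Plus_left[OF unit_Hom[OF x] R.Hom_closed[OF f] R.Hom_closed[OF g]] .

text \<open>Transposition turns a map out of \<open>L y\<close> that equalizes \<open>L f\<close> and \<open>L g\<close> into a map out of
  \<open>y\<close> that equalizes \<open>f\<close> and \<open>g\<close>.\<close>

lemma left_preserves_coequalizers: "preserves_coequalizers C D L"
proof (rule L.preserves_coequalizersI)
  fix x y z f g c w t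
  assume c: "coequalizer C x y z f g c" and t: "t \<in> Hom D (FOb L y) w"
    and eq: "t \<cdot>\<^bsub>D\<^esub> FAr L f = t \<cdot>\<^bsub>D\<^esub> FAr L g"
  have fg: "f \<in> Hom C x y" "g \<in> Hom C x y" "c \<in> Hom C y z" using c by (auto simp: coequalizer_def)
  have ob: "y \<in> Ob C" "z \<in> Ob C" "w \<in> Ob D" using fg t L.C.Hom_Ob L.D.Hom_Ob by blast+
  have "transpose y t \<cdot>\<^bsub>C\<^esub> f = transpose y t \<cdot>\<^bsub>C\<^esub> g"
    using transpose_Comp_right[OF t fg(1)] transpose_Comp_right[OF t fg(2)] eq by simp
  then obtain k where k: "k \<in> Hom C z (FOb R w)" "k \<cdot>\<^bsub>C\<^esub> c = transpose y t"
    using coequalizer_factor[OF c transpose_Hom[OF ob(1) t]] by blast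
  show "\<exists>!u. u \<in> Hom D (FOb L z) w \<and> u \<cdot>\<^bsub>D\<^esub> FAr L c = t"
  proof (rule ex1I[of _ "\<epsilon> w \<cdot>\<^bsub>D\<^esub> FAr L k"])
    have "(\<epsilon> w \<cdot>\<^bsub>D\<^esub> FAr L k) \<cdot>\<^bsub>D\<^esub> FAr L c = \<epsilon> w \<cdot>\<^bsub>D\<^esub> FAr L (k \<cdot>\<^bsub>C\<^esub> c)"
      using k(1) fg ob by (auto simp: L.Comp Hom_iff)
    then show "\<epsilon> w \<cdot>\<^bsub>D\<^esub> FAr L k \<in> Hom D (FOb L z) w \<and> (\<epsilon> w \<cdot>\<^bsub>D\<^esub> FAr L k) \<cdot>\<^bsub>D\<^esub> FAr L c = t"
      using k ob counit_transpose[OF ob(1) t] by (auto simp: Hom_iff)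
  next
    fix u assume u: "u \<in> Hom D (FOb L z) w \<and> u \<cdot>\<^bsub>D\<^esub> FAr L c = t"
    then have "transpose z u \<cdot>\<^bsub>C\<^esub> c = k \<cdot>\<^bsub>C\<^esub> c"
      using transpose_Comp_right[of u z w c y] fg k by simp
    then have "transpose z u = k"
      using L.C.coequalizer_cancel[OF c transpose_Hom[OF ob(2) conjunct1[OF u]] k(1)] by simp
    then show "u = \<epsilon> w \<cdot>\<^bsub>D\<^esub> FAr L k"
      using counit_transpose[OF ob(2) conjunct1[OF u]] by simp
  qed
qed

end

section \<open>Equivalences\<close>

lemma faithful_if_left_invertible:
  assumes "preadditive_category C"
    and \<sigma>: "nat_iso C C (idfun C) (G \<odot>\<^bsub>C\<^esub> F) \<sigma>"
  shows "inj_on (FAr F) (Hom C x y)"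
proof (rule inj_onI)
  interpret C: preadditive_category C by fact
  fix u v assume u: "u \<in> Hom C x y" and v: "v \<in> Hom C x y" and eq: "FAr F u = FAr F v"
  have y: "y \<in> Ob C" using u C.Hom_Ob by blast
  have nt: "nat_trans C C (idfun C) (G \<odot>\<^bsub>C\<^esub> F) \<sigma>" and iso: "is_iso C (\<sigma> y)"
    using \<sigma> y by (auto simp: nat_iso_def)
  have "\<sigma> y \<cdot>\<^bsub>C\<^esub> u = \<sigma> y \<cdot>\<^bsub>C\<^esub> v"
    using nat_transD(4)[OF nt u] nat_transD(4)[OF nt v] u v eq by (simp add: Hom_iff FAr_fcomp)
  moreover have "\<sigma> y \<in> Hom C y (FOb (G \<odot>\<^bsub>C\<^esub> F) y)" using nat_transD(3)[OF nt y] y by simp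
  ultimately show "u = v" using C.iso_cancel_left[OF iso _ u v] by blast
qed

lemma equivalence_fully_faithful:
  assumes C: "preadditive_category C" and D: "preadditive_category D"
    and F: "is_equivalence C D F" and x: "x \<in> Ob C" and y: "y \<in> Ob C"
  shows "bij_betw (FAr F) (Hom C x y) (Hom D (FOb F x) (FOb F y))"
proof -
  obtain G \<sigma> \<tau> where G: "additive_functor D C G"
    and \<sigma>: "nat_iso C C (idfun C) (G \<odot>\<^bsub>C\<^esub> F) \<sigma>"
    and \<tau>: "nat_iso D D (F \<odot>\<^bsub>D\<^esub> G) (idfun D) \<tau>"
    using F by (auto simp: is_equivalence_def)
  interpret C: preadditive_category C by fact
  interpret D: preadditive_category D by fact
  interpret F: afunctor C D F by standard (use F in \<open>simp add: is_equivalence_def\<close>)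
  interpret G: afunctor D C G by standard (rule G)
  have nt: "nat_trans C C (idfun C) (G \<odot>\<^bsub>C\<^esub> F) \<sigma>" and iso: "is_iso C (\<sigma> x)" "is_iso C (\<sigma> y)"
    using \<sigma> x y by (auto simp: nat_iso_def)
  have h: "\<sigma> x \<in> Hom C x (FOb G (FOb F x))" "\<sigma> y \<in> Hom C y (FOb G (FOb F y))"
    using nat_transD(3)[OF nt x] nat_transD(3)[OF nt y] x y by (auto simp: FOb_fcomp)
  have Gf: "inj_on (FAr G) (Hom D (FOb F x) (FOb F y))"
    using faithful_if_left_invertible[OF D nat_iso_inverse[OF D D \<tau>]] .
  have "h \<in> FAr F ` Hom C x y" if h': "h \<in> Hom D (FOb F x) (FOb F y)" for h
  proof -
    let ?u = "inverse_arrow C (\<sigma> y) \<cdot>\<^bsub>C\<^esub> (FAr G h \<cdot>\<^bsub>C\<^esub> \<sigma> x)"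
    note i = C.inverse_arrow[OF iso(2) h(2)]
    have u: "?u \<in> Hom C x y" using h h' i(1) by (auto simp: Hom_iff)
    have "FAr G (FAr F ?u) \<cdot>\<^bsub>C\<^esub> \<sigma> x = \<sigma> y \<cdot>\<^bsub>C\<^esub> ?u"
      using nat_transD(4)[OF nt u] u by (simp add: Hom_iff FAr_fcomp)
    also have "\<dots> = (\<sigma> y \<cdot>\<^bsub>C\<^esub> inverse_arrow C (\<sigma> y)) \<cdot>\<^bsub>C\<^esub> (FAr G h \<cdot>\<^bsub>C\<^esub> \<sigma> x)"
      using h h' i(1) by (simp add: Hom_iff)
    also have "\<dots> = FAr G h \<cdot>\<^bsub>C\<^esub> \<sigma> x" using h h' i(3) by (simp add: Hom_iff)
    finally have "FAr G (FAr F ?u) = FAr G h"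
      using C.iso_cancel_right[OF iso(1) h(1)] u h' G.Hom_closed F.Hom_closed by blast
    then have "FAr F ?u = h" using inj_onD[OF Gf] F.Hom_closed[OF u] h' by blast
    then show ?thesis using u by (metis imageI)
  qed
  then show ?thesis
    using faithful_if_left_invertible[OF C \<sigma>] F.Hom_closed by (auto simp: bij_betw_def)
qed

text \<open>Equivalences come without triangle identities here, so this is argued from full faithfulness
  and essential surjectivity rather than by exhibiting an adjunction.\<close>

lemma equivalence_preserves_coequalizers:
  assumes C: "preadditive_category C" and D: "preadditive_category D" and E: "is_equivalence C D F"
  shows "preserves_coequalizers C D F"
proof -
  interpret C: preadditive_category C by fact
  interpret D: preadditive_category D by fact
  interpret F: afunctor C D F by standard (use E in \<open>simp add: is_equivalence_def\<close>)
  obtain G \<tau> where G: "additive_functor D C G"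
    and \<tau>: "nat_iso D D (F \<odot>\<^bsub>D\<^esub> G) (idfun D) \<tau>"
    using E by (auto simp: is_equivalence_def)
  interpret G: afunctor D C G by standard (rule G)
  note ff = equivalence_fully_faithful[OF C D E]
  show ?thesis
  proof (rule F.preserves_coequalizersI)
    fix x y z f g c w t
    assume c: "coequalizer C x y z f g c" and t: "t \<in> Hom D (FOb F y) w"
      and eq: "t \<cdot>\<^bsub>D\<^esub> FAr F f = t \<cdot>\<^bsub>D\<^esub> FAr F g"
    have fg: "f \<in> Hom C x y" "g \<in> Hom C x y" "c \<in> Hom C y z" using c by (auto simp: coequalizer_def)
    have ob: "x \<in> Ob C" "y \<in> Ob C" "z \<in> Ob C" "w \<in> Ob D"
      using fg t C.Hom_Ob D.Hom_Ob by blast+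
    have p: "\<tau> w \<in> Hom D (FOb F (FOb G w)) w" and iso: "is_iso D (\<tau> w)"
      using \<tau> ob(4) nat_transD(3)[of D D "F \<odot>\<^bsub>D\<^esub> G" "idfun D" \<tau> w] by (auto simp: nat_iso_def FOb_fcomp)
    obtain q where q: "q \<in> Hom D w (FOb F (FOb G w))" "q \<cdot>\<^bsub>D\<^esub> \<tau> w = Idn D (FOb F (FOb G w))"
      "\<tau> w \<cdot>\<^bsub>D\<^esub> q = Idn D w" using D.is_isoE[OF iso p] by blast
    have Gw: "FOb G w \<in> Ob C" using ob by simp
    \<comment> \<open>Arrows from the image of \<open>F\<close> to \<open>w\<close> come, along \<open>q\<close>, from arrows of \<open>C\<close> to \<open>G w\<close>.\<close>
    have lift: "\<exists>s\<in>Hom C v (FOb G w). FAr F s = q \<cdot>\<^bsub>D\<^esub> h" if "v \<in> Ob C" "h \<in> Hom D (FOb F v) w" for v h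
    proof -
      have "q \<cdot>\<^bsub>D\<^esub> h \<in> Hom D (FOb F v) (FOb F (FOb G w))" using that q(1) by (simp add: Hom_iff)
      then show ?thesis using bij_betw_imp_surj_on[OF ff[OF that(1) Gw]] by (metis imageE)
    qed
    have faith: "s = s'" if "s \<in> Hom C v (FOb G w)" "s' \<in> Hom C v (FOb G w)" "FAr F s = FAr F s'" for v s s'
      using inj_onD[OF bij_betw_imp_inj_on[OF ff[OF C.Hom_Ob(1)[OF that(1)] Gw]] that(3,1,2)] .
    obtain s where s: "s \<in> Hom C y (FOb G w)" "FAr F s = q \<cdot>\<^bsub>D\<^esub> t" using lift[OF ob(2) t] by blast
    have "FAr F (s \<cdot>\<^bsub>C\<^esub> f) = q \<cdot>\<^bsub>D\<^esub> (t \<cdot>\<^bsub>D\<^esub> FAr F f)" "FAr F (s \<cdot>\<^bsub>C\<^esub> g) = q \<cdot>\<^bsub>D\<^esub> (t \<cdot>\<^bsub>D\<^esub> FAr F g)"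
      using s fg t q(1) by (auto simp: F.Comp Hom_iff)
    then have "s \<cdot>\<^bsub>C\<^esub> f = s \<cdot>\<^bsub>C\<^esub> g"
      using faith[of "s \<cdot>\<^bsub>C\<^esub> f" x "s \<cdot>\<^bsub>C\<^esub> g"] s(1) fg C.Comp_closed eq by metis
    then obtain s' where s': "s' \<in> Hom C z (FOb G w)" "s' \<cdot>\<^bsub>C\<^esub> c = s"
      using coequalizer_factor[OF c s(1)] by blast
    show "\<exists>!u. u \<in> Hom D (FOb F z) w \<and> u \<cdot>\<^bsub>D\<^esub> FAr F c = t"
    proof (rule ex_ex1I)
      have "(\<tau> w \<cdot>\<^bsub>D\<^esub> FAr F s') \<cdot>\<^bsub>D\<^esub> FAr F c = \<tau> w \<cdot>\<^bsub>D\<^esub> FAr F (s' \<cdot>\<^bsub>C\<^esub> c)"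
        using s'(1) fg p by (auto simp: F.Comp Hom_iff)
      also have "\<dots> = (\<tau> w \<cdot>\<^bsub>D\<^esub> q) \<cdot>\<^bsub>D\<^esub> t" using s'(2) s(2) t q(1) p by (simp add: Hom_iff)
      finally have "(\<tau> w \<cdot>\<^bsub>D\<^esub> FAr F s') \<cdot>\<^bsub>D\<^esub> FAr F c = t" using q t by (simp add: Hom_iff)
      moreover have "\<tau> w \<cdot>\<^bsub>D\<^esub> FAr F s' \<in> Hom D (FOb F z) w" using s'(1) p by (simp add: Hom_iff)
      ultimately show "\<exists>u. u \<in> Hom D (FOb F z) w \<and> u \<cdot>\<^bsub>D\<^esub> FAr F c = t" by blast
    next
      fix u u'
      assume "u \<in> Hom D (FOb F z) w \<and> u \<cdot>\<^bsub>D\<^esub> FAr F c = t" "u' \<in> Hom D (FOb F z) w \<and> u' \<cdot>\<^bsub>D\<^esub> FAr F c = t"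
      then have u: "u \<in> Hom D (FOb F z) w" "u \<cdot>\<^bsub>D\<^esub> FAr F c = t"
        and u': "u' \<in> Hom D (FOb F z) w" "u' \<cdot>\<^bsub>D\<^esub> FAr F c = t" by auto
      obtain k where k: "k \<in> Hom C z (FOb G w)" "FAr F k = q \<cdot>\<^bsub>D\<^esub> u" using lift[OF ob(3) u(1)] by blast
      obtain k' where k': "k' \<in> Hom C z (FOb G w)" "FAr F k' = q \<cdot>\<^bsub>D\<^esub> u'" using lift[OF ob(3) u'(1)] by blast
      have "FAr F (k \<cdot>\<^bsub>C\<^esub> c) = q \<cdot>\<^bsub>D\<^esub> (u \<cdot>\<^bsub>D\<^esub> FAr F c)" "FAr F (k' \<cdot>\<^bsub>C\<^esub> c) = q \<cdot>\<^bsub>D\<^esub> (u' \<cdot>\<^bsub>D\<^esub> FAr F c)"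
        using k k' u(1) u'(1) fg q(1) by (auto simp: F.Comp Hom_iff)
      then have "k \<cdot>\<^bsub>C\<^esub> c = k' \<cdot>\<^bsub>C\<^esub> c"
        using faith[of "k \<cdot>\<^bsub>C\<^esub> c" y "k' \<cdot>\<^bsub>C\<^esub> c"] k(1) k'(1) fg C.Comp_closed u(2) u'(2) by metis
      then have "k = k'" using C.coequalizer_cancel[OF c k(1) k'(1)] by simp
      then have "q \<cdot>\<^bsub>D\<^esub> u = q \<cdot>\<^bsub>D\<^esub> u'" using k(2) k'(2) by simp
      moreover have "is_iso D q" using D.is_isoI[OF q(1) p q(3,2)] .
      ultimately show "u = u'" using D.iso_cancel_left[OF _ q(1) u(1) u'(1)] by blast
    qed
  qed
qed

section \<open>The opposite category\<close>

text \<open>Functors are the same records over the opposite categories, so duality needs no opposite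
  functors, and natural transformations only change direction.\<close>

definition opposite :: "('o, 'a) precat \<Rightarrow> ('o, 'a) precat" where
  "opposite C = \<lparr>Ob = Ob C, Ar = Ar C, Dom = Cod C, Cod = Dom C, Idn = Idn C,
     Comp = (\<lambda>g f. f \<cdot>\<^bsub>C\<^esub> g), Plus = Plus C, Zero = (\<lambda>x y. Zero C y x)\<rparr>"

lemma opposite_simps [simp]:
  "Ob (opposite C) = Ob C" "Ar (opposite C) = Ar C" "Dom (opposite C) = Cod C"
  "Cod (opposite C) = Dom C" "Idn (opposite C) = Idn C" "g \<cdot>\<^bsub>opposite C\<^esub> f = f \<cdot>\<^bsub>C\<^esub> g"
  "Plus (opposite C) = Plus C" "Zero (opposite C) x y = Zero C y x"
  by (simp_all add: opposite_def)

lemma Hom_opposite [simp]: "Hom (opposite C) x y = Hom C y x"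
  by (auto simp: Hom_def)

lemma fcomp_opposite [simp]: "G \<odot>\<^bsub>opposite C\<^esub> F = G \<odot>\<^bsub>C\<^esub> F"
  by (simp add: fcomp_def)

lemma idfun_opposite [simp]: "idfun (opposite C) = idfun C"
  by (simp add: idfun_def)

lemma precomp_opposite [simp]: "precomp (opposite C) \<tau> F = precomp C \<tau> F"
  by (simp add: precomp_def)

lemma id_trans_opposite [simp]: "id_trans (opposite C) (opposite D) F = id_trans C D F"
  by (simp add: id_trans_def)

lemma preadditive_opposite:
  assumes "preadditive_category C"
  shows "preadditive_category (opposite C)"
proof -
  interpret preadditive_category C by fact
  have [simp]: "Hom_group (opposite C) x y = Hom_group C y x" for x y
    by (simp add: Hom_group_def)
  show ?thesis
  proof (rule preadditive_category.intro)
    fix f w x g y h z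
    assume "f \<in> Hom (opposite C) w x" "g \<in> Hom (opposite C) x y" "h \<in> Hom (opposite C) y z"
    then show "(h \<cdot>\<^bsub>opposite C\<^esub> g) \<cdot>\<^bsub>opposite C\<^esub> f = h \<cdot>\<^bsub>opposite C\<^esub> (g \<cdot>\<^bsub>opposite C\<^esub> f)"
      by (simp add: Hom_iff)
  qed (auto simp: Dom_closed Cod_closed Idn_closed Comp_closed Idn_left Idn_right Hom_comm_group
      Comp_Plus_left Comp_Plus_right)
qed

lemma additive_functor_opposite [simp]:
  "additive_functor (opposite C) (opposite D) F = additive_functor C D F"
  unfolding additive_functor_def by auto

lemma nat_trans_opposite [simp]:
  "nat_trans (opposite C) (opposite D) F G \<tau> = nat_trans C D G F \<tau>"
  unfolding nat_trans_def by auto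

lemma is_iso_opposite [simp]: "is_iso (opposite C) f = is_iso C f"
  unfolding is_iso_def by auto

lemma nat_iso_opposite [simp]: "nat_iso (opposite C) (opposite D) F G \<tau> = nat_iso C D G F \<tau>"
  unfolding nat_iso_def by simp

lemma adjunction_opposite:
  "adjunction C D L R \<eta> \<epsilon> \<Longrightarrow> adjunction (opposite D) (opposite C) R L \<epsilon> \<eta>"
  unfolding adjunction_def by simp

lemma is_equivalence_opposite:
  assumes C: "preadditive_category C" and D: "preadditive_category D" and F: "is_equivalence C D F"
  shows "is_equivalence (opposite C) (opposite D) F"
proof -
  obtain G \<sigma> \<tau> where "additive_functor D C G" "nat_iso C C (idfun C) (G \<odot>\<^bsub>C\<^esub> F) \<sigma>"
    "nat_iso D D (F \<odot>\<^bsub>D\<^esub> G) (idfun D) \<tau>"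
    using F by (auto simp: is_equivalence_def)
  then show ?thesis
    using F nat_iso_inverse[OF C C] nat_iso_inverse[OF D D] unfolding is_equivalence_def by auto blast
qed

lemma opposite_opposite [simp]: "opposite (opposite C) = C"
  by (simp add: opposite_def)

text \<open>Half of the axioms of an abelian category, the half by which free objects present all others.
  The other half says the same of the opposite category.\<close>

locale cokernel_category = preadditive_category +
  assumes ex_cokernel: "f \<in> Ar C \<Longrightarrow> \<exists>c. is_cokernel C f c"
    and epic_is_cokernel: "epic C e \<Longrightarrow> \<exists>f. is_cokernel C f e"
begin

text \<open>The coequalizer of \<open>f\<close> and \<open>g\<close> is the cokernel of their difference.\<close>

lemma ex_coequalizer:
  assumes f: "f \<in> Hom C x y" and g: "g \<in> Hom C x y"
  shows "\<exists>z c. coequalizer C x y z f g c"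
proof -
  obtain d where d: "d \<in> Hom C x y" "Plus C g d = f" using ex_difference[OF f g] by blast
  have x: "x \<in> Ob C" using f Hom_Ob by blast
  have eq: "t \<cdot> f = t \<cdot> g \<longleftrightarrow> t \<cdot> d = Zero C x w" if t: "t \<in> Hom C y w" for t w
    using Comp_Plus_right[OF g d(1) t] d(2) Plus_eq_self_iff[OF Comp_closed[OF g t] Comp_closed[OF d(1) t]]
    by auto
  obtain c where c: "is_cokernel C d c" using ex_cokernel d(1) by (auto simp: Hom_iff)
  have cH: "c \<in> Hom C y (Cod C c)" "c \<cdot> d = Zero C x (Cod C c)"
    using c d(1) by (auto simp: is_cokernel_def Hom_iff)
  have "\<exists>!u. u \<in> Hom C (Cod C c) w \<and> u \<cdot> c = t" if "t \<in> Hom C y w" "t \<cdot> f = t \<cdot> g" for t w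
  proof -
    have "w \<in> Ob C" "t \<in> Hom C (Cod C d) w" "t \<cdot> d = Zero C (Dom C d) w"
      using that Hom_Ob d(1) eq[OF that(1)] by (auto simp: Hom_iff)
    then show ?thesis using c unfolding is_cokernel_def by blast
  qed
  then have "coequalizer C x y (Cod C c) f g c"
    using f g cH eq[OF cH(1)] unfolding coequalizer_def by blast
  then show ?thesis by blast
qed

end

lemma cokernel_category_abelian:
  assumes "abelian_category C"
  shows "cokernel_category C" "cokernel_category (opposite C)"
proof -
  interpret abelian_category C by fact
  interpret op: preadditive_category "opposite C"
    by (rule preadditive_opposite) (rule preadditive_category_axioms)
  show "cokernel_category C"
    by standard (fact ex_cokernel, fact epic_is_cokernel)
  have "is_cokernel (opposite C) f k = is_kernel C f k" for f k
    unfolding is_cokernel_def is_kernel_def by auto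
  moreover have "epic (opposite C) f = monic C f" for f
    unfolding epic_def monic_def by auto
  ultimately show "cokernel_category (opposite C)"
    by unfold_locales (auto simp: ex_kernel monic_is_kernel)
qed

section \<open>Objects presented by free objects\<close>

text \<open>Objects \<open>L d\<close> are called free. The right adjoint \<open>S\<close> of \<open>R\<close> serves to make \<open>R\<close> preserve
  coequalizers.\<close>

locale free_presentation =
  A: cokernel_category A + D: preadditive_category D +
  LR: adjoint_functors D A L R \<eta> \<epsilon> + RS: adjoint_functors A D R S \<eta>' \<epsilon>'
  for A :: "('o, 'a) precat" and D :: "('p, 'b) precat" and L R S \<eta> \<epsilon> \<eta>' \<epsilon>' +
  assumes faithful: "faithful A R"
begin

abbreviation T :: "'o \<Rightarrow> 'o" where "T X \<equiv> FOb L (FOb R X)"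

text \<open>Arrows \<open>L d \<rightarrow> X\<close> are treated as elements of \<open>X\<close>, on which the arrows between free objects
  act from the right by composition.\<close>

abbreviation Elts :: "'p \<Rightarrow> 'o \<Rightarrow> 'a set" where "Elts d X \<equiv> Hom A (FOb L d) X"

lemma counit_cancel:
  assumes u: "u \<in> Hom A X Y" and v: "v \<in> Hom A X Y" and eq: "u \<cdot>\<^bsub>A\<^esub> \<epsilon> X = v \<cdot>\<^bsub>A\<^esub> \<epsilon> X"
  shows "u = v"
proof -
  have X: "X \<in> Ob A" "Y \<in> Ob A" using u A.Hom_Ob by blast+
  have "FAr R w = LR.transpose (FOb R X) (w \<cdot>\<^bsub>A\<^esub> \<epsilon> X)" if "w \<in> Hom A X Y" for w
    using LR.transpose_Comp_left[OF _ LR.counit_Hom[OF X(1)] that] X that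
    by (simp add: LR.transpose_counit Hom_iff)
  then have "FAr R u = FAr R v" using u v eq by simp
  then show ?thesis using faithful X u v by (auto simp: faithful_def dest: inj_onD)
qed

text \<open>The counit is epic, hence the cokernel of some \<open>k : W \<rightarrow> T X\<close>. If \<open>t\<close> equalizes the pair then
  \<open>t k \<epsilon>\<^sub>W = t \<epsilon>\<^sub>T\<^sub>X T k = t T(\<epsilon>\<^sub>X k) = 0\<close>, so \<open>t k = 0\<close> as \<open>\<epsilon>\<^sub>W\<close> is epic, and \<open>t\<close> factors through
  \<open>\<epsilon>\<^sub>X\<close>.\<close>

lemma presentation:
  assumes X: "X \<in> Ob A"
  shows "coequalizer A (T (T X)) (T X) X (FAr L (FAr R (\<epsilon> X))) (\<epsilon> (T X)) (\<epsilon> X)"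
proof -
  have "epic A (\<epsilon> X)"
    unfolding epic_def using X by (auto intro: counit_cancel)
  then obtain k where k: "is_cokernel A k (\<epsilon> X)" using A.epic_is_cokernel by blast
  define W where "W = Dom A k"
  have kH: "k \<in> Hom A W (T X)" and W: "W \<in> Ob A" and \<epsilon>k: "\<epsilon> X \<cdot>\<^bsub>A\<^esub> k = Zero A W X"
    using k X A.Dom_closed by (auto simp: is_cokernel_def Hom_iff W_def)
  have "\<exists>!u. u \<in> Hom A X Z \<and> u \<cdot>\<^bsub>A\<^esub> \<epsilon> X = t"
    if t: "t \<in> Hom A (T X) Z" and eq: "t \<cdot>\<^bsub>A\<^esub> FAr L (FAr R (\<epsilon> X)) = t \<cdot>\<^bsub>A\<^esub> \<epsilon> (T X)" for t Z
  proof -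
    have Z: "Z \<in> Ob A" using t A.Hom_Ob by blast
    have "(t \<cdot>\<^bsub>A\<^esub> k) \<cdot>\<^bsub>A\<^esub> \<epsilon> W = t \<cdot>\<^bsub>A\<^esub> (\<epsilon> (T X) \<cdot>\<^bsub>A\<^esub> FAr L (FAr R k))"
      using t kH X W by (simp add: LR.counit_natural[OF kH] Hom_iff)
    also have "\<dots> = (t \<cdot>\<^bsub>A\<^esub> FAr L (FAr R (\<epsilon> X))) \<cdot>\<^bsub>A\<^esub> FAr L (FAr R k)"
      unfolding eq using t kH X W by (simp add: Hom_iff)
    also have "\<dots> = t \<cdot>\<^bsub>A\<^esub> FAr L (FAr R (\<epsilon> X \<cdot>\<^bsub>A\<^esub> k))"
      using t kH X W by (simp add: Hom_iff LR.L.Comp LR.R.Comp)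
    also have "\<dots> = Zero A (T W) Z"
      using \<epsilon>k X W t by (simp add: LR.R.Zero LR.L.Zero A.Comp_Zero)
    also have "\<dots> = Zero A W Z \<cdot>\<^bsub>A\<^esub> \<epsilon> W"
      using A.Zero_Comp[OF Z LR.counit_Hom[OF W]] by simp
    finally have "t \<cdot>\<^bsub>A\<^esub> k = Zero A W Z"
      using counit_cancel A.Comp_closed[OF kH t] A.Zero_closed[OF W Z] by blast
    then show ?thesis
      using k t Z kH X unfolding is_cokernel_def by (auto simp: W_def Hom_iff)
  qed
  then show ?thesis
    using X LR.counit_natural[OF LR.counit_Hom[OF X]] LR.counit_Hom[of "T X"] LR.counit_Hom[of X]
      LR.L.Hom_closed[OF LR.R.Hom_closed[OF LR.counit_Hom[OF X]]]
    unfolding coequalizer_def by simp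
qed

text \<open>With \<open>F\<close> the identity this is a natural transformation between the restrictions of
  \<open>Hom(-, X)\<close> and \<open>Hom(-, Y)\<close> to the free objects.\<close>

definition semilinear :: "('p \<Rightarrow> 'p \<Rightarrow> 'a \<Rightarrow> 'a) \<Rightarrow> 'o \<Rightarrow> 'o \<Rightarrow> ('p \<Rightarrow> 'a \<Rightarrow> 'a) \<Rightarrow> bool" where
  "semilinear F X Y \<beta> \<longleftrightarrow> X \<in> Ob A \<and> Y \<in> Ob A \<and> (\<forall>d\<in>Ob D. \<beta> d \<in> Elts d X \<rightarrow> Elts d Y) \<and>
    (\<forall>d\<in>Ob D. \<forall>e\<in>Ob D. \<forall>w\<in>Elts d (FOb L e). \<forall>x\<in>Elts e X. \<beta> d (x \<cdot>\<^bsub>A\<^esub> w) = \<beta> e x \<cdot>\<^bsub>A\<^esub> F d e w)"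

text \<open>The restriction of \<open>Hom(-, Y)\<close> to the free objects is that of \<open>Hom(-, X)\<close> pulled back along
  the inverse of \<open>F\<close>.\<close>

definition twist :: "('p \<Rightarrow> 'p \<Rightarrow> 'a \<Rightarrow> 'a) \<Rightarrow> 'o \<Rightarrow> 'o \<Rightarrow> ('p \<Rightarrow> 'a \<Rightarrow> 'a) \<Rightarrow> bool" where
  "twist F X Y \<alpha> \<longleftrightarrow> semilinear F X Y \<alpha> \<and> (\<forall>d\<in>Ob D. bij_betw (\<alpha> d) (Elts d X) (Elts d Y))"

text \<open>An automorphism, identical on objects, of the category whose objects are those of \<open>D\<close> and
  whose arrows \<open>d \<rightarrow> e\<close> are those from \<open>L d\<close> to \<open>L e\<close> (the Kleisli category of the monad
  \<open>R L\<close>), fixing the arrows that come from \<open>D\<close>. The indices are kept because \<open>L\<close> may identify objects that \<open>F\<close>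
  distinguishes.\<close>

definition free_automorphism :: "('p \<Rightarrow> 'p \<Rightarrow> 'a \<Rightarrow> 'a) \<Rightarrow> bool" where
  "free_automorphism F \<longleftrightarrow>
    (\<forall>d\<in>Ob D. \<forall>e\<in>Ob D. bij_betw (F d e) (Elts d (FOb L e)) (Elts d (FOb L e))) \<and>
    (\<forall>d e. \<forall>g\<in>Hom D d e. F d e (FAr L g) = FAr L g) \<and>
    (\<forall>d\<in>Ob D. \<forall>e\<in>Ob D. \<forall>f\<in>Ob D. \<forall>w\<in>Elts d (FOb L e). \<forall>v\<in>Elts e (FOb L f).
      F d f (v \<cdot>\<^bsub>A\<^esub> w) = F e f v \<cdot>\<^bsub>A\<^esub> F d e w)"

lemma semilinearD:
  assumes "semilinear F X Y \<beta>"
  shows "X \<in> Ob A" "Y \<in> Ob A" "\<lbrakk>d \<in> Ob D; x \<in> Elts d X\<rbrakk> \<Longrightarrow> \<beta> d x \<in> Elts d Y"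
    "\<lbrakk>d \<in> Ob D; e \<in> Ob D; w \<in> Elts d (FOb L e); x \<in> Elts e X\<rbrakk> \<Longrightarrow> \<beta> d (x \<cdot>\<^bsub>A\<^esub> w) = \<beta> e x \<cdot>\<^bsub>A\<^esub> F d e w"
  using assms unfolding semilinear_def by blast+

lemma twistD:
  assumes "twist F X Y \<alpha>"
  shows "semilinear F X Y \<alpha>" "d \<in> Ob D \<Longrightarrow> bij_betw (\<alpha> d) (Elts d X) (Elts d Y)"
  using assms unfolding twist_def by blast+

lemma twist_surj:
  assumes "twist F X Y \<alpha>" "d \<in> Ob D" "y \<in> Elts d Y"
  obtains x where "x \<in> Elts d X" "y = \<alpha> d x"
  using bij_betw_imp_surj_on[OF twistD(2)[OF assms(1,2)]] assms(3) by blast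

lemma free_automorphismD:
  assumes "free_automorphism F"
  shows "\<lbrakk>d \<in> Ob D; e \<in> Ob D\<rbrakk> \<Longrightarrow> bij_betw (F d e) (Elts d (FOb L e)) (Elts d (FOb L e))"
    "g \<in> Hom D d e \<Longrightarrow> F d e (FAr L g) = FAr L g"
    "\<lbrakk>d \<in> Ob D; e \<in> Ob D; f \<in> Ob D; w \<in> Elts d (FOb L e); v \<in> Elts e (FOb L f)\<rbrakk>
      \<Longrightarrow> F d f (v \<cdot>\<^bsub>A\<^esub> w) = F e f v \<cdot>\<^bsub>A\<^esub> F d e w"
    "\<lbrakk>d \<in> Ob D; e \<in> Ob D; w \<in> Elts d (FOb L e)\<rbrakk> \<Longrightarrow> F d e w \<in> Elts d (FOb L e)"
  using assms unfolding free_automorphism_def by (blast dest: bij_betw_apply)+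

lemma free_automorphism_id: "free_automorphism (\<lambda>d e w. w)"
  unfolding free_automorphism_def by (auto simp: bij_betw_def)

definition inverse_automorphism :: "('p \<Rightarrow> 'p \<Rightarrow> 'a \<Rightarrow> 'a) \<Rightarrow> 'p \<Rightarrow> 'p \<Rightarrow> 'a \<Rightarrow> 'a" where
  "inverse_automorphism F d e = inv_into (Elts d (FOb L e)) (F d e)"

lemma inverse_automorphism:
  assumes F: "free_automorphism F"
  shows "\<lbrakk>d \<in> Ob D; e \<in> Ob D; w \<in> Elts d (FOb L e)\<rbrakk> \<Longrightarrow> inverse_automorphism F d e (F d e w) = w"
    and "\<lbrakk>d \<in> Ob D; e \<in> Ob D; w \<in> Elts d (FOb L e)\<rbrakk> \<Longrightarrow> F d e (inverse_automorphism F d e w) = w"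
    and "free_automorphism (inverse_automorphism F)"
proof -
  let ?G = "inverse_automorphism F"
  show l: "?G d e (F d e w) = w" if "d \<in> Ob D" "e \<in> Ob D" "w \<in> Elts d (FOb L e)" for d e w
    using bij_betw_inv_into_left[OF free_automorphismD(1)[OF F that(1,2)] that(3)]
    by (simp add: inverse_automorphism_def)
  show r: "F d e (?G d e w) = w" if "d \<in> Ob D" "e \<in> Ob D" "w \<in> Elts d (FOb L e)" for d e w
    using bij_betw_inv_into_right[OF free_automorphismD(1)[OF F that(1,2)] that(3)]
    by (simp add: inverse_automorphism_def)
  have b: "bij_betw (?G d e) (Elts d (FOb L e)) (Elts d (FOb L e))" if "d \<in> Ob D" "e \<in> Ob D" for d e
    using bij_betw_inv_into[OF free_automorphismD(1)[OF F that]] by (simp add: inverse_automorphism_def)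
  note c = bij_betw_apply[OF b]
  have "?G d e (FAr L g) = FAr L g" if g: "g \<in> Hom D d e" for d e g
  proof -
    have "d \<in> Ob D" "e \<in> Ob D" using g D.Hom_Ob by blast+
    then show ?thesis using l[OF _ _ LR.L.Hom_closed[OF g]] free_automorphismD(2)[OF F g] by simp
  qed
  moreover have "?G d f (v \<cdot>\<^bsub>A\<^esub> w) = ?G e f v \<cdot>\<^bsub>A\<^esub> ?G d e w"
    if "d \<in> Ob D" "e \<in> Ob D" "f \<in> Ob D" "w \<in> Elts d (FOb L e)" "v \<in> Elts e (FOb L f)" for d e f w v
  proof -
    have "F d f (?G e f v \<cdot>\<^bsub>A\<^esub> ?G d e w) = v \<cdot>\<^bsub>A\<^esub> w"
      using free_automorphismD(3)[OF F that(1-3) c[OF that(1,2,4)] c[OF that(2,3,5)]] that r by simp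
    then show ?thesis
      using l[OF that(1,3) A.Comp_closed[OF c[OF that(1,2,4)] c[OF that(2,3,5)]]] by simp
  qed
  ultimately show "free_automorphism ?G"
    using b unfolding free_automorphism_def by blast
qed

lemma eq_if_eq_on_free:
  assumes u: "u \<in> Hom A X Y" and v: "v \<in> Hom A X Y"
    and eq: "\<And>d x. \<lbrakk>d \<in> Ob D; x \<in> Elts d X\<rbrakk> \<Longrightarrow> u \<cdot>\<^bsub>A\<^esub> x = v \<cdot>\<^bsub>A\<^esub> x"
  shows "u = v"
proof -
  have X: "X \<in> Ob A" using u A.Hom_Ob by blast
  show ?thesis using counit_cancel[OF u v eq[OF _ LR.counit_Hom[OF X]]] X by simp
qed

lemma eq_if_eq_on_twist:
  assumes t: "twist F X Y \<alpha>" and u: "u \<in> Hom A Y Z" and v: "v \<in> Hom A Y Z"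
    and eq: "\<And>d x. \<lbrakk>d \<in> Ob D; x \<in> Elts d X\<rbrakk> \<Longrightarrow> u \<cdot>\<^bsub>A\<^esub> \<alpha> d x = v \<cdot>\<^bsub>A\<^esub> \<alpha> d x"
  shows "u = v"
  by (rule eq_if_eq_on_free[OF u v]) (metis twist_surj[OF t] eq)

text \<open>The free objects are dense: the value of \<open>\<beta>\<close> at the counit \<open>\<epsilon>\<^sub>X\<close>, the universal element,
  equalizes the presentation of \<open>X\<close> and so factors through \<open>\<epsilon>\<^sub>X\<close>.\<close>

lemma representable:
  assumes \<beta>: "semilinear (\<lambda>d e w. w) X Y \<beta>"
  obtains u where "u \<in> Hom A X Y" "\<And>d x. \<lbrakk>d \<in> Ob D; x \<in> Elts d X\<rbrakk> \<Longrightarrow> \<beta> d x = u \<cdot>\<^bsub>A\<^esub> x"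
proof -
  note b = semilinearD[OF \<beta>]
  have X: "X \<in> Ob A" by (rule b)
  then have ob: "FOb R X \<in> Ob D" "T X \<in> Ob A" "FOb R (T X) \<in> Ob D" by simp_all
  let ?b = "\<beta> (FOb R X) (\<epsilon> X)"
  have e: "\<epsilon> X \<in> Elts (FOb R X) X" using LR.counit_Hom[OF X] .
  have Te: "FAr L (FAr R (\<epsilon> X)) \<in> Elts (FOb R (T X)) (T X)"
    using LR.L.Hom_closed[OF LR.R.Hom_closed[OF e]] .
  have "?b \<cdot>\<^bsub>A\<^esub> FAr L (FAr R (\<epsilon> X)) = ?b \<cdot>\<^bsub>A\<^esub> \<epsilon> (T X)"
    using b(4)[OF ob(3,1) Te e] b(4)[OF ob(3,1) LR.counit_Hom[OF ob(2)] e] LR.counit_natural[OF e] by simp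
  then obtain u where u: "u \<in> Hom A X Y" "u \<cdot>\<^bsub>A\<^esub> \<epsilon> X = ?b"
    using coequalizer_factor[OF presentation[OF X] b(3)[OF ob(1) e]] by blast
  have "\<beta> d x = u \<cdot>\<^bsub>A\<^esub> x" if d: "d \<in> Ob D" and x: "x \<in> Elts d X" for d x
  proof -
    let ?g = "FAr L (LR.transpose d x)"
    have g: "?g \<in> Elts d (T X)" using LR.L.Hom_closed[OF LR.transpose_Hom[OF d x]] .
    have xe: "\<epsilon> X \<cdot>\<^bsub>A\<^esub> ?g = x" using LR.counit_transpose[OF d x] .
    have "\<beta> d x = ?b \<cdot>\<^bsub>A\<^esub> ?g" using b(4)[OF d ob(1) g e] xe by simp
    also have "\<dots> = u \<cdot>\<^bsub>A\<^esub> (\<epsilon> X \<cdot>\<^bsub>A\<^esub> ?g)" unfolding u(2)[symmetric] using A.Comp_assoc[OF g e u(1)] .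
    finally show ?thesis unfolding xe .
  qed
  then show ?thesis using that u(1) by blast
qed

text \<open>In the presentation of \<open>X\<close> replace \<open>\<epsilon>\<^sub>T\<^sub>X\<close> by \<open>F \<epsilon>\<^sub>T\<^sub>X\<close>, and let \<open>c : T X \<rightarrow> Y\<close> be the
  coequalizer. Since \<open>F\<close> fixes the arrows \<open>L g\<close>, the assignment \<open>\<alpha>(x) = c \<cdot> L x\<^sup>b\<close>, with
  \<open>x\<^sup>b : d \<rightarrow> R X\<close> the transpose of \<open>x\<close>, is semilinear. In terms of transposes \<open>\<alpha>\<close> is composition
  with the transpose \<open>\<omega> : R X \<rightarrow> R Y\<close> of \<open>c\<close>, so it remains to invert \<open>\<omega>\<close>. As \<open>R\<close> preserves
  the coequalizer, the inverse \<open>\<kappa>\<close> is induced by the map \<open>\<theta> : R T X \<rightarrow> R X\<close> that sends the transpose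
  of \<open>w\<close> to that of \<open>\<epsilon>\<^sub>X \<cdot> F\<^sup>-\<^sup>1(w)\<close>.\<close>

lemma ex_twist:
  assumes F: "free_automorphism F" and X: "X \<in> Ob A"
  shows "\<exists>Y \<alpha>. twist F X Y \<alpha>"
proof -
  define G where "G = inverse_automorphism F"
  note G = inverse_automorphism[OF F, folded G_def]
  note Fd = free_automorphismD[OF F] and Gd = free_automorphismD[OF G(3)]
  \<comment> \<open>So \<open>T X = L a\<close> and \<open>T (T X) = L b\<close>: both are visibly free, with indices for \<open>F\<close>.\<close>
  define a where "a = FOb R X"
  define b where "b = FOb R (T X)"
  have a: "a \<in> Ob D" and b: "b \<in> Ob D" and TX: "FOb L a \<in> Ob A" "T X = FOb L a"
    using X by (auto simp: a_def b_def)
  have e: "\<epsilon> X \<in> Elts a X" using LR.counit_Hom[OF X] by (simp add: a_def)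
  define e1 where "e1 = \<epsilon> (FOb L a)"
  have e1: "e1 \<in> Elts b (FOb L a)" using LR.counit_Hom[OF TX(1)] by (simp add: e1_def b_def a_def)
  have Re: "FAr R (\<epsilon> X) \<in> Hom D b a" using LR.R.Hom_closed[OF e] by (simp add: a_def b_def)
  have Te: "FAr L (FAr R (\<epsilon> X)) \<in> Elts b (FOb L a)" using LR.L.Hom_closed[OF Re] .
  obtain Y c where co: "coequalizer A (FOb L b) (FOb L a) Y (FAr L (FAr R (\<epsilon> X))) (F b a e1) c"
    using A.ex_coequalizer[OF Te Fd(4)[OF b a e1]] by blast
  have c: "c \<in> Hom A (FOb L a) Y" and ceq: "c \<cdot>\<^bsub>A\<^esub> FAr L (FAr R (\<epsilon> X)) = c \<cdot>\<^bsub>A\<^esub> F b a e1"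
    using co by (auto simp: coequalizer_def)
  have Y: "Y \<in> Ob A" using c A.Hom_Ob by blast
  define \<alpha> where "\<alpha> d x = c \<cdot>\<^bsub>A\<^esub> FAr L (LR.transpose d x)" for d x
  have tr: "LR.transpose d x \<in> Hom D d a" if "d \<in> Ob D" "x \<in> Elts d X" for d x
    using LR.transpose_Hom[OF that] by (simp add: a_def)
  have \<alpha>H: "\<alpha> d x \<in> Elts d Y" if "d \<in> Ob D" "x \<in> Elts d X" for d x
    unfolding \<alpha>_def using A.Comp_closed[OF LR.L.Hom_closed[OF tr[OF that]] c] .
  have \<alpha>F: "\<alpha> d (x \<cdot>\<^bsub>A\<^esub> w) = \<alpha> e' x \<cdot>\<^bsub>A\<^esub> F d e' w"
    if d: "d \<in> Ob D" and e': "e' \<in> Ob D" and w: "w \<in> Elts d (FOb L e')" and x: "x \<in> Elts e' X" for d e' w x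
  proof -
    define k where "k = FOb R (FOb L e')"
    define g where "g = LR.transpose e' x"
    define h where "h = LR.transpose d w"
    have k: "k \<in> Ob D" and Le: "FOb L e' \<in> Ob A" using e' by (auto simp: k_def)
    have g: "g \<in> Hom D e' a" using tr[OF e' x] by (simp add: g_def)
    have h: "h \<in> Hom D d k" using LR.transpose_Hom[OF d w] by (simp add: h_def k_def)
    have z: "\<epsilon> (FOb L e') \<in> Elts k (FOb L e')" using LR.counit_Hom[OF Le] by (simp add: k_def)
    have Lg: "FAr L g \<in> Elts e' (FOb L a)" and Lh: "FAr L h \<in> Elts d (FOb L k)"
      using LR.L.Hom_closed g h by blast+
    have RLg: "FAr R (FAr L g) \<in> Hom D k b" using LR.R.Hom_closed[OF Lg] by (simp add: k_def b_def a_def)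
    have LRLg: "FAr L (FAr R (FAr L g)) \<in> Elts k (FOb L b)" using LR.L.Hom_closed[OF RLg] .
    have nat: "e1 \<cdot>\<^bsub>A\<^esub> FAr L (FAr R (FAr L g)) = FAr L g \<cdot>\<^bsub>A\<^esub> \<epsilon> (FOb L e')"
      using LR.counit_natural[OF Lg] by (simp add: e1_def)
    have "FAr R x = FAr R (\<epsilon> X) \<cdot>\<^bsub>D\<^esub> FAr R (FAr L g)"
      using LR.R.Comp[of "FAr L g" "\<epsilon> X"] LR.counit_transpose[OF e' x] Lg e by (auto simp: g_def Hom_iff)
    moreover have "LR.transpose d (x \<cdot>\<^bsub>A\<^esub> w) = FAr R x \<cdot>\<^bsub>D\<^esub> h"
      using LR.transpose_Comp_left[OF d w x] by (simp add: h_def)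
    ultimately have "\<alpha> d (x \<cdot>\<^bsub>A\<^esub> w) = (c \<cdot>\<^bsub>A\<^esub> FAr L (FAr R (\<epsilon> X))) \<cdot>\<^bsub>A\<^esub> (FAr L (FAr R (FAr L g)) \<cdot>\<^bsub>A\<^esub> FAr L h)"
      using c Te LRLg Lh Re RLg h unfolding \<alpha>_def by (simp add: LR.L.Comp Hom_iff)
    also have "\<dots> = c \<cdot>\<^bsub>A\<^esub> ((F b a e1 \<cdot>\<^bsub>A\<^esub> FAr L (FAr R (FAr L g))) \<cdot>\<^bsub>A\<^esub> FAr L h)"
      unfolding ceq using c LRLg Lh Fd(4)[OF b a e1] by (simp add: Hom_iff)
    also have "F b a e1 \<cdot>\<^bsub>A\<^esub> FAr L (FAr R (FAr L g)) = F k a (FAr L g \<cdot>\<^bsub>A\<^esub> \<epsilon> (FOb L e'))"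
      using Fd(3)[OF k b a LRLg e1] Fd(2)[OF RLg] nat by simp
    also have "\<dots> = FAr L g \<cdot>\<^bsub>A\<^esub> F k e' (\<epsilon> (FOb L e'))"
      using Fd(3)[OF k e' a z Lg] Fd(2)[OF g] by simp
    also have "c \<cdot>\<^bsub>A\<^esub> ((FAr L g \<cdot>\<^bsub>A\<^esub> F k e' (\<epsilon> (FOb L e'))) \<cdot>\<^bsub>A\<^esub> FAr L h) =
        \<alpha> e' x \<cdot>\<^bsub>A\<^esub> (F k e' (\<epsilon> (FOb L e')) \<cdot>\<^bsub>A\<^esub> FAr L h)"
      using c Lg Lh Fd(4)[OF k e' z] by (simp add: \<alpha>_def g_def[symmetric] Hom_iff)
    also have "F k e' (\<epsilon> (FOb L e')) \<cdot>\<^bsub>A\<^esub> FAr L h = F d e' w"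
      using Fd(3)[OF d k e' Lh z] Fd(2)[OF h] LR.counit_transpose[OF d w] by (simp add: h_def)
    finally show ?thesis .
  qed
  have sl: "semilinear F X Y \<alpha>"
    unfolding semilinear_def using X Y \<alpha>H \<alpha>F by blast
  define \<theta> where "\<theta> = LR.transpose b (\<epsilon> X \<cdot>\<^bsub>A\<^esub> G b a e1)"
  define \<omega> where "\<omega> = LR.transpose a c"
  have Ge1: "\<epsilon> X \<cdot>\<^bsub>A\<^esub> G b a e1 \<in> Elts b X" using A.Comp_closed[OF Gd(4)[OF b a e1] e] .
  have \<theta>: "\<theta> \<in> Hom D b a" using tr[OF b Ge1] by (simp add: \<theta>_def)
  have \<omega>: "\<omega> \<in> Hom D a (FOb R Y)" using LR.transpose_Hom[OF a c] by (simp add: \<omega>_def)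
  \<comment> \<open>The characterisation of \<open>\<theta>\<close>; its definition is the case where \<open>w\<close> is the counit.\<close>
  have \<theta>w: "\<theta> \<cdot>\<^bsub>D\<^esub> LR.transpose d w = LR.transpose d (\<epsilon> X \<cdot>\<^bsub>A\<^esub> G d a w)"
    if d: "d \<in> Ob D" and w: "w \<in> Elts d (FOb L a)" for d w
  proof -
    let ?h = "LR.transpose d w"
    have h: "?h \<in> Hom D d b" using LR.transpose_Hom[OF d w] by (simp add: b_def a_def)
    have Lh: "FAr L ?h \<in> Elts d (FOb L b)" using LR.L.Hom_closed[OF h] .
    have "w = e1 \<cdot>\<^bsub>A\<^esub> FAr L ?h" using LR.counit_transpose[OF d w] by (simp add: e1_def)
    then have "G d a w = G b a e1 \<cdot>\<^bsub>A\<^esub> FAr L ?h"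
      using Gd(3)[OF d b a Lh e1] Gd(2)[OF h] by simp
    then have "LR.transpose d (\<epsilon> X \<cdot>\<^bsub>A\<^esub> G d a w) = LR.transpose d ((\<epsilon> X \<cdot>\<^bsub>A\<^esub> G b a e1) \<cdot>\<^bsub>A\<^esub> FAr L ?h)"
      using A.Comp_assoc[OF Lh Gd(4)[OF b a e1] e] by simp
    also have "\<dots> = \<theta> \<cdot>\<^bsub>D\<^esub> ?h" using LR.transpose_Comp_right[OF Ge1 h] by (simp add: \<theta>_def)
    finally show ?thesis by simp
  qed
  have \<omega>x: "LR.transpose d (\<alpha> d x) = \<omega> \<cdot>\<^bsub>D\<^esub> LR.transpose d x" if "d \<in> Ob D" "x \<in> Elts d X" for d x
    using LR.transpose_Comp_right[OF c tr[OF that]] by (simp add: \<alpha>_def \<omega>_def)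
  \<comment> \<open>Every \<open>R v\<close> is itself a transpose, so the preceding fact computes \<open>\<theta> \<cdot> R v\<close>.\<close>
  have \<theta>R: "\<theta> \<cdot>\<^bsub>D\<^esub> FAr R v = LR.transpose (FOb R (FOb L b)) ((\<epsilon> X \<cdot>\<^bsub>A\<^esub> G b a v) \<cdot>\<^bsub>A\<^esub> G (FOb R (FOb L b)) b (\<epsilon> (FOb L b)))"
    if v: "v \<in> Elts b (FOb L a)" for v
  proof -
    let ?k = "FOb R (FOb L b)" and ?z = "\<epsilon> (FOb L b)"
    have k: "?k \<in> Ob D" "FOb L b \<in> Ob A" using b by auto
    have z: "?z \<in> Elts ?k (FOb L b)" using LR.counit_Hom[OF k(2)] .
    have "FAr R v = LR.transpose ?k (v \<cdot>\<^bsub>A\<^esub> ?z)"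
      using LR.transpose_Comp_left[OF k(1) z v] k v by (simp add: LR.transpose_counit Hom_iff)
    then show ?thesis
      using \<theta>w[OF k(1) A.Comp_closed[OF z v]] Gd(3)[OF k(1) b a z v]
        A.Comp_assoc[OF Gd(4)[OF k(1) b z] Gd(4)[OF b a v] e] by simp
  qed
  have "\<epsilon> X \<cdot>\<^bsub>A\<^esub> FAr L (FAr R (\<epsilon> X)) = \<epsilon> X \<cdot>\<^bsub>A\<^esub> e1"
    using LR.counit_natural[OF e] by (simp add: e1_def)
  then have "\<theta> \<cdot>\<^bsub>D\<^esub> FAr R (FAr L (FAr R (\<epsilon> X))) = \<theta> \<cdot>\<^bsub>D\<^esub> FAr R (F b a e1)"
    using \<theta>R[OF Te] \<theta>R[OF Fd(4)[OF b a e1]] Gd(2)[OF Re] G(1)[OF b a e1] by simp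
  moreover have Rco: "coequalizer D (FOb R (FOb L b)) b (FOb R Y) (FAr R (FAr L (FAr R (\<epsilon> X)))) (FAr R (F b a e1)) (FAr R c)"
    using RS.left_preserves_coequalizers co unfolding preserves_coequalizers_def by (simp add: b_def a_def)
  ultimately obtain \<kappa> where \<kappa>: "\<kappa> \<in> Hom D (FOb R Y) a" "\<kappa> \<cdot>\<^bsub>D\<^esub> FAr R c = \<theta>"
    using coequalizer_factor \<theta> by metis
  have Rc: "FAr R c \<in> Hom D b (FOb R Y)" using LR.R.Hom_closed[OF c] by (simp add: b_def a_def)
  have \<kappa>\<omega>: "\<kappa> \<cdot>\<^bsub>D\<^esub> \<omega> = Idn D a"
  proof -
    have i: "Idn A (FOb L a) \<in> Elts a (FOb L a)" using TX(1) by (simp add: Hom_iff)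
    have "\<kappa> \<cdot>\<^bsub>D\<^esub> \<omega> = (\<kappa> \<cdot>\<^bsub>D\<^esub> FAr R c) \<cdot>\<^bsub>D\<^esub> LR.transpose a (Idn A (FOb L a))"
      using LR.transpose_Comp_left[OF a i c] LR.transpose_Hom[OF a i] c \<kappa>(1) Rc
      by (simp add: \<omega>_def Hom_iff b_def a_def)
    also have "\<dots> = LR.transpose a (\<epsilon> X \<cdot>\<^bsub>A\<^esub> G a a (Idn A (FOb L a)))"
      using \<theta>w[OF a i] \<kappa>(2) by simp
    also have "G a a (Idn A (FOb L a)) = Idn A (FOb L a)"
      using Gd(2)[of "Idn D a" a a] a by (simp add: Hom_iff)
    also have "\<epsilon> X \<cdot>\<^bsub>A\<^esub> Idn A (FOb L a) = \<epsilon> X" using e by (simp add: Hom_iff)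
    finally show ?thesis using LR.transpose_counit[OF X] by (simp add: a_def)
  qed
  have \<omega>\<kappa>: "\<omega> \<cdot>\<^bsub>D\<^esub> \<kappa> = Idn D (FOb R Y)"
  proof -
    have \<alpha>e: "\<alpha> a (\<epsilon> X) = c"
      using LR.transpose_counit[OF X] c a by (simp add: \<alpha>_def a_def Hom_iff)
    have "(\<omega> \<cdot>\<^bsub>D\<^esub> \<kappa>) \<cdot>\<^bsub>D\<^esub> FAr R c = \<omega> \<cdot>\<^bsub>D\<^esub> \<theta>" using D.Comp_assoc[OF Rc \<kappa>(1) \<omega>] \<kappa>(2) by simp
    also have "\<dots> = LR.transpose b (\<alpha> b (\<epsilon> X \<cdot>\<^bsub>A\<^esub> G b a e1))"
      using \<omega>x[OF b Ge1] by (simp add: \<theta>_def)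
    also have "\<alpha> b (\<epsilon> X \<cdot>\<^bsub>A\<^esub> G b a e1) = c \<cdot>\<^bsub>A\<^esub> e1"
      using \<alpha>F[OF b a Gd(4)[OF b a e1] e] G(2)[OF b a e1] \<alpha>e by simp
    also have "LR.transpose b (c \<cdot>\<^bsub>A\<^esub> e1) = FAr R c"
      using LR.transpose_Comp_left[OF b e1 c] LR.transpose_counit[OF TX(1)] Rc
      by (simp add: e1_def b_def a_def Hom_iff)
    finally have "(\<omega> \<cdot>\<^bsub>D\<^esub> \<kappa>) \<cdot>\<^bsub>D\<^esub> FAr R c = Idn D (FOb R Y) \<cdot>\<^bsub>D\<^esub> FAr R c" using Rc by (simp add: Hom_iff)
    then show ?thesis
      using D.coequalizer_cancel[OF Rco D.Comp_closed[OF \<kappa>(1) \<omega>]] Y D.Idn_closed by simp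
  qed
  have "bij_betw (\<alpha> d) (Elts d X) (Elts d Y)" if d: "d \<in> Ob D" for d
  proof (rule bij_betw_byWitness[where f' = "\<lambda>y. \<epsilon> X \<cdot>\<^bsub>A\<^esub> FAr L (\<kappa> \<cdot>\<^bsub>D\<^esub> LR.transpose d y)"])
    have h: "\<kappa> \<cdot>\<^bsub>D\<^esub> LR.transpose d y \<in> Hom D d a" if "y \<in> Elts d Y" for y
      using D.Comp_closed[OF LR.transpose_Hom[OF d that] \<kappa>(1)] .
    show sub: "(\<lambda>y. \<epsilon> X \<cdot>\<^bsub>A\<^esub> FAr L (\<kappa> \<cdot>\<^bsub>D\<^esub> LR.transpose d y)) ` Elts d Y \<subseteq> Elts d X"
      using A.Comp_closed[OF LR.L.Hom_closed[OF h] e] by blast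
    show "\<alpha> d ` Elts d X \<subseteq> Elts d Y" using \<alpha>H[OF d] by blast
    show "\<forall>x\<in>Elts d X. \<epsilon> X \<cdot>\<^bsub>A\<^esub> FAr L (\<kappa> \<cdot>\<^bsub>D\<^esub> LR.transpose d (\<alpha> d x)) = x"
    proof
      fix x assume x: "x \<in> Elts d X"
      have "\<kappa> \<cdot>\<^bsub>D\<^esub> LR.transpose d (\<alpha> d x) = LR.transpose d x"
        using \<omega>x[OF d x] D.Comp_assoc[OF tr[OF d x] \<omega> \<kappa>(1)] \<kappa>\<omega> tr[OF d x] by (simp add: Hom_iff)
      then show "\<epsilon> X \<cdot>\<^bsub>A\<^esub> FAr L (\<kappa> \<cdot>\<^bsub>D\<^esub> LR.transpose d (\<alpha> d x)) = x"
        using LR.counit_transpose[OF d x] by simp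
    qed
    show "\<forall>y\<in>Elts d Y. \<alpha> d (\<epsilon> X \<cdot>\<^bsub>A\<^esub> FAr L (\<kappa> \<cdot>\<^bsub>D\<^esub> LR.transpose d y)) = y"
    proof
      fix y assume y: "y \<in> Elts d Y"
      let ?x = "\<epsilon> X \<cdot>\<^bsub>A\<^esub> FAr L (\<kappa> \<cdot>\<^bsub>D\<^esub> LR.transpose d y)"
      have x: "?x \<in> Elts d X" using sub y by blast
      have "LR.transpose d (\<alpha> d ?x) = \<omega> \<cdot>\<^bsub>D\<^esub> (\<kappa> \<cdot>\<^bsub>D\<^esub> LR.transpose d y)"
        using \<omega>x[OF d x] LR.transpose_counit_Comp[of "\<kappa> \<cdot>\<^bsub>D\<^esub> LR.transpose d y" d X] h[OF y] X by (simp add: a_def)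
      also have "\<dots> = LR.transpose d y"
        using D.Comp_assoc[OF LR.transpose_Hom[OF d y] \<kappa>(1) \<omega>] \<omega>\<kappa> LR.transpose_Hom[OF d y] by (simp add: Hom_iff)
      finally show "\<alpha> d ?x = y" using LR.transpose_inject[OF d \<alpha>H[OF d x] y] by simp
    qed
  qed
  then show ?thesis using sl unfolding twist_def by blast
qed

end

section \<open>Twisting by an automorphism of the free objects\<close>

context free_presentation
begin

text \<open>Conjugating \<open>u\<close> by the two twists gives a map on elements in which \<open>F\<close> cancels against its
  inverse; it is therefore linear and comes from an arrow.\<close>

lemma twist_arrow:
  assumes F: "free_automorphism F" and t: "twist F X Y \<alpha>" and t': "twist F X' Y' \<alpha>'"
    and u: "u \<in> Hom A X X'"
  obtains v where "v \<in> Hom A Y Y'" "\<And>d x. \<lbrakk>d \<in> Ob D; x \<in> Elts d X\<rbrakk> \<Longrightarrow> v \<cdot>\<^bsub>A\<^esub> \<alpha> d x = \<alpha>' d (u \<cdot>\<^bsub>A\<^esub> x)"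
proof -
  note b = twistD(2)[OF t] and s = semilinearD[OF twistD(1)[OF t]] and s' = semilinearD[OF twistD(1)[OF t']]
  define \<beta> where "\<beta> d y = \<alpha>' d (u \<cdot>\<^bsub>A\<^esub> inv_into (Elts d X) (\<alpha> d) y)" for d y
  note Gc = free_automorphismD(4)[OF inverse_automorphism(3)[OF F]]
  have \<beta>: "\<beta> d (\<alpha> d x) = \<alpha>' d (u \<cdot>\<^bsub>A\<^esub> x)" if "d \<in> Ob D" "x \<in> Elts d X" for d x
    using bij_betw_inv_into_left[OF b[OF that(1)] that(2)] by (simp add: \<beta>_def)
  have "\<beta> d y \<in> Elts d Y'" if d: "d \<in> Ob D" and y: "y \<in> Elts d Y" for d y
    using twist_surj[OF t d y] \<beta>[OF d] s'(3)[OF d] A.Comp_closed[OF _ u] by metis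
  moreover have "\<beta> d (y \<cdot>\<^bsub>A\<^esub> w) = \<beta> e y \<cdot>\<^bsub>A\<^esub> w"
    if d: "d \<in> Ob D" and e: "e \<in> Ob D" and w: "w \<in> Elts d (FOb L e)" and y: "y \<in> Elts e Y" for d e w y
  proof -
    obtain x where x: "x \<in> Elts e X" "y = \<alpha> e x" using twist_surj[OF t e y] .
    define w' where "w' = inverse_automorphism F d e w"
    have w': "w' \<in> Elts d (FOb L e)" "F d e w' = w"
      using Gc[OF d e w] inverse_automorphism(2)[OF F d e w] by (auto simp: w'_def)
    have "\<beta> d (y \<cdot>\<^bsub>A\<^esub> w) = \<alpha>' d (u \<cdot>\<^bsub>A\<^esub> (x \<cdot>\<^bsub>A\<^esub> w'))"
      using s(4)[OF d e w'(1) x(1)] w'(2) x(2) \<beta>[OF d A.Comp_closed[OF w'(1) x(1)]] by simp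
    also have "\<dots> = \<beta> e y \<cdot>\<^bsub>A\<^esub> w"
      using A.Comp_assoc[OF w'(1) x(1) u] s'(4)[OF d e w'(1) A.Comp_closed[OF x(1) u]] w'(2) x(2) \<beta>[OF e x(1)]
      by simp
    finally show ?thesis .
  qed
  ultimately have "semilinear (\<lambda>d e w. w) Y Y' \<beta>"
    using s(2) s'(2) unfolding semilinear_def by auto
  then obtain v where "v \<in> Hom A Y Y'" "\<And>d y. \<lbrakk>d \<in> Ob D; y \<in> Elts d Y\<rbrakk> \<Longrightarrow> \<beta> d y = v \<cdot>\<^bsub>A\<^esub> y"
    using representable by blast
  then show ?thesis using that \<beta> s(3) by metis
qed

lemma twist_unique:
  assumes F: "free_automorphism F" and t: "twist F X Y \<alpha>" and t': "twist F X Y' \<alpha>'"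
  obtains v where "v \<in> Hom A Y Y'" "is_iso A v" "\<And>d x. \<lbrakk>d \<in> Ob D; x \<in> Elts d X\<rbrakk> \<Longrightarrow> v \<cdot>\<^bsub>A\<^esub> \<alpha> d x = \<alpha>' d x"
proof -
  note s = semilinearD[OF twistD(1)[OF t]] and s' = semilinearD[OF twistD(1)[OF t']]
  have i: "Idn A X \<in> Hom A X X" using A.Idn_closed s(1) by blast
  obtain v where v: "v \<in> Hom A Y Y'" "\<And>d x. \<lbrakk>d \<in> Ob D; x \<in> Elts d X\<rbrakk> \<Longrightarrow> v \<cdot>\<^bsub>A\<^esub> \<alpha> d x = \<alpha>' d (Idn A X \<cdot>\<^bsub>A\<^esub> x)"
    using twist_arrow[OF F t t' i] by blast
  obtain v' where v': "v' \<in> Hom A Y' Y" "\<And>d x. \<lbrakk>d \<in> Ob D; x \<in> Elts d X\<rbrakk> \<Longrightarrow> v' \<cdot>\<^bsub>A\<^esub> \<alpha>' d x = \<alpha> d (Idn A X \<cdot>\<^bsub>A\<^esub> x)"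
    using twist_arrow[OF F t' t i] by blast
  have e: "v \<cdot>\<^bsub>A\<^esub> \<alpha> d x = \<alpha>' d x" "v' \<cdot>\<^bsub>A\<^esub> \<alpha>' d x = \<alpha> d x" if "d \<in> Ob D" "x \<in> Elts d X" for d x
    using v(2)[OF that] v'(2)[OF that] A.Idn_left[OF that(2)] by auto
  have "v' \<cdot>\<^bsub>A\<^esub> v = Idn A Y"
  proof (rule eq_if_eq_on_twist[OF t A.Comp_closed[OF v(1) v'(1)] A.Idn_closed[OF s(2)]])
    fix d x assume d: "d \<in> Ob D" and x: "x \<in> Elts d X"
    show "(v' \<cdot>\<^bsub>A\<^esub> v) \<cdot>\<^bsub>A\<^esub> \<alpha> d x = Idn A Y \<cdot>\<^bsub>A\<^esub> \<alpha> d x"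
      using A.Comp_assoc[OF s(3)[OF d x] v(1) v'(1)] e[OF d x] A.Idn_left[OF s(3)[OF d x]] by simp
  qed
  moreover have "v \<cdot>\<^bsub>A\<^esub> v' = Idn A Y'"
  proof (rule eq_if_eq_on_twist[OF t' A.Comp_closed[OF v'(1) v(1)] A.Idn_closed[OF s'(2)]])
    fix d x assume d: "d \<in> Ob D" and x: "x \<in> Elts d X"
    show "(v \<cdot>\<^bsub>A\<^esub> v') \<cdot>\<^bsub>A\<^esub> \<alpha>' d x = Idn A Y' \<cdot>\<^bsub>A\<^esub> \<alpha>' d x"
      using A.Comp_assoc[OF s'(3)[OF d x] v'(1) v(1)] e[OF d x] A.Idn_left[OF s'(3)[OF d x]] by simp
  qed
  ultimately show ?thesis using that v(1) v'(1) e(1) A.is_isoI by blast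
qed

lemma twist_free:
  assumes F: "free_automorphism F" and e: "e \<in> Ob D"
  shows "twist F (FOb L e) (FOb L e) (\<lambda>d. F d e)"
  using e free_automorphismD[OF F] unfolding twist_def semilinear_def by auto

lemma twist_refl: "X \<in> Ob A \<Longrightarrow> twist (\<lambda>d e w. w) X X (\<lambda>d x. x)"
  unfolding twist_def semilinear_def by (auto simp: bij_betw_def)

text \<open>A free object is its own twist, by \<open>F\<close> itself. Choosing this one makes the twisting functor
  fix the free objects on the nose. The elements need an index \<open>d\<close> with \<open>X = L d\<close>, and
  \<open>inv_into\<close> picks one.\<close>

definition chosen_twist :: "('p \<Rightarrow> 'p \<Rightarrow> 'a \<Rightarrow> 'a) \<Rightarrow> 'o \<Rightarrow> 'o \<times> ('p \<Rightarrow> 'a \<Rightarrow> 'a)" where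
  "chosen_twist F X =
    (if X \<in> FOb L ` Ob D then (X, \<lambda>d. F d (inv_into (Ob D) (FOb L) X))
     else (SOME p. twist F X (fst p) (snd p)))"

definition twist_ob where "twist_ob F X = fst (chosen_twist F X)"
definition twist_el where "twist_el F X = snd (chosen_twist F X)"

lemma chosen_twist:
  assumes F: "free_automorphism F" and X: "X \<in> Ob A"
  shows "twist F X (twist_ob F X) (twist_el F X)"
proof (cases "X \<in> FOb L ` Ob D")
  case True
  then show ?thesis
    using twist_free[OF F inv_into_into[OF True]] f_inv_into_f[OF True]
    by (simp add: twist_ob_def twist_el_def chosen_twist_def)
next
  case False
  have "\<exists>p. twist F X (fst p) (snd p)" using ex_twist[OF F X] by auto
  from someI_ex[OF this] False show ?thesis
    by (simp add: twist_ob_def twist_el_def chosen_twist_def)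
qed

lemma twist_ob_free: "d \<in> Ob D \<Longrightarrow> twist_ob F (FOb L d) = FOb L d"
  by (simp add: twist_ob_def chosen_twist_def)

definition twist_ar where
  "twist_ar F u = (THE v. v \<in> Hom A (twist_ob F (Dom A u)) (twist_ob F (Cod A u)) \<and>
    (\<forall>d\<in>Ob D. \<forall>x\<in>Elts d (Dom A u). v \<cdot>\<^bsub>A\<^esub> twist_el F (Dom A u) d x = twist_el F (Cod A u) d (u \<cdot>\<^bsub>A\<^esub> x)))"

definition twist_functor :: "('p \<Rightarrow> 'p \<Rightarrow> 'a \<Rightarrow> 'a) \<Rightarrow> ('o, 'a, 'o, 'a) fctr" where
  "twist_functor F = \<lparr>FOb = (\<lambda>X\<in>Ob A. twist_ob F X), FAr = (\<lambda>u\<in>Ar A. twist_ar F u)\<rparr>"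

lemma twist_el:
  assumes F: "free_automorphism F" and X: "X \<in> Ob A"
  shows "\<lbrakk>d \<in> Ob D; x \<in> Elts d X\<rbrakk> \<Longrightarrow> twist_el F X d x \<in> Elts d (twist_ob F X)"
    "\<lbrakk>d \<in> Ob D; e \<in> Ob D; w \<in> Elts d (FOb L e); x \<in> Elts e X\<rbrakk>
      \<Longrightarrow> twist_el F X d (x \<cdot>\<^bsub>A\<^esub> w) = twist_el F X e x \<cdot>\<^bsub>A\<^esub> F d e w"
    "twist_ob F X \<in> Ob A"
  using semilinearD[OF twistD(1)[OF chosen_twist[OF F X]]] by blast+

text \<open>Every element is \<open>\<epsilon>\<^sub>X \<cdot> L g\<close> with \<open>g\<close> its transpose, and \<open>F\<close> fixes \<open>L g\<close>. So \<open>\<alpha>\<close> is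
  transposition, which is additive, followed by composition with \<open>\<alpha>(\<epsilon>\<^sub>X)\<close>.\<close>

lemma twist_el_Plus:
  assumes F: "free_automorphism F" and X: "X \<in> Ob A" and d: "d \<in> Ob D"
    and x: "x \<in> Elts d X" and y: "y \<in> Elts d X"
  shows "twist_el F X d (Plus A x y) = Plus A (twist_el F X d x) (twist_el F X d y)"
proof -
  let ?a = "FOb R X" and ?\<alpha> = "twist_el F X"
  have a: "?a \<in> Ob D" using X by simp
  have c: "?\<alpha> ?a (\<epsilon> X) \<in> Elts ?a (twist_ob F X)" using twist_el(1)[OF F X a LR.counit_Hom[OF X]] .
  have \<alpha>: "?\<alpha> d z = ?\<alpha> ?a (\<epsilon> X) \<cdot>\<^bsub>A\<^esub> FAr L (LR.transpose d z)" if z: "z \<in> Elts d X" for z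
    using twist_el(2)[OF F X d a LR.L.Hom_closed[OF LR.transpose_Hom[OF d z]] LR.counit_Hom[OF X]]
      LR.counit_transpose[OF d z] free_automorphismD(2)[OF F LR.transpose_Hom[OF d z]] by simp
  have t: "LR.transpose d x \<in> Hom D d ?a" "LR.transpose d y \<in> Hom D d ?a"
    using LR.transpose_Hom[OF d x] LR.transpose_Hom[OF d y] .
  show ?thesis
    unfolding \<alpha>[OF x] \<alpha>[OF y] \<alpha>[OF A.Plus_closed[OF x y]]
    using LR.transpose_Plus[OF d x y] LR.L.Plus[OF t]
      A.Comp_Plus_right[OF LR.L.Hom_closed[OF t(1)] LR.L.Hom_closed[OF t(2)] c] by simp
qed

lemma twist_ar:
  assumes F: "free_automorphism F" and u: "u \<in> Hom A X X'"
  shows "twist_ar F u \<in> Hom A (twist_ob F X) (twist_ob F X')"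
    "\<lbrakk>d \<in> Ob D; x \<in> Elts d X\<rbrakk> \<Longrightarrow> twist_ar F u \<cdot>\<^bsub>A\<^esub> twist_el F X d x = twist_el F X' d (u \<cdot>\<^bsub>A\<^esub> x)"
proof -
  have X: "X \<in> Ob A" "X' \<in> Ob A" "Dom A u = X" "Cod A u = X'" using u A.Hom_Ob by (auto simp: Hom_iff)
  note t = chosen_twist[OF F X(1)] chosen_twist[OF F X(2)]
  let ?P = "\<lambda>v. v \<in> Hom A (twist_ob F X) (twist_ob F X') \<and>
    (\<forall>d\<in>Ob D. \<forall>x\<in>Elts d X. v \<cdot>\<^bsub>A\<^esub> twist_el F X d x = twist_el F X' d (u \<cdot>\<^bsub>A\<^esub> x))"
  have "\<exists>!v. ?P v"
  proof (rule ex_ex1I)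
    show "\<exists>v. ?P v" using twist_arrow[OF F t u] by metis
    show "v = v'" if "?P v" "?P v'" for v v'
      using that by (intro eq_if_eq_on_twist[OF t(1), of v _ v']) auto
  qed
  then have "?P (twist_ar F u)" unfolding twist_ar_def X(3,4) by (rule theI')
  then show "twist_ar F u \<in> Hom A (twist_ob F X) (twist_ob F X')"
    "\<lbrakk>d \<in> Ob D; x \<in> Elts d X\<rbrakk> \<Longrightarrow> twist_ar F u \<cdot>\<^bsub>A\<^esub> twist_el F X d x = twist_el F X' d (u \<cdot>\<^bsub>A\<^esub> x)"
    by auto
qed

lemma twist_ar_eqI:
  assumes F: "free_automorphism F" and u: "u \<in> Hom A X X'"
    and v: "v \<in> Hom A (twist_ob F X) (twist_ob F X')"
    and eq: "\<And>d x. \<lbrakk>d \<in> Ob D; x \<in> Elts d X\<rbrakk> \<Longrightarrow> v \<cdot>\<^bsub>A\<^esub> twist_el F X d x = twist_el F X' d (u \<cdot>\<^bsub>A\<^esub> x)"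
  shows "twist_ar F u = v"
  using A.Hom_Ob(1)[OF u] twist_ar[OF F u] v eq
  by (intro eq_if_eq_on_twist[OF chosen_twist[OF F], of X _ _ v]) auto

lemma twist_functor_simps [simp]:
  "X \<in> Ob A \<Longrightarrow> FOb (twist_functor F) X = twist_ob F X"
  "u \<in> Ar A \<Longrightarrow> FAr (twist_functor F) u = twist_ar F u"
  by (simp_all add: twist_functor_def)

lemma twist_functor_additive:
  assumes F: "free_automorphism F"
  shows "additive_functor A A (twist_functor F)"
proof -
  note tw = twist_ar[OF F] and el = twist_el[OF F]
  have idn: "twist_ar F (Idn A X) = Idn A (twist_ob F X)" if X: "X \<in> Ob A" for X
  proof (rule twist_ar_eqI[OF F A.Idn_closed[OF X] A.Idn_closed[OF el(3)[OF X]]])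
    fix d x assume d: "d \<in> Ob D" and x: "x \<in> Elts d X"
    show "Idn A (twist_ob F X) \<cdot>\<^bsub>A\<^esub> twist_el F X d x = twist_el F X d (Idn A X \<cdot>\<^bsub>A\<^esub> x)"
      using A.Idn_left[OF x] A.Idn_left[OF el(1)[OF X d x]] by simp
  qed
  have cmp: "twist_ar F (v \<cdot>\<^bsub>A\<^esub> u) = twist_ar F v \<cdot>\<^bsub>A\<^esub> twist_ar F u"
    if u: "u \<in> Hom A X Y" and v: "v \<in> Hom A Y Z" for u v X Y Z
  proof (rule twist_ar_eqI[OF F A.Comp_closed[OF u v] A.Comp_closed[OF tw(1)[OF u] tw(1)[OF v]]])
    fix d x assume d: "d \<in> Ob D" and x: "x \<in> Elts d X"
    show "(twist_ar F v \<cdot>\<^bsub>A\<^esub> twist_ar F u) \<cdot>\<^bsub>A\<^esub> twist_el F X d x = twist_el F Z d ((v \<cdot>\<^bsub>A\<^esub> u) \<cdot>\<^bsub>A\<^esub> x)"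
      using A.Comp_assoc[OF el(1)[OF A.Hom_Ob(1)[OF u] d x] tw(1)[OF u] tw(1)[OF v]]
        tw(2)[OF u d x] tw(2)[OF v d A.Comp_closed[OF x u]] A.Comp_assoc[OF x u v] by simp
  qed
  have pls: "twist_ar F (Plus A u v) = Plus A (twist_ar F u) (twist_ar F v)"
    if u: "u \<in> Hom A X Y" and v: "v \<in> Hom A X Y" for u v X Y
  proof (rule twist_ar_eqI[OF F A.Plus_closed[OF u v] A.Plus_closed[OF tw(1)[OF u] tw(1)[OF v]]])
    fix d x assume d: "d \<in> Ob D" and x: "x \<in> Elts d X"
    have X: "X \<in> Ob A" "Y \<in> Ob A" using u A.Hom_Ob by blast+
    show "Plus A (twist_ar F u) (twist_ar F v) \<cdot>\<^bsub>A\<^esub> twist_el F X d x = twist_el F Y d (Plus A u v \<cdot>\<^bsub>A\<^esub> x)"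
      using A.Comp_Plus_left[OF el(1)[OF X(1) d x] tw(1)[OF u] tw(1)[OF v]] A.Comp_Plus_left[OF x u v]
        tw(2)[OF u d x] tw(2)[OF v d x]
        twist_el_Plus[OF F X(2) d A.Comp_closed[OF x u] A.Comp_closed[OF x v]] by simp
  qed
  show ?thesis
    unfolding additive_functor_def
  proof (intro conjI ballI impI)
    show "FOb (twist_functor F) \<in> Ob A \<rightarrow>\<^sub>E Ob A" using el(3) by (auto simp: twist_functor_def)
    show "FAr (twist_functor F) \<in> Ar A \<rightarrow>\<^sub>E Ar A"
      using tw(1)[OF A.Ar_Hom] by (auto simp: twist_functor_def Hom_iff)
  next
    fix f assume "f \<in> Ar A"
    then show "Dom A (FAr (twist_functor F) f) = FOb (twist_functor F) (Dom A f)"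
      "Cod A (FAr (twist_functor F) f) = FOb (twist_functor F) (Cod A f)"
      using tw(1)[OF A.Ar_Hom] by (auto simp: Hom_iff A.Dom_closed A.Cod_closed)
  next
    fix x assume "x \<in> Ob A"
    then show "FAr (twist_functor F) (Idn A x) = Idn A (FOb (twist_functor F) x)" using idn by simp
  next
    fix f g assume f: "f \<in> Ar A" and g: "g \<in> Ar A" and "Dom A g = Cod A f"
    then show "FAr (twist_functor F) (g \<cdot>\<^bsub>A\<^esub> f) = FAr (twist_functor F) g \<cdot>\<^bsub>A\<^esub> FAr (twist_functor F) f"
      using cmp[of f "Dom A f" "Cod A f" g "Cod A g"] by (simp add: Hom_iff)
  next
    fix f g assume f: "f \<in> Ar A" and g: "g \<in> Ar A" and "Dom A f = Dom A g \<and> Cod A f = Cod A g"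
    then have h: "f \<in> Hom A (Dom A f) (Cod A f)" "g \<in> Hom A (Dom A f) (Cod A f)" by (auto simp: Hom_iff)
    show "FAr (twist_functor F) (Plus A f g) = Plus A (FAr (twist_functor F) f) (FAr (twist_functor F) g)"
      using pls[OF h] f g A.Plus_closed[OF h] by (simp add: Hom_iff)
  qed
qed

text \<open>A twist by \<open>F\<close> followed by one by \<open>G\<close> is a twist by the identity, as is \<open>X\<close> with its own
  elements, and twists are unique up to isomorphism.\<close>

lemma twist_functor_inverse:
  assumes F: "free_automorphism F" and G: "free_automorphism G"
    and GF: "\<And>d e w. \<lbrakk>d \<in> Ob D; e \<in> Ob D; w \<in> Elts d (FOb L e)\<rbrakk> \<Longrightarrow> G d e (F d e w) = w"
  shows "\<exists>\<sigma>. nat_iso A A (idfun A) (twist_functor G \<odot>\<^bsub>A\<^esub> twist_functor F) \<sigma>"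
proof -
  let ?H = "\<lambda>X. twist_ob G (twist_ob F X)"
  define \<gamma> where "\<gamma> X d x = twist_el G (twist_ob F X) d (twist_el F X d x)" for X d x
  have tw: "twist (\<lambda>d e w. w) X (?H X) (\<gamma> X)" if X: "X \<in> Ob A" for X
  proof -
    note t = chosen_twist[OF F X] chosen_twist[OF G twist_el(3)[OF F X]]
    have "\<gamma> X d (x \<cdot>\<^bsub>A\<^esub> w) = \<gamma> X e x \<cdot>\<^bsub>A\<^esub> w"
      if "d \<in> Ob D" "e \<in> Ob D" "w \<in> Elts d (FOb L e)" "x \<in> Elts e X" for d e w x
      using twist_el(2)[OF F X that] that GF twist_el(1)[OF F X] free_automorphismD(4)[OF F]
        twist_el(2)[OF G twist_el(3)[OF F X]] by (simp add: \<gamma>_def)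
    moreover have "bij_betw (\<gamma> X d) (Elts d X) (Elts d (?H X))" if "d \<in> Ob D" for d
      using bij_betw_trans[OF twistD(2)[OF t(1) that] twistD(2)[OF t(2) that]]
      by (simp add: \<gamma>_def[abs_def] comp_def)
    ultimately show ?thesis
      using X twist_el(3)[OF G twist_el(3)[OF F X]] unfolding twist_def semilinear_def
      by (blast dest: bij_betw_apply)
  qed
  have "\<exists>v. v \<in> Hom A X (?H X) \<and> is_iso A v \<and> (\<forall>d\<in>Ob D. \<forall>x\<in>Elts d X. v \<cdot>\<^bsub>A\<^esub> x = \<gamma> X d x)"
    if X: "X \<in> Ob A" for X
    using twist_unique[OF free_automorphism_id twist_refl[OF X] tw[OF X]] by metis
  then obtain \<sigma> where \<sigma>: "\<And>X. X \<in> Ob A \<Longrightarrow> \<sigma> X \<in> Hom A X (?H X)" "\<And>X. X \<in> Ob A \<Longrightarrow> is_iso A (\<sigma> X)"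
    "\<And>X d x. \<lbrakk>X \<in> Ob A; d \<in> Ob D; x \<in> Elts d X\<rbrakk> \<Longrightarrow> \<sigma> X \<cdot>\<^bsub>A\<^esub> x = \<gamma> X d x"
    by metis
  have "nat_trans A A (idfun A) (twist_functor G \<odot>\<^bsub>A\<^esub> twist_functor F) (restrict \<sigma> (Ob A))"
  proof (rule nat_transI)
    show "additive_functor A A (idfun A)"
      using additive_functor_idfun[OF A.preadditive_category_axioms] .
    show "additive_functor A A (twist_functor G \<odot>\<^bsub>A\<^esub> twist_functor F)"
      using additive_functor_fcomp[OF A.preadditive_category_axioms A.preadditive_category_axioms
          A.preadditive_category_axioms] twist_functor_additive F G by blast
    show "restrict \<sigma> (Ob A) X \<in> Hom A (FOb (idfun A) X) (FOb (twist_functor G \<odot>\<^bsub>A\<^esub> twist_functor F) X)"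
      if "X \<in> Ob A" for X using that \<sigma>(1) twist_el(3)[OF F] by (simp add: FOb_fcomp)
    fix X Y u assume u: "u \<in> Hom A X Y"
    then have X: "X \<in> Ob A" "Y \<in> Ob A" and uA: "u \<in> Ar A" using A.Hom_Ob by (auto simp: Hom_iff)
    let ?u = "twist_ar G (twist_ar F u)"
    have u': "?u \<in> Hom A (?H X) (?H Y)" using twist_ar(1)[OF G twist_ar(1)[OF F u]] .
    have "\<sigma> Y \<cdot>\<^bsub>A\<^esub> u = ?u \<cdot>\<^bsub>A\<^esub> \<sigma> X"
    proof (rule eq_if_eq_on_free[OF A.Comp_closed[OF u \<sigma>(1)[OF X(2)]] A.Comp_closed[OF \<sigma>(1)[OF X(1)] u']])
      fix d x assume d: "d \<in> Ob D" and x: "x \<in> Elts d X"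
      have "(?u \<cdot>\<^bsub>A\<^esub> \<sigma> X) \<cdot>\<^bsub>A\<^esub> x = ?u \<cdot>\<^bsub>A\<^esub> \<gamma> X d x"
        using A.Comp_assoc[OF x \<sigma>(1)[OF X(1)] u'] \<sigma>(3)[OF X(1) d x] by simp
      also have "\<dots> = \<gamma> Y d (u \<cdot>\<^bsub>A\<^esub> x)"
        using twist_ar(2)[OF G twist_ar(1)[OF F u] d twist_el(1)[OF F X(1) d x]] twist_ar(2)[OF F u d x]
        by (simp add: \<gamma>_def)
      also have "\<dots> = (\<sigma> Y \<cdot>\<^bsub>A\<^esub> u) \<cdot>\<^bsub>A\<^esub> x"
        using A.Comp_assoc[OF x u \<sigma>(1)[OF X(2)]] \<sigma>(3)[OF X(2) d A.Comp_closed[OF x u]] by simp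
      finally show "(\<sigma> Y \<cdot>\<^bsub>A\<^esub> u) \<cdot>\<^bsub>A\<^esub> x = (?u \<cdot>\<^bsub>A\<^esub> \<sigma> X) \<cdot>\<^bsub>A\<^esub> x" by simp
    qed
    then show "restrict \<sigma> (Ob A) Y \<cdot>\<^bsub>A\<^esub> FAr (idfun A) u =
        FAr (twist_functor G \<odot>\<^bsub>A\<^esub> twist_functor F) u \<cdot>\<^bsub>A\<^esub> restrict \<sigma> (Ob A) X"
      using X uA twist_ar(1)[OF F u] by (simp add: FAr_fcomp Hom_iff)
  qed simp
  then show ?thesis using \<sigma>(2) by (auto simp: nat_iso_def)
qed

lemma twist_functor_equivalence:
  assumes F: "free_automorphism F"
  shows "is_equivalence A A (twist_functor F)"
proof -
  let ?G = "inverse_automorphism F"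
  note G = inverse_automorphism[OF F]
  obtain \<sigma> where \<sigma>: "nat_iso A A (idfun A) (twist_functor ?G \<odot>\<^bsub>A\<^esub> twist_functor F) \<sigma>"
    using twist_functor_inverse[OF F G(3,1)] by blast
  obtain \<tau> where \<tau>: "nat_iso A A (idfun A) (twist_functor F \<odot>\<^bsub>A\<^esub> twist_functor ?G) \<tau>"
    using twist_functor_inverse[OF G(3) F G(2)] by blast
  show ?thesis
    using \<sigma> nat_iso_inverse[OF A.preadditive_category_axioms A.preadditive_category_axioms \<tau>]
      twist_functor_additive[OF F] twist_functor_additive[OF G(3)]
    unfolding is_equivalence_def by blast
qed

text \<open>On a free object \<open>L d\<close> the chosen twist is \<open>L d\<close> itself, but only up to the choice of \<open>d\<close>,
  which \<open>\<iota>\<close> corrects.\<close>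

lemma ex_twist_equivalence:
  assumes F: "free_automorphism F"
  shows "\<exists>\<Phi> \<iota>. is_equivalence A A \<Phi> \<and> nat_iso D A (\<Phi> \<odot>\<^bsub>D\<^esub> L) L \<iota> \<and>
    (\<forall>d\<in>Ob D. \<forall>e\<in>Ob D. \<forall>w\<in>Elts d (FOb L e). \<iota> e \<cdot>\<^bsub>A\<^esub> FAr \<Phi> w = F d e w \<cdot>\<^bsub>A\<^esub> \<iota> d) \<and>
    ((\<forall>c\<in>Ob D. \<forall>d\<in>Ob D. \<forall>e\<in>Ob D. \<forall>w\<in>Elts c (FOb L d). FOb L d = FOb L e \<longrightarrow> F c d w = F c e w) \<longrightarrow>
      \<Phi> \<odot>\<^bsub>D\<^esub> L = L \<and> \<iota> = id_trans D A L)"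
proof -
  let ?\<Phi> = "twist_functor F"
  note t = chosen_twist[OF F LR.L.Ob_closed] and el = twist_el[OF F LR.L.Ob_closed]
  have ob: "twist_ob F (FOb L d) = FOb L d" if "d \<in> Ob D" for d using twist_ob_free that .
  have "\<exists>v. v \<in> Hom A (FOb L d) (FOb L d) \<and> is_iso A v \<and>
      (\<forall>c\<in>Ob D. \<forall>x\<in>Elts c (FOb L d). v \<cdot>\<^bsub>A\<^esub> twist_el F (FOb L d) c x = F c d x)" if d: "d \<in> Ob D" for d
    using twist_unique[OF F t[OF d] twist_free[OF F d]] ob[OF d] by metis
  then obtain i where i: "\<And>d. d \<in> Ob D \<Longrightarrow> i d \<in> Hom A (FOb L d) (FOb L d)"
    "\<And>d. d \<in> Ob D \<Longrightarrow> is_iso A (i d)"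
    "\<And>c d x. \<lbrakk>c \<in> Ob D; d \<in> Ob D; x \<in> Elts c (FOb L d)\<rbrakk> \<Longrightarrow> i d \<cdot>\<^bsub>A\<^esub> twist_el F (FOb L d) c x = F c d x"
    by metis
  define \<iota> where "\<iota> = restrict i (Ob D)"
  have equiv: "is_equivalence A A ?\<Phi>" using twist_functor_equivalence[OF F] .
  have nat: "\<iota> e \<cdot>\<^bsub>A\<^esub> FAr ?\<Phi> w = F d e w \<cdot>\<^bsub>A\<^esub> \<iota> d"
    if d: "d \<in> Ob D" and e: "e \<in> Ob D" and w: "w \<in> Elts d (FOb L e)" for d e w
  proof -
    have w': "twist_ar F w \<in> Hom A (FOb L d) (FOb L e)" using twist_ar(1)[OF F w] ob d e by simp
    have Fw: "F d e w \<in> Hom A (FOb L d) (FOb L e)" using free_automorphismD(4)[OF F d e w] .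
    have td: "twist F (FOb L d) (FOb L d) (twist_el F (FOb L d))" using t[OF d] ob[OF d] by simp
    have "i e \<cdot>\<^bsub>A\<^esub> twist_ar F w = F d e w \<cdot>\<^bsub>A\<^esub> i d"
    proof (rule eq_if_eq_on_twist[OF td A.Comp_closed[OF w' i(1)[OF e]] A.Comp_closed[OF i(1)[OF d] Fw]])
      fix c x assume c: "c \<in> Ob D" and x: "x \<in> Elts c (FOb L d)"
      have \<alpha>x: "twist_el F (FOb L d) c x \<in> Elts c (FOb L d)" using el(1)[OF d c x] ob[OF d] by simp
      have "(i e \<cdot>\<^bsub>A\<^esub> twist_ar F w) \<cdot>\<^bsub>A\<^esub> twist_el F (FOb L d) c x = F c e (w \<cdot>\<^bsub>A\<^esub> x)"
        using A.Comp_assoc[OF \<alpha>x w' i(1)[OF e]] twist_ar(2)[OF F w c x] i(3)[OF c e A.Comp_closed[OF x w]]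
        by simp
      also have "\<dots> = F d e w \<cdot>\<^bsub>A\<^esub> F c d x" using free_automorphismD(3)[OF F c d e x w] .
      also have "\<dots> = (F d e w \<cdot>\<^bsub>A\<^esub> i d) \<cdot>\<^bsub>A\<^esub> twist_el F (FOb L d) c x"
        using A.Comp_assoc[OF \<alpha>x i(1)[OF d] Fw] i(3)[OF c d x] by simp
      finally show "(i e \<cdot>\<^bsub>A\<^esub> twist_ar F w) \<cdot>\<^bsub>A\<^esub> twist_el F (FOb L d) c x =
        (F d e w \<cdot>\<^bsub>A\<^esub> i d) \<cdot>\<^bsub>A\<^esub> twist_el F (FOb L d) c x" .
    qed
    then show ?thesis using d e w by (simp add: \<iota>_def Hom_iff)
  qed
  have \<Phi>L: "additive_functor D A (?\<Phi> \<odot>\<^bsub>D\<^esub> L)"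
    using additive_functor_fcomp[OF D.preadditive_category_axioms A.preadditive_category_axioms
        A.preadditive_category_axioms LR.L.F twist_functor_additive[OF F]] .
  have nt: "nat_trans D A (?\<Phi> \<odot>\<^bsub>D\<^esub> L) L \<iota>"
  proof (rule nat_transI[OF \<Phi>L LR.L.F])
    show "\<iota> d \<in> Hom A (FOb (?\<Phi> \<odot>\<^bsub>D\<^esub> L) d) (FOb L d)" if "d \<in> Ob D" for d
      using that i(1) ob by (simp add: FOb_fcomp \<iota>_def)
    show "\<iota> e \<cdot>\<^bsub>A\<^esub> FAr (?\<Phi> \<odot>\<^bsub>D\<^esub> L) g = FAr L g \<cdot>\<^bsub>A\<^esub> \<iota> d" if g: "g \<in> Hom D d e" for d e g
      using nat[OF D.Hom_Ob[OF g] LR.L.Hom_closed[OF g]] free_automorphismD(2)[OF F g] g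
      by (simp add: FAr_fcomp Hom_iff)
  qed (simp add: \<iota>_def)
  have iso: "nat_iso D A (?\<Phi> \<odot>\<^bsub>D\<^esub> L) L \<iota>" using nt i(2) by (simp add: nat_iso_def \<iota>_def)
  have strict: "?\<Phi> \<odot>\<^bsub>D\<^esub> L = L \<and> \<iota> = id_trans D A L"
    if compat: "\<forall>c\<in>Ob D. \<forall>d\<in>Ob D. \<forall>e\<in>Ob D. \<forall>w\<in>Elts c (FOb L d). FOb L d = FOb L e \<longrightarrow> F c d w = F c e w"
  proof
    have id: "\<iota> d = Idn A (FOb L d)" if d: "d \<in> Ob D" for d
    proof -
      let ?d = "inv_into (Ob D) (FOb L) (FOb L d)"
      have d': "?d \<in> Ob D" "FOb L ?d = FOb L d"
        using d by (auto intro: inv_into_into f_inv_into_f)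
      have td: "twist F (FOb L d) (FOb L d) (twist_el F (FOb L d))" using t[OF d] ob[OF d] by simp
      have "i d = Idn A (FOb L d)"
      proof (rule eq_if_eq_on_twist[OF td i(1)[OF d] A.Idn_closed[OF LR.L.Ob_closed[OF d]]])
        fix c x assume c: "c \<in> Ob D" and x: "x \<in> Elts c (FOb L d)"
        have "twist_el F (FOb L d) c x = F c ?d x"
          using d by (simp add: twist_el_def chosen_twist_def)
        then show "i d \<cdot>\<^bsub>A\<^esub> twist_el F (FOb L d) c x = Idn A (FOb L d) \<cdot>\<^bsub>A\<^esub> twist_el F (FOb L d) c x"
          using i(3)[OF c d x] compat[rule_format, OF c d d'(1) x d'(2)[symmetric]]
            A.Idn_left[OF free_automorphismD(4)[OF F c d x]] by simp
      qed
      then show ?thesis using d by (simp add: \<iota>_def)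
    qed
    then show "\<iota> = id_trans D A L" by (auto simp: \<iota>_def id_trans_def fun_eq_iff)
    have "FOb (?\<Phi> \<odot>\<^bsub>D\<^esub> L) d = FOb L d" for d
      using ob LR.L.F by (cases "d \<in> Ob D") (auto simp: fcomp_def compose_def additive_functor_def PiE_def extensional_def)
    moreover have "FAr (?\<Phi> \<odot>\<^bsub>D\<^esub> L) g = FAr L g" for g
    proof (cases "g \<in> Ar D")
      case True
      then have g: "g \<in> Hom D (Dom D g) (Cod D g)" and o: "Dom D g \<in> Ob D" "Cod D g \<in> Ob D"
        using D.Ar_Hom D.Dom_closed D.Cod_closed by auto
      have "FAr (?\<Phi> \<odot>\<^bsub>D\<^esub> L) g \<in> Hom A (FOb L (Dom D g)) (FOb L (Cod D g))"
        using twist_ar(1)[OF F LR.L.Hom_closed[OF g]] ob o True by (simp add: FAr_fcomp)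
      then show ?thesis
        using nat_transD(4)[OF nt g] LR.L.Hom_closed[OF g] id o by (simp add: Hom_iff)
    next
      case False
      then show ?thesis
        using LR.L.F by (auto simp: fcomp_def compose_def additive_functor_def PiE_def extensional_def)
    qed
    ultimately show "?\<Phi> \<odot>\<^bsub>D\<^esub> L = L" by (intro fctr.equality) (auto simp: fun_eq_iff)
  qed
  show ?thesis
    using equiv iso nat strict by (intro exI[of _ ?\<Phi>] exI[of _ \<iota>] conjI ballI impI) blast+
qed

section \<open>Natural isomorphisms determined on the free objects\<close>

text \<open>The component at \<open>X\<close> is forced by naturality along \<open>\<epsilon>\<^sub>X\<close>, since \<open>H \<epsilon>\<^sub>X\<close> is a coequalizer; and
  it exists because \<open>K \<epsilon>\<^sub>X \<cdot> z\<^sub>R\<^sub>X\<close> equalizes the \<open>H\<close>-image of the presentation, whose arrows run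
  between free objects. Its inverse is the extension of the inverses of \<open>z\<close>.\<close>

lemma ex1_nat_iso_extending:
  assumes B: "preadditive_category B"
    and H: "additive_functor A B H" "preserves_coequalizers A B H"
    and K: "additive_functor A B K" "preserves_coequalizers A B K"
    and z: "\<And>d. d \<in> Ob D \<Longrightarrow> z d \<in> Hom B (FOb H (FOb L d)) (FOb K (FOb L d))"
      "\<And>d. d \<in> Ob D \<Longrightarrow> is_iso B (z d)" "z \<in> extensional (Ob D)"
    and nat: "\<And>d e w. \<lbrakk>d \<in> Ob D; e \<in> Ob D; w \<in> Elts d (FOb L e)\<rbrakk>
      \<Longrightarrow> z e \<cdot>\<^bsub>B\<^esub> FAr H w = FAr K w \<cdot>\<^bsub>B\<^esub> z d"
  shows "\<exists>!\<zeta>. nat_iso A B H K \<zeta> \<and> precomp D \<zeta> L = z"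
proof -
  interpret B: preadditive_category B by fact
  interpret H: afunctor A B H by standard (rule H)
  interpret K: afunctor A B K by standard (rule K)
  have factor: "\<exists>v\<in>Hom B (FOb H' X) (FOb K' X). v \<cdot>\<^bsub>B\<^esub> FAr H' (\<epsilon> X) = FAr K' (\<epsilon> X) \<cdot>\<^bsub>B\<^esub> z' (FOb R X)"
    if "afunctor A B H'" "afunctor A B K'" and pH: "preserves_coequalizers A B H'"
      and z': "\<And>d. d \<in> Ob D \<Longrightarrow> z' d \<in> Hom B (FOb H' (FOb L d)) (FOb K' (FOb L d))"
      and nat': "\<And>d e w. \<lbrakk>d \<in> Ob D; e \<in> Ob D; w \<in> Elts d (FOb L e)\<rbrakk>
        \<Longrightarrow> z' e \<cdot>\<^bsub>B\<^esub> FAr H' w = FAr K' w \<cdot>\<^bsub>B\<^esub> z' d"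
      and X: "X \<in> Ob A" for H' K' z' X
  proof -
    interpret H': afunctor A B H' by fact
    interpret K': afunctor A B K' by fact
    define a where "a = FOb R X"
    define b where "b = FOb R (T X)"
    have a: "a \<in> Ob D" and b: "b \<in> Ob D" using X by (auto simp: a_def b_def)
    note e = LR.counit_Hom[OF X, folded a_def]
    have TX: "FOb L a \<in> Ob A" using a by simp
    have e1: "\<epsilon> (FOb L a) \<in> Elts b (FOb L a)" using LR.counit_Hom[OF TX] by (simp add: a_def b_def)
    have Te: "FAr L (FAr R (\<epsilon> X)) \<in> Elts b (FOb L a)"
      using LR.L.Hom_closed[OF LR.R.Hom_closed[OF LR.counit_Hom[OF X]]] by (simp add: a_def b_def)
    let ?t = "FAr K' (\<epsilon> X) \<cdot>\<^bsub>B\<^esub> z' a"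
    have t: "?t \<in> Hom B (FOb H' (FOb L a)) (FOb K' X)"
      using B.Comp_closed[OF z'[OF a] K'.Hom_closed[OF e]] .
    have "?t \<cdot>\<^bsub>B\<^esub> FAr H' w = FAr K' (\<epsilon> X \<cdot>\<^bsub>A\<^esub> w) \<cdot>\<^bsub>B\<^esub> z' b" if w: "w \<in> Elts b (FOb L a)" for w
    proof -
      have "?t \<cdot>\<^bsub>B\<^esub> FAr H' w = FAr K' (\<epsilon> X) \<cdot>\<^bsub>B\<^esub> (FAr K' w \<cdot>\<^bsub>B\<^esub> z' b)"
        using B.Comp_assoc[OF H'.Hom_closed[OF w] z'[OF a] K'.Hom_closed[OF e]] nat'[OF b a w] by simp
      also have "\<dots> = FAr K' (\<epsilon> X \<cdot>\<^bsub>A\<^esub> w) \<cdot>\<^bsub>B\<^esub> z' b"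
        using B.Comp_assoc[OF z'[OF b] K'.Hom_closed[OF w] K'.Hom_closed[OF e]] K'.Comp[of w "\<epsilon> X"] w e
        by (simp add: Hom_iff)
      finally show ?thesis .
    qed
    note eq = this[OF Te] this[OF e1]
    have teq: "?t \<cdot>\<^bsub>B\<^esub> FAr H' (FAr L (FAr R (\<epsilon> X))) = ?t \<cdot>\<^bsub>B\<^esub> FAr H' (\<epsilon> (FOb L a))"
      unfolding eq LR.counit_natural[OF e] by (simp add: a_def)
    have co: "coequalizer B (FOb H' (FOb L b)) (FOb H' (FOb L a)) (FOb H' X)
        (FAr H' (FAr L (FAr R (\<epsilon> X)))) (FAr H' (\<epsilon> (FOb L a))) (FAr H' (\<epsilon> X))"
      using pH presentation[OF X] unfolding preserves_coequalizers_def by (auto simp: a_def b_def)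
    obtain v where "v \<in> Hom B (FOb H' X) (FOb K' X)" "v \<cdot>\<^bsub>B\<^esub> FAr H' (\<epsilon> X) = ?t"
      using coequalizer_factor[OF co t teq] by blast
    then show ?thesis by (auto simp: a_def)
  qed
  have cancel: "u = v" if X: "X \<in> Ob A" and "preserves_coequalizers A B H'"
    "u \<in> Hom B (FOb H' X) Y" "v \<in> Hom B (FOb H' X) Y" "u \<cdot>\<^bsub>B\<^esub> FAr H' (\<epsilon> X) = v \<cdot>\<^bsub>B\<^esub> FAr H' (\<epsilon> X)" for H' X Y u v
    using B.coequalizer_cancel that presentation[OF X] unfolding preserves_coequalizers_def by metis
  have afH: "afunctor A B H" "afunctor A B K" by (rule H.afunctor_axioms, rule K.afunctor_axioms)
  obtain f where f: "\<And>X. X \<in> Ob A \<Longrightarrow> f X \<in> Hom B (FOb H X) (FOb K X)"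
    "\<And>X. X \<in> Ob A \<Longrightarrow> f X \<cdot>\<^bsub>B\<^esub> FAr H (\<epsilon> X) = FAr K (\<epsilon> X) \<cdot>\<^bsub>B\<^esub> z (FOb R X)"
    using factor[OF afH H(2) z(1) nat] by metis
  define y where "y d = inverse_arrow B (z d)" for d
  note yz = B.inverse_arrow[OF z(2,1), folded y_def]
  have ynat: "y e \<cdot>\<^bsub>B\<^esub> FAr K w = FAr H w \<cdot>\<^bsub>B\<^esub> y d"
    if d: "d \<in> Ob D" and e: "e \<in> Ob D" and w: "w \<in> Elts d (FOb L e)" for d e w
  proof (rule B.iso_cancel_right[OF z(2)[OF d] z(1)[OF d]])
    note Hw = H.Hom_closed[OF w] and Kw = K.Hom_closed[OF w]
    show "y e \<cdot>\<^bsub>B\<^esub> FAr K w \<in> Hom B (FOb K (FOb L d)) (FOb H (FOb L e))"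
      "FAr H w \<cdot>\<^bsub>B\<^esub> y d \<in> Hom B (FOb K (FOb L d)) (FOb H (FOb L e))"
      using B.Comp_closed Hw Kw yz(1) d e by blast+
    have "(y e \<cdot>\<^bsub>B\<^esub> FAr K w) \<cdot>\<^bsub>B\<^esub> z d = (y e \<cdot>\<^bsub>B\<^esub> z e) \<cdot>\<^bsub>B\<^esub> FAr H w"
      using B.Comp_assoc[OF z(1)[OF d] Kw yz(1)[OF e e]] B.Comp_assoc[OF Hw z(1)[OF e] yz(1)[OF e e]] nat[OF d e w]
      by simp
    also have "\<dots> = FAr H w \<cdot>\<^bsub>B\<^esub> (y d \<cdot>\<^bsub>B\<^esub> z d)"
      using yz(2) d e Hw by (simp add: Hom_iff)
    also have "\<dots> = (FAr H w \<cdot>\<^bsub>B\<^esub> y d) \<cdot>\<^bsub>B\<^esub> z d"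
      using B.Comp_assoc[OF z(1)[OF d] yz(1)[OF d d] Hw] by simp
    finally show "(y e \<cdot>\<^bsub>B\<^esub> FAr K w) \<cdot>\<^bsub>B\<^esub> z d = (FAr H w \<cdot>\<^bsub>B\<^esub> y d) \<cdot>\<^bsub>B\<^esub> z d" .
  qed
  obtain g where g: "\<And>X. X \<in> Ob A \<Longrightarrow> g X \<in> Hom B (FOb K X) (FOb H X)"
    "\<And>X. X \<in> Ob A \<Longrightarrow> g X \<cdot>\<^bsub>B\<^esub> FAr K (\<epsilon> X) = FAr H (\<epsilon> X) \<cdot>\<^bsub>B\<^esub> y (FOb R X)"
    using factor[OF afH(2,1) K(2) yz(1) ynat] by metis
  have iso: "is_iso B (f X)" if X: "X \<in> Ob A" for X
  proof (rule B.is_isoI[OF f(1)[OF X] g(1)[OF X]])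
    let ?a = "FOb R X"
    have a: "?a \<in> Ob D" using X by simp
    note He = H.Hom_closed[OF LR.counit_Hom[OF X]] and Ke = K.Hom_closed[OF LR.counit_Hom[OF X]]
    show "g X \<cdot>\<^bsub>B\<^esub> f X = Idn B (FOb H X)"
    proof (rule cancel[OF X H(2) B.Comp_closed[OF f(1)[OF X] g(1)[OF X]] B.Idn_closed[OF H.Ob_closed[OF X]]])
      have "(g X \<cdot>\<^bsub>B\<^esub> f X) \<cdot>\<^bsub>B\<^esub> FAr H (\<epsilon> X) = (g X \<cdot>\<^bsub>B\<^esub> FAr K (\<epsilon> X)) \<cdot>\<^bsub>B\<^esub> z ?a"
        using B.Comp_assoc[OF He f(1)[OF X] g(1)[OF X]] f(2)[OF X] B.Comp_assoc[OF z(1)[OF a] Ke g(1)[OF X]] by simp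
      also have "\<dots> = FAr H (\<epsilon> X) \<cdot>\<^bsub>B\<^esub> (y ?a \<cdot>\<^bsub>B\<^esub> z ?a)"
        using g(2)[OF X] B.Comp_assoc[OF z(1)[OF a] yz(1)[OF a a] He] by simp
      finally show "(g X \<cdot>\<^bsub>B\<^esub> f X) \<cdot>\<^bsub>B\<^esub> FAr H (\<epsilon> X) = Idn B (FOb H X) \<cdot>\<^bsub>B\<^esub> FAr H (\<epsilon> X)"
        using yz(2)[OF a a] He by (simp add: Hom_iff)
    qed
    show "f X \<cdot>\<^bsub>B\<^esub> g X = Idn B (FOb K X)"
    proof (rule cancel[OF X K(2) B.Comp_closed[OF g(1)[OF X] f(1)[OF X]] B.Idn_closed[OF K.Ob_closed[OF X]]])
      have "(f X \<cdot>\<^bsub>B\<^esub> g X) \<cdot>\<^bsub>B\<^esub> FAr K (\<epsilon> X) = (f X \<cdot>\<^bsub>B\<^esub> FAr H (\<epsilon> X)) \<cdot>\<^bsub>B\<^esub> y ?a"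
        using B.Comp_assoc[OF Ke g(1)[OF X] f(1)[OF X]] g(2)[OF X] B.Comp_assoc[OF yz(1)[OF a a] He f(1)[OF X]] by simp
      also have "\<dots> = FAr K (\<epsilon> X) \<cdot>\<^bsub>B\<^esub> (z ?a \<cdot>\<^bsub>B\<^esub> y ?a)"
        using f(2)[OF X] B.Comp_assoc[OF yz(1)[OF a a] z(1)[OF a] Ke] by simp
      finally show "(f X \<cdot>\<^bsub>B\<^esub> g X) \<cdot>\<^bsub>B\<^esub> FAr K (\<epsilon> X) = Idn B (FOb K X) \<cdot>\<^bsub>B\<^esub> FAr K (\<epsilon> X)"
        using yz(3)[OF a a] Ke by (simp add: Hom_iff)
    qed
  qed
  have fL: "f (FOb L d) = z d" if d: "d \<in> Ob D" for d
  proof (rule cancel[OF LR.L.Ob_closed[OF d] H(2) f(1)[OF LR.L.Ob_closed[OF d]] z(1)[OF d]])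
    have Ld: "FOb L d \<in> Ob A" using d by simp
    show "f (FOb L d) \<cdot>\<^bsub>B\<^esub> FAr H (\<epsilon> (FOb L d)) = z d \<cdot>\<^bsub>B\<^esub> FAr H (\<epsilon> (FOb L d))"
      using f(2)[OF Ld] nat[OF LR.R.Ob_closed[OF Ld] d LR.counit_Hom[OF Ld]] by simp
  qed
  have fnat: "f Y \<cdot>\<^bsub>B\<^esub> FAr H u = FAr K u \<cdot>\<^bsub>B\<^esub> f X" if u: "u \<in> Hom A X Y" for X Y u
  proof -
    have X: "X \<in> Ob A" and Y: "Y \<in> Ob A" using u A.Hom_Ob by blast+
    let ?a = "FOb R X" and ?b = "FOb R Y"
    have ab: "?a \<in> Ob D" "?b \<in> Ob D" using X Y by auto
    let ?w = "FAr L (FAr R u)"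
    have w: "?w \<in> Elts ?a (FOb L ?b)" using LR.L.Hom_closed[OF LR.R.Hom_closed[OF u]] .
    note ex = LR.counit_Hom[OF X] and ey = LR.counit_Hom[OF Y]
    have Hn: "FAr H u \<cdot>\<^bsub>B\<^esub> FAr H (\<epsilon> X) = FAr H (\<epsilon> Y) \<cdot>\<^bsub>B\<^esub> FAr H ?w"
      using H.Comp[of "\<epsilon> X" u] H.Comp[of ?w "\<epsilon> Y"] LR.counit_natural[OF u] u w ex ey by (simp add: Hom_iff)
    have Kn: "FAr K u \<cdot>\<^bsub>B\<^esub> FAr K (\<epsilon> X) = FAr K (\<epsilon> Y) \<cdot>\<^bsub>B\<^esub> FAr K ?w"
      using K.Comp[of "\<epsilon> X" u] K.Comp[of ?w "\<epsilon> Y"] LR.counit_natural[OF u] u w ex ey by (simp add: Hom_iff)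
    show ?thesis
    proof (rule cancel[OF X H(2) B.Comp_closed[OF H.Hom_closed[OF u] f(1)[OF Y]]
          B.Comp_closed[OF f(1)[OF X] K.Hom_closed[OF u]]])
      have "(f Y \<cdot>\<^bsub>B\<^esub> FAr H u) \<cdot>\<^bsub>B\<^esub> FAr H (\<epsilon> X) = (f Y \<cdot>\<^bsub>B\<^esub> FAr H (\<epsilon> Y)) \<cdot>\<^bsub>B\<^esub> FAr H ?w"
        using B.Comp_assoc[OF H.Hom_closed[OF ex] H.Hom_closed[OF u] f(1)[OF Y]] Hn
          B.Comp_assoc[OF H.Hom_closed[OF w] H.Hom_closed[OF ey] f(1)[OF Y]] by simp
      also have "\<dots> = FAr K (\<epsilon> Y) \<cdot>\<^bsub>B\<^esub> (FAr K ?w \<cdot>\<^bsub>B\<^esub> z ?a)"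
        using f(2)[OF Y] B.Comp_assoc[OF H.Hom_closed[OF w] z(1)[OF ab(2)] K.Hom_closed[OF ey]] nat[OF ab w] by simp
      also have "\<dots> = FAr K u \<cdot>\<^bsub>B\<^esub> (FAr K (\<epsilon> X) \<cdot>\<^bsub>B\<^esub> z ?a)"
        using B.Comp_assoc[OF z(1)[OF ab(1)] K.Hom_closed[OF w] K.Hom_closed[OF ey]] Kn
          B.Comp_assoc[OF z(1)[OF ab(1)] K.Hom_closed[OF ex] K.Hom_closed[OF u]] by simp
      also have "\<dots> = (FAr K u \<cdot>\<^bsub>B\<^esub> f X) \<cdot>\<^bsub>B\<^esub> FAr H (\<epsilon> X)"
        using f(2)[OF X] B.Comp_assoc[OF H.Hom_closed[OF ex] f(1)[OF X] K.Hom_closed[OF u]] by simp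
      finally show "(f Y \<cdot>\<^bsub>B\<^esub> FAr H u) \<cdot>\<^bsub>B\<^esub> FAr H (\<epsilon> X) = (FAr K u \<cdot>\<^bsub>B\<^esub> f X) \<cdot>\<^bsub>B\<^esub> FAr H (\<epsilon> X)" .
    qed
  qed
  show ?thesis
  proof (rule ex1I[of _ "restrict f (Ob A)"])
    have "nat_trans A B H K (restrict f (Ob A))"
      using f(1) fnat A.Hom_Ob by (intro nat_transI[OF H(1) K(1)]) auto
    moreover have "precomp D (restrict f (Ob A)) L = z"
      using fL z(3) by (auto simp: precomp_def compose_def fun_eq_iff extensional_def)
    ultimately show "nat_iso A B H K (restrict f (Ob A)) \<and> precomp D (restrict f (Ob A)) L = z"
      using iso by (simp add: nat_iso_def)
  next
    fix \<zeta> assume a: "nat_iso A B H K \<zeta> \<and> precomp D \<zeta> L = z"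
    then have nt: "nat_trans A B H K \<zeta>" and \<zeta>L: "\<And>d. d \<in> Ob D \<Longrightarrow> \<zeta> (FOb L d) = z d"
      by (auto simp: nat_iso_def precomp_def compose_def)
    have "\<zeta> X = f X" if X: "X \<in> Ob A" for X
    proof (rule cancel[OF X H(2) nat_transD(3)[OF nt X] f(1)[OF X]])
      show "\<zeta> X \<cdot>\<^bsub>B\<^esub> FAr H (\<epsilon> X) = f X \<cdot>\<^bsub>B\<^esub> FAr H (\<epsilon> X)"
        using nat_transD(4)[OF nt LR.counit_Hom[OF X]] f(2)[OF X] \<zeta>L X by simp
    qed
    then show "\<zeta> = restrict f (Ob A)"
      using nat_transD(5)[OF nt] by (auto simp: fun_eq_iff extensional_def)
  qed
qed

end

section \<open>Two Nakayama functors\<close>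

text \<open>Up to transposition, \<open>L\<close> is composition with the unit.\<close>

lemma (in adjoint_functors) left_fully_faithful_at:
  assumes x: "x \<in> Ob C" and y: "y \<in> Ob C" and iso: "is_iso C (\<eta> y)"
  shows "bij_betw (FAr L) (Hom C x y) (Hom D (FOb L x) (FOb L y))"
proof -
  note h = unit_Hom[OF y]
  have tr: "transpose x (FAr L u) = \<eta> y \<cdot>\<^bsub>C\<^esub> u" if "u \<in> Hom C x y" for u
    using unit_natural[OF that] by (simp add: transpose_def)
  have "inj_on (FAr L) (Hom C x y)"
  proof (rule inj_onI)
    fix u v assume u: "u \<in> Hom C x y" and v: "v \<in> Hom C x y" and eq: "FAr L u = FAr L v"
    have "\<eta> y \<cdot>\<^bsub>C\<^esub> u = \<eta> y \<cdot>\<^bsub>C\<^esub> v" using tr[OF u] tr[OF v] eq by simp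
    then show "u = v" using L.C.iso_cancel_left[OF iso h u v] by simp
  qed
  moreover have "k \<in> FAr L ` Hom C x y" if k: "k \<in> Hom D (FOb L x) (FOb L y)" for k
  proof -
    let ?u = "inverse_arrow C (\<eta> y) \<cdot>\<^bsub>C\<^esub> transpose x k"
    note i = L.C.inverse_arrow[OF iso h] and t = transpose_Hom[OF x k]
    have u: "?u \<in> Hom C x y" using L.C.Comp_closed[OF t i(1)] .
    have "transpose x (FAr L ?u) = transpose x k"
      using tr[OF u] L.C.Comp_assoc[OF t i(1) h] i(3) L.C.Idn_left[OF t] by simp
    then have "FAr L ?u = k" using transpose_inject[OF x L.Hom_closed[OF u] k] by simp
    then show ?thesis using u by (metis imageI)
  qed
  ultimately show ?thesis using L.Hom_closed unfolding bij_betw_def by blast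
qed

lemma nakayama_functor_properties:
  assumes A: "preadditive_category A" and fs: "additive_functor D A f_shriek"
    and N: "nakayama_functor A D f_shriek f_star \<nu>"
  shows "additive_functor A A \<nu>" "preserves_coequalizers A A \<nu>"
    "\<lbrakk>d \<in> Ob D; e \<in> Ob D\<rbrakk> \<Longrightarrow> bij_betw (FAr \<nu>) (Hom A (FOb f_shriek d) (FOb f_shriek e))
      (Hom A (FOb \<nu> (FOb f_shriek d)) (FOb \<nu> (FOb f_shriek e)))"
proof -
  obtain \<nu>m \<eta> \<epsilon> where adj: "adjunction A A \<nu> \<nu>m \<eta> \<epsilon>"
    and iso: "nat_iso D A f_shriek ((\<nu>m \<odot>\<^bsub>A\<^esub> \<nu>) \<odot>\<^bsub>D\<^esub> f_shriek) (precomp D \<eta> f_shriek)"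
    using N by (auto simp: nakayama_functor_def)
  interpret N: adjoint_functors A A \<nu> \<nu>m \<eta> \<epsilon>
    using A adj by (auto intro!: adjoint_functors.intro afunctor.intro afunctor_axioms.intro
        adjoint_functors_axioms.intro simp: adjunction_def)
  show "additive_functor A A \<nu>" by (rule N.L.F)
  show "preserves_coequalizers A A \<nu>" by (rule N.left_preserves_coequalizers)
  assume d: "d \<in> Ob D" and e: "e \<in> Ob D"
  have "FOb f_shriek d \<in> Ob A" "FOb f_shriek e \<in> Ob A"
    using fs d e by (auto simp: additive_functor_def)
  moreover have "is_iso A (\<eta> (FOb f_shriek e))"
    using iso e by (auto simp: nat_iso_def precomp_def compose_def)
  ultimately show "bij_betw (FAr \<nu>) (Hom A (FOb f_shriek d) (FOb f_shriek e))
      (Hom A (FOb \<nu> (FOb f_shriek d)) (FOb \<nu> (FOb f_shriek e)))"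
    using N.left_fully_faithful_at by blast
qed

lemma nat_iso_id_trans:
  assumes D: "preadditive_category D" and A: "preadditive_category A" and F: "additive_functor D A F"
  shows "nat_iso D A F F (id_trans D A F)"
proof -
  interpret F: afunctor D A F using D A F by (intro afunctor.intro afunctor_axioms.intro)
  have "nat_trans D A F F (id_trans D A F)"
  proof (rule nat_transI[OF F F])
    fix x y f assume f: "f \<in> Hom D x y"
    then show "id_trans D A F y \<cdot>\<^bsub>A\<^esub> FAr F f = FAr F f \<cdot>\<^bsub>A\<^esub> id_trans D A F x"
      using F.C.Hom_Ob[OF f] F.Hom_closed[OF f] by (simp add: id_trans_def Hom_iff)
  qed (auto simp: id_trans_def Hom_iff)
  then show ?thesis by (simp add: nat_iso_def id_trans_def F.D.is_iso_Idn)
qed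

text \<open>The units and counits are parameters because the presentations are built from them.\<close>

locale nakayama_pair =
  fixes A :: "('o, 'a) precat" and D :: "('p, 'b) precat"
    and f_shriek f_low :: "('p, 'b, 'o, 'a) fctr"
    and f_star :: "('o, 'a, 'p, 'b) fctr"
    and \<nu>1 \<nu>2 :: "('o, 'a, 'o, 'a) fctr" and \<eta> \<epsilon> \<eta>' \<epsilon>'
  assumes A_abelian: "abelian_category A" and D_preadditive: "preadditive_category D"
    and adj_left: "adjunction D A f_shriek f_star \<eta> \<epsilon>"
    and adj_right: "adjunction A D f_star f_low \<eta>' \<epsilon>'"
    and f_star_faithful: "faithful A f_star"
    and N1: "nakayama_functor A D f_shriek f_star \<nu>1"
    and N2: "nakayama_functor A D f_shriek f_star \<nu>2"
    and nu1_shriek: "\<nu>1 \<odot>\<^bsub>D\<^esub> f_shriek = f_low" and nu2_shriek: "\<nu>2 \<odot>\<^bsub>D\<^esub> f_shriek = f_low"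
begin

abbreviation H_shriek where "H_shriek d e \<equiv> Hom A (FOb f_shriek d) (FOb f_shriek e)"
abbreviation H_low where "H_low d e \<equiv> Hom A (FOb f_low d) (FOb f_low e)"

lemma A_preadditive: "preadditive_category A"
  using A_abelian by (simp add: abelian_category_def additive_category_def)

lemma functors: "additive_functor D A f_shriek" "additive_functor A D f_star" "additive_functor D A f_low"
  using adj_left adj_right by (auto simp: adjunction_def)

sublocale P: free_presentation A D f_shriek f_star f_low \<eta> \<epsilon> \<eta>' \<epsilon>'
  using cokernel_category_abelian(1)[OF A_abelian] A_preadditive D_preadditive functors adj_left adj_right f_star_faithful
  by (intro free_presentation.intro adjoint_functors.intro afunctor.intro afunctor_axioms.intro
        adjoint_functors_axioms.intro free_presentation_axioms.intro)

text \<open>Dually, every object is copresented by the objects \<open>f_low d\<close>.\<close>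

lemma opposite_presentation:
  "free_presentation (opposite A) (opposite D) f_low f_star f_shriek \<epsilon>' \<eta>' \<epsilon> \<eta>"
proof -
  have "faithful (opposite A) f_star" using f_star_faithful by (simp add: faithful_def)
  then show ?thesis
    using cokernel_category_abelian(2)[OF A_abelian] preadditive_opposite[OF A_preadditive]
      preadditive_opposite[OF D_preadditive] functors adjunction_opposite[OF adj_left] adjunction_opposite[OF adj_right]
    by (intro free_presentation.intro adjoint_functors.intro afunctor.intro afunctor_axioms.intro
        adjoint_functors_axioms.intro free_presentation_axioms.intro) auto
qed

lemmas nu1 = nakayama_functor_properties[OF A_preadditive functors(1) N1]
lemmas nu2 = nakayama_functor_properties[OF A_preadditive functors(1) N2]

sublocale nu1: afunctor A A \<nu>1 by standard (rule nu1)
sublocale nu2: afunctor A A \<nu>2 by standard (rule nu2)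

lemma nu_shriek:
  "d \<in> Ob D \<Longrightarrow> FOb \<nu>1 (FOb f_shriek d) = FOb f_low d"
  "d \<in> Ob D \<Longrightarrow> FOb \<nu>2 (FOb f_shriek d) = FOb f_low d"
  "g \<in> Ar D \<Longrightarrow> FAr \<nu>1 (FAr f_shriek g) = FAr f_low g"
  "g \<in> Ar D \<Longrightarrow> FAr \<nu>2 (FAr f_shriek g) = FAr f_low g"
  using FOb_fcomp[of d D \<nu>1 f_shriek] FOb_fcomp[of d D \<nu>2 f_shriek]
    FAr_fcomp[of g D \<nu>1 f_shriek] FAr_fcomp[of g D \<nu>2 f_shriek] by (auto simp: nu1_shriek nu2_shriek)

lemma nu_bij:
  assumes "d \<in> Ob D" "e \<in> Ob D"
  shows "bij_betw (FAr \<nu>1) (H_shriek d e) (H_low d e)" "bij_betw (FAr \<nu>2) (H_shriek d e) (H_low d e)"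
  using nu1(3)[OF assms] nu2(3)[OF assms] by (simp_all add: nu_shriek assms)

lemma nu1_cancel:
  "\<lbrakk>d \<in> Ob D; e \<in> Ob D; u \<in> H_shriek d e; v \<in> H_shriek d e; FAr \<nu>1 u = FAr \<nu>1 v\<rbrakk> \<Longrightarrow> u = v"
  using inj_onD[OF bij_betw_imp_inj_on[OF nu_bij(1)]] by blast

lemma nu_Comp:
  assumes "w \<in> H_shriek d e" "v \<in> H_shriek e f"
  shows "FAr \<nu>1 (v \<cdot>\<^bsub>A\<^esub> w) = FAr \<nu>1 v \<cdot>\<^bsub>A\<^esub> FAr \<nu>1 w" "FAr \<nu>2 (v \<cdot>\<^bsub>A\<^esub> w) = FAr \<nu>2 v \<cdot>\<^bsub>A\<^esub> FAr \<nu>2 w"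
  using assms nu1.Comp[of w v] nu2.Comp[of w v] by (auto simp: Hom_iff)

text \<open>The arrow that \<open>\<nu>1\<close> sends to \<open>\<nu>2 w\<close>. The indices enter only through the objects \<open>f_shriek d\<close>
  and \<open>f_shriek e\<close>, which is why the first part holds strictly without a compatibility condition.\<close>

definition shriek_twist :: "'p \<Rightarrow> 'p \<Rightarrow> 'a \<Rightarrow> 'a" where
  "shriek_twist d e w = inv_into (H_shriek d e) (FAr \<nu>1) (FAr \<nu>2 w)"

lemma shriek_twist:
  assumes "d \<in> Ob D" "e \<in> Ob D" "w \<in> H_shriek d e"
  shows "shriek_twist d e w \<in> H_shriek d e" "FAr \<nu>1 (shriek_twist d e w) = FAr \<nu>2 w"
proof -
  note b = nu_bij[OF assms(1,2)]
  have "FAr \<nu>2 w \<in> H_low d e" using bij_betw_apply[OF b(2) assms(3)] .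
  then show "shriek_twist d e w \<in> H_shriek d e" "FAr \<nu>1 (shriek_twist d e w) = FAr \<nu>2 w"
    using bij_betw_apply[OF bij_betw_inv_into[OF b(1)]] bij_betw_inv_into_right[OF b(1)]
    by (auto simp: shriek_twist_def)
qed

lemma shriek_twist_automorphism: "P.free_automorphism shriek_twist"
  unfolding P.free_automorphism_def
proof (intro conjI ballI allI)
  fix d e assume d: "d \<in> Ob D" and e: "e \<in> Ob D"
  show "bij_betw (shriek_twist d e) (H_shriek d e) (H_shriek d e)"
    using bij_betw_trans[OF nu_bij(2)[OF d e] bij_betw_inv_into[OF nu_bij(1)[OF d e]]]
    by (simp add: shriek_twist_def[abs_def] comp_def)
next
  fix d e g assume g: "g \<in> Hom D d e"
  have de: "d \<in> Ob D" "e \<in> Ob D" using g P.D.Hom_Ob by blast+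
  note h = P.LR.L.Hom_closed[OF g]
  show "shriek_twist d e (FAr f_shriek g) = FAr f_shriek g"
    using nu1_cancel[OF de shriek_twist(1)[OF de h] h] shriek_twist(2)[OF de h] nu_shriek(3,4)[of g] g
    by (simp add: Hom_iff)
next
  fix d e f w v assume d: "d \<in> Ob D" and e: "e \<in> Ob D" and f: "f \<in> Ob D"
    and w: "w \<in> H_shriek d e" and v: "v \<in> H_shriek e f"
  note tw = shriek_twist[OF d e w] and tv = shriek_twist[OF e f v] and c = P.A.Comp_closed[OF w v]
  show "shriek_twist d f (v \<cdot>\<^bsub>A\<^esub> w) = shriek_twist e f v \<cdot>\<^bsub>A\<^esub> shriek_twist d e w"
    using nu1_cancel[OF d f shriek_twist(1)[OF d f c] P.A.Comp_closed[OF tw(1) tv(1)]]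
      shriek_twist(2)[OF d f c] nu_Comp(1)[OF tw(1) tv(1)] nu_Comp(2)[OF w v] tw(2) tv(2) by simp
qed

text \<open>The map \<open>\<nu>1 v \<mapsto> \<nu>2 v\<close>. It does depend on the indices: the arrow \<open>v\<close> with \<open>\<nu>1 v = w\<close> runs between
  \<open>f_shriek d\<close> and \<open>f_shriek e\<close>, which \<open>f_low d\<close> and \<open>f_low e\<close> do not determine.\<close>

definition low_twist :: "'p \<Rightarrow> 'p \<Rightarrow> 'a \<Rightarrow> 'a" where
  "low_twist d e w = FAr \<nu>2 (inv_into (H_shriek d e) (FAr \<nu>1) w)"

lemma low_twist:
  assumes "d \<in> Ob D" "e \<in> Ob D" "v \<in> H_shriek d e"
  shows "low_twist d e (FAr \<nu>1 v) = FAr \<nu>2 v"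
  using bij_betw_inv_into_left[OF nu_bij(1)[OF assms(1,2)] assms(3)] by (simp add: low_twist_def)

lemma H_lowE:
  assumes "d \<in> Ob D" "e \<in> Ob D" "w \<in> H_low d e"
  obtains v where "v \<in> H_shriek d e" "w = FAr \<nu>1 v"
  using bij_betw_imp_surj_on[OF nu_bij(1)[OF assms(1,2)]] assms(3) by blast

lemma low_twist_automorphism:
  "free_presentation.free_automorphism (opposite A) (opposite D) f_low (\<lambda>d e. low_twist e d)"
proof -
  interpret op: free_presentation "opposite A" "opposite D" f_low f_star f_shriek \<epsilon>' \<eta>' \<epsilon> \<eta>
    by (rule opposite_presentation)
  have "bij_betw (low_twist d e) (H_low d e) (H_low d e)" if d: "d \<in> Ob D" and e: "e \<in> Ob D" for d e
    using bij_betw_trans[OF bij_betw_inv_into[OF nu_bij(1)[OF d e]] nu_bij(2)[OF d e]]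
    by (simp add: low_twist_def[abs_def] comp_def)
  moreover have "low_twist d e (FAr f_low g) = FAr f_low g" if g: "g \<in> Hom D d e" for d e g
  proof -
    have de: "d \<in> Ob D" "e \<in> Ob D" "g \<in> Ar D" using g P.D.Hom_Ob by (auto simp: Hom_iff)
    show ?thesis using low_twist[OF de(1,2) P.LR.L.Hom_closed[OF g]] nu_shriek(3,4)[OF de(3)] by simp
  qed
  moreover have "low_twist d f (v \<cdot>\<^bsub>A\<^esub> w) = low_twist e f v \<cdot>\<^bsub>A\<^esub> low_twist d e w"
    if d: "d \<in> Ob D" and e: "e \<in> Ob D" and f: "f \<in> Ob D" and w: "w \<in> H_low d e" and v: "v \<in> H_low e f"
    for d e f w v
  proof -
    obtain w' where w': "w' \<in> H_shriek d e" "w = FAr \<nu>1 w'" using H_lowE[OF d e w] .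
    obtain v' where v': "v' \<in> H_shriek e f" "v = FAr \<nu>1 v'" using H_lowE[OF e f v] .
    show ?thesis
      using low_twist[OF d f P.A.Comp_closed[OF w'(1) v'(1)]] low_twist[OF d e w'(1)] low_twist[OF e f v'(1)]
        nu_Comp[OF w'(1) v'(1)] w'(2) v'(2) by simp
  qed
  ultimately show ?thesis unfolding op.free_automorphism_def by simp
qed

text \<open>If \<open>f_low d = f_low e\<close>, the identity is \<open>\<nu>1 u\<close> for some \<open>u\<close> from \<open>f_shriek d\<close> to \<open>f_shriek e\<close>, and
  passing from index \<open>e\<close> to \<open>d\<close> composes with \<open>\<nu>2 u\<close>, which the hypothesis makes the identity.\<close>

lemma low_twist_fibre_compatible:
  assumes fc: "fibre_compatible A D f_shriek f_low \<nu>1 \<nu>2"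
    and c: "c \<in> Ob D" and d: "d \<in> Ob D" and e: "e \<in> Ob D" and eq: "FOb f_low d = FOb f_low e"
    and w: "w \<in> H_low d c"
  shows "low_twist d c w = low_twist e c w"
proof -
  have X: "FOb f_low d \<in> Ob A" using P.RS.R.Ob_closed[OF d] .
  have i: "Idn A (FOb f_low d) \<in> H_low d e" using P.A.Idn_closed[OF X] eq by simp
  obtain u where u: "u \<in> H_shriek d e" "Idn A (FOb f_low d) = FAr \<nu>1 u" using H_lowE[OF d e i] .
  have u2: "FAr \<nu>2 u = Idn A (FOb f_low d)" using fc d e eq u unfolding fibre_compatible_def by metis
  obtain v where v: "v \<in> H_shriek e c" "w = FAr \<nu>1 v" using H_lowE[OF e c] w eq by auto
  note vu = P.A.Comp_closed[OF u(1) v(1)]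
  have v2: "FAr \<nu>2 v \<in> H_low d c" using bij_betw_apply[OF nu_bij(2)[OF e c] v(1)] eq by simp
  have "low_twist d c (FAr \<nu>1 (v \<cdot>\<^bsub>A\<^esub> u)) = FAr \<nu>2 (v \<cdot>\<^bsub>A\<^esub> u)" using low_twist[OF d c vu] .
  moreover have "FAr \<nu>1 (v \<cdot>\<^bsub>A\<^esub> u) = w"
    using nu_Comp(1)[OF u(1) v(1)] u(2) v(2) P.A.Idn_right[OF w] by simp
  moreover have "FAr \<nu>2 (v \<cdot>\<^bsub>A\<^esub> u) = FAr \<nu>2 v"
    using nu_Comp(2)[OF u(1) v(1)] u2 P.A.Idn_right[OF v2] by simp
  ultimately show ?thesis using low_twist[OF e c v(1)] v(2) by simp
qed

lemma precomp_Hom_natural: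
  assumes "nat_trans A A H K \<xi>" "precomp D \<xi> f_shriek = z" "d \<in> Ob D" "e \<in> Ob D" "w \<in> H_shriek d e"
  shows "z e \<cdot>\<^bsub>A\<^esub> FAr H w = FAr K w \<cdot>\<^bsub>A\<^esub> z d"
  using nat_transD(4)[OF assms(1,5)] assms(2-4) by (auto simp: precomp_def compose_def)

subsection \<open>Equivalences composed on the right\<close>

lemma is_equivalence_properties:
  assumes "is_equivalence A A \<Phi>"
  shows "additive_functor A A \<Phi>" "preserves_coequalizers A A \<Phi>" "afunctor A A \<Phi>"
    "preserves_coequalizers (opposite A) (opposite A) \<Phi>"
proof -
  note oA = preadditive_opposite[OF A_preadditive]
  show F: "additive_functor A A \<Phi>" using assms by (simp add: is_equivalence_def)
  show "afunctor A A \<Phi>"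
    using A_preadditive F by (intro afunctor.intro afunctor_axioms.intro)
  show "preserves_coequalizers A A \<Phi>"
    using equivalence_preserves_coequalizers[OF A_preadditive A_preadditive assms] .
  show "preserves_coequalizers (opposite A) (opposite A) \<Phi>"
    using equivalence_preserves_coequalizers[OF oA oA is_equivalence_opposite[OF A_preadditive A_preadditive assms]] .
qed

lemma ex_right_equivalence:
  obtains \<Phi> where "is_equivalence A A \<Phi>" "\<Phi> \<odot>\<^bsub>D\<^esub> f_shriek = f_shriek"
    "\<And>d e w. \<lbrakk>d \<in> Ob D; e \<in> Ob D; w \<in> H_shriek d e\<rbrakk> \<Longrightarrow> FAr \<nu>1 (FAr \<Phi> w) = FAr \<nu>2 w"
proof -
  obtain \<Phi> \<iota> where \<Phi>: "is_equivalence A A \<Phi>"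
    and nat: "\<forall>d\<in>Ob D. \<forall>e\<in>Ob D. \<forall>w\<in>H_shriek d e. \<iota> e \<cdot>\<^bsub>A\<^esub> FAr \<Phi> w = shriek_twist d e w \<cdot>\<^bsub>A\<^esub> \<iota> d"
    and s: "\<Phi> \<odot>\<^bsub>D\<^esub> f_shriek = f_shriek" "\<iota> = id_trans D A f_shriek"
    using P.ex_twist_equivalence[OF shriek_twist_automorphism] by (auto simp: shriek_twist_def)
  interpret Phi: afunctor A A \<Phi> using is_equivalence_properties(3)[OF \<Phi>] .
  have ob: "FOb \<Phi> (FOb f_shriek d) = FOb f_shriek d" if "d \<in> Ob D" for d
    using FOb_fcomp[OF that, of \<Phi> f_shriek] s(1) by simp
  have "FAr \<nu>1 (FAr \<Phi> w) = FAr \<nu>2 w" if d: "d \<in> Ob D" and e: "e \<in> Ob D" and w: "w \<in> H_shriek d e" for d e w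
    using bspec[OF bspec[OF bspec[OF nat d] e] w] shriek_twist[OF d e w] Phi.Hom_closed[OF w] ob d e s(2)
    by (simp add: id_trans_def Hom_iff)
  then show ?thesis using that \<Phi> s(1) by blast
qed

lemma ex1_right_comparison:
  assumes \<Phi>: "is_equivalence A A \<Phi>" and L: "\<Phi> \<odot>\<^bsub>D\<^esub> f_shriek = f_shriek"
    and nat: "\<And>d e w. \<lbrakk>d \<in> Ob D; e \<in> Ob D; w \<in> H_shriek d e\<rbrakk> \<Longrightarrow> FAr \<nu>1 (FAr \<Phi> w) = FAr \<nu>2 w"
  shows "\<exists>!\<xi>. nat_iso A A (\<nu>1 \<odot>\<^bsub>A\<^esub> \<Phi>) \<nu>2 \<xi> \<and> precomp D \<xi> f_shriek = id_trans D A f_low"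
proof -
  note eq = is_equivalence_properties[OF \<Phi>]
  interpret Phi: afunctor A A \<Phi> by (rule eq)
  have ob: "FOb \<Phi> (FOb f_shriek d) = FOb f_shriek d" if "d \<in> Ob D" for d
    using FOb_fcomp[OF that, of \<Phi> f_shriek] L by simp
  have af: "additive_functor A A (\<nu>1 \<odot>\<^bsub>A\<^esub> \<Phi>)"
    using additive_functor_fcomp[OF A_preadditive A_preadditive A_preadditive eq(1) nu1(1)] .
  have pc: "preserves_coequalizers A A (\<nu>1 \<odot>\<^bsub>A\<^esub> \<Phi>)"
    using preserves_coequalizers_fcomp[OF A_preadditive eq(2) nu1(2)] .
  have obs: "FOb (\<nu>1 \<odot>\<^bsub>A\<^esub> \<Phi>) (FOb f_shriek d) = FOb f_low d" "FOb \<nu>2 (FOb f_shriek d) = FOb f_low d"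
    "FOb f_low d \<in> Ob A" if "d \<in> Ob D" for d
    using that by (auto simp: FOb_fcomp ob nu_shriek)
  show ?thesis
  proof (rule P.ex1_nat_iso_extending[OF A_preadditive af pc nu2(1,2)])
    fix d assume d: "d \<in> Ob D"
    show "id_trans D A f_low d \<in> Hom A (FOb (\<nu>1 \<odot>\<^bsub>A\<^esub> \<Phi>) (FOb f_shriek d)) (FOb \<nu>2 (FOb f_shriek d))"
      "is_iso A (id_trans D A f_low d)"
      using obs[OF d] d P.A.Idn_closed P.A.is_iso_Idn by (auto simp: id_trans_def)
  next
    fix d e w assume d: "d \<in> Ob D" and e: "e \<in> Ob D" and w: "w \<in> H_shriek d e"
    have n2: "FAr \<nu>2 w \<in> H_low d e" using bij_betw_apply[OF nu_bij(2)[OF d e] w] .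
    have "FAr (\<nu>1 \<odot>\<^bsub>A\<^esub> \<Phi>) w = FAr \<nu>2 w" using nat[OF d e w] w by (simp add: FAr_fcomp Hom_iff)
    then show "id_trans D A f_low e \<cdot>\<^bsub>A\<^esub> FAr (\<nu>1 \<odot>\<^bsub>A\<^esub> \<Phi>) w = FAr \<nu>2 w \<cdot>\<^bsub>A\<^esub> id_trans D A f_low d"
      using n2 d e by (simp add: id_trans_def Hom_iff)
  qed (simp add: id_trans_def)
qed

lemma right_comparison_natural:
  assumes \<Psi>: "is_equivalence A A \<Psi>" and L: "\<Psi> \<odot>\<^bsub>D\<^esub> f_shriek = f_shriek"
    and \<xi>: "nat_iso A A (\<nu>1 \<odot>\<^bsub>A\<^esub> \<Psi>) \<nu>2 \<xi>" "precomp D \<xi> f_shriek = id_trans D A f_low"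
    and d: "d \<in> Ob D" and e: "e \<in> Ob D" and w: "w \<in> H_shriek d e"
  shows "FAr \<nu>1 (FAr \<Psi> w) = FAr \<nu>2 w"
proof -
  interpret Psi: afunctor A A \<Psi> by (rule is_equivalence_properties[OF \<Psi>])
  have ob: "FOb \<Psi> (FOb f_shriek d) = FOb f_shriek d" if "d \<in> Ob D" for d
    using FOb_fcomp[OF that, of \<Psi> f_shriek] L by simp
  have "FAr \<Psi> w \<in> H_shriek d e" using Psi.Hom_closed[OF w] ob d e by simp
  then have "FAr \<nu>1 (FAr \<Psi> w) \<in> H_low d e" "FAr \<nu>2 w \<in> H_low d e"
    using bij_betw_apply[OF nu_bij(1)[OF d e]] bij_betw_apply[OF nu_bij(2)[OF d e] w] by blast+
  then show ?thesis
    using precomp_Hom_natural[OF _ \<xi>(2) d e w, of "\<nu>1 \<odot>\<^bsub>A\<^esub> \<Psi>" \<nu>2] \<xi>(1) d e w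
    by (simp add: nat_iso_def id_trans_def FAr_fcomp Hom_iff)
qed

text \<open>Since \<open>\<nu>1\<close> is faithful on the free objects, \<open>\<Phi>\<close> and \<open>\<Psi>\<close> agree there, and the identity extends.\<close>

lemma ex1_right_equivalence_comparison:
  assumes \<Phi>: "is_equivalence A A \<Phi>" "\<Phi> \<odot>\<^bsub>D\<^esub> f_shriek = f_shriek"
    and \<Psi>: "is_equivalence A A \<Psi>" "\<Psi> \<odot>\<^bsub>D\<^esub> f_shriek = f_shriek"
    and \<Phi>n: "\<And>d e w. \<lbrakk>d \<in> Ob D; e \<in> Ob D; w \<in> H_shriek d e\<rbrakk> \<Longrightarrow> FAr \<nu>1 (FAr \<Phi> w) = FAr \<nu>2 w"
    and \<Psi>n: "\<And>d e w. \<lbrakk>d \<in> Ob D; e \<in> Ob D; w \<in> H_shriek d e\<rbrakk> \<Longrightarrow> FAr \<nu>1 (FAr \<Psi> w) = FAr \<nu>2 w"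
  shows "\<exists>!\<zeta>. nat_iso A A \<Phi> \<Psi> \<zeta> \<and> precomp D \<zeta> f_shriek = id_trans D A f_shriek"
proof -
  note e1 = is_equivalence_properties[OF \<Phi>(1)] and e2 = is_equivalence_properties[OF \<Psi>(1)]
  interpret Phi: afunctor A A \<Phi> by (rule e1)
  interpret Psi: afunctor A A \<Psi> by (rule e2)
  have ob: "FOb \<Phi> (FOb f_shriek d) = FOb f_shriek d" "FOb \<Psi> (FOb f_shriek d) = FOb f_shriek d"
    if "d \<in> Ob D" for d
    using FOb_fcomp[OF that, of \<Phi> f_shriek] FOb_fcomp[OF that, of \<Psi> f_shriek] \<Phi>(2) \<Psi>(2) by auto
  show ?thesis
  proof (rule P.ex1_nat_iso_extending[OF A_preadditive e1(1,2) e2(1,2)])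
    fix d assume d: "d \<in> Ob D"
    show "id_trans D A f_shriek d \<in> Hom A (FOb \<Phi> (FOb f_shriek d)) (FOb \<Psi> (FOb f_shriek d))"
      "is_iso A (id_trans D A f_shriek d)"
      using ob[OF d] d P.A.Idn_closed P.A.is_iso_Idn by (auto simp: id_trans_def)
  next
    fix d e w assume d: "d \<in> Ob D" and e: "e \<in> Ob D" and w: "w \<in> H_shriek d e"
    have h: "FAr \<Phi> w \<in> H_shriek d e" "FAr \<Psi> w \<in> H_shriek d e"
      using Phi.Hom_closed[OF w] Psi.Hom_closed[OF w] ob d e by auto
    have "FAr \<Phi> w = FAr \<Psi> w" using nu1_cancel[OF d e h] \<Phi>n[OF d e w] \<Psi>n[OF d e w] by simp
    then show "id_trans D A f_shriek e \<cdot>\<^bsub>A\<^esub> FAr \<Phi> w = FAr \<Psi> w \<cdot>\<^bsub>A\<^esub> id_trans D A f_shriek d"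
      using h d e by (simp add: id_trans_def Hom_iff)
  qed (simp add: id_trans_def)
qed

subsection \<open>Equivalences composed on the left\<close>

text \<open>Equivalent to the existence of an isomorphism \<open>\<Phi> \<circ> \<nu>1 \<rightarrow> \<nu>2\<close> restricting to \<open>\<iota>\<close> on the objects
  \<open>f_shriek d\<close>, by \<open>left_comparisonI\<close> and \<open>ex1_left_comparison_iso\<close>, but stated on those objects
  alone.\<close>

definition left_comparison where
  "left_comparison \<Phi> \<iota> \<longleftrightarrow> is_equivalence A A \<Phi> \<and> nat_iso D A (\<Phi> \<odot>\<^bsub>D\<^esub> f_low) f_low \<iota> \<and>
    (\<forall>d\<in>Ob D. \<forall>e\<in>Ob D. \<forall>v\<in>H_shriek d e. \<iota> e \<cdot>\<^bsub>A\<^esub> FAr \<Phi> (FAr \<nu>1 v) = FAr \<nu>2 v \<cdot>\<^bsub>A\<^esub> \<iota> d)"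

lemma left_comparisonD:
  assumes "left_comparison \<Phi> \<iota>"
  shows "is_equivalence A A \<Phi>" "d \<in> Ob D \<Longrightarrow> \<iota> d \<in> Hom A (FOb \<Phi> (FOb f_low d)) (FOb f_low d)"
    "d \<in> Ob D \<Longrightarrow> is_iso A (\<iota> d)" "\<iota> \<in> extensional (Ob D)"
    "\<lbrakk>d \<in> Ob D; e \<in> Ob D; v \<in> H_shriek d e\<rbrakk> \<Longrightarrow> \<iota> e \<cdot>\<^bsub>A\<^esub> FAr \<Phi> (FAr \<nu>1 v) = FAr \<nu>2 v \<cdot>\<^bsub>A\<^esub> \<iota> d"
  using assms nat_transD(3,5)[of D A "\<Phi> \<odot>\<^bsub>D\<^esub> f_low" f_low \<iota>]
  by (auto simp: left_comparison_def nat_iso_def FOb_fcomp)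

text \<open>In the opposite category the isomorphism runs from \<open>f_low\<close> to \<open>\<Phi> \<circ> f_low\<close>, so \<open>\<iota>\<close> is its
  inverse.\<close>

lemma ex_left_comparison:
  obtains \<Phi> \<iota> where "left_comparison \<Phi> \<iota>"
    "fibre_compatible A D f_shriek f_low \<nu>1 \<nu>2 \<Longrightarrow> \<Phi> \<odot>\<^bsub>D\<^esub> f_low = f_low \<and> \<iota> = id_trans D A f_low"
proof -
  interpret op: free_presentation "opposite A" "opposite D" f_low f_star f_shriek \<epsilon>' \<eta>' \<epsilon> \<eta>
    by (rule opposite_presentation)
  obtain \<Phi> \<kappa> where all: "is_equivalence (opposite A) (opposite A) \<Phi> \<and>
      nat_iso D A f_low (\<Phi> \<odot>\<^bsub>D\<^esub> f_low) \<kappa> \<and>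
      (\<forall>d\<in>Ob D. \<forall>e\<in>Ob D. \<forall>w\<in>H_low e d. FAr \<Phi> w \<cdot>\<^bsub>A\<^esub> \<kappa> e = \<kappa> d \<cdot>\<^bsub>A\<^esub> low_twist e d w) \<and>
      ((\<forall>c\<in>Ob D. \<forall>d\<in>Ob D. \<forall>e\<in>Ob D. \<forall>w\<in>H_low d c. FOb f_low d = FOb f_low e
        \<longrightarrow> low_twist d c w = low_twist e c w) \<longrightarrow> \<Phi> \<odot>\<^bsub>D\<^esub> f_low = f_low \<and> \<kappa> = id_trans D A f_low)"
    using op.ex_twist_equivalence[OF low_twist_automorphism]
    unfolding opposite_simps Hom_opposite fcomp_opposite nat_iso_opposite id_trans_opposite
    by (elim exE) (rule that)
  note \<Phi> = conjunct1[OF all] and \<kappa> = conjunct1[OF conjunct2[OF all]]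
    and nat = conjunct1[OF conjunct2[OF conjunct2[OF all]]]
    and strict = conjunct2[OF conjunct2[OF conjunct2[OF all]]]
  from \<kappa> have \<kappa>H: "\<And>d. d \<in> Ob D \<Longrightarrow> \<kappa> d \<in> Hom A (FOb f_low d) (FOb \<Phi> (FOb f_low d))"
    and \<kappa>i: "\<And>d. d \<in> Ob D \<Longrightarrow> is_iso A (\<kappa> d)"
    using nat_transD(3)[of D A f_low "\<Phi> \<odot>\<^bsub>D\<^esub> f_low" \<kappa>] by (auto simp: nat_iso_def FOb_fcomp)
  have eq: "is_equivalence A A \<Phi>"
    using is_equivalence_opposite[OF _ _ \<Phi>] preadditive_opposite[OF A_preadditive] by simp
  interpret Phi: afunctor A A \<Phi> by (rule is_equivalence_properties[OF eq])
  define \<iota> where "\<iota> = (\<lambda>d\<in>Ob D. inverse_arrow A (\<kappa> d))"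
  note inv = P.A.inverse_arrow[OF \<kappa>i \<kappa>H]
  have "\<iota> e \<cdot>\<^bsub>A\<^esub> FAr \<Phi> (FAr \<nu>1 v) = FAr \<nu>2 v \<cdot>\<^bsub>A\<^esub> \<iota> d"
    if d: "d \<in> Ob D" and e: "e \<in> Ob D" and v: "v \<in> H_shriek d e" for d e v
  proof (rule P.A.iso_cancel_right[OF \<kappa>i[OF d] \<kappa>H[OF d]])
    have v1: "FAr \<nu>1 v \<in> H_low d e" and v2: "FAr \<nu>2 v \<in> H_low d e"
      using bij_betw_apply[OF nu_bij(1)[OF d e] v] bij_betw_apply[OF nu_bij(2)[OF d e] v] .
    note \<Phi>v = Phi.Hom_closed[OF v1]
    have \<iota>: "\<iota> d = inverse_arrow A (\<kappa> d)" "\<iota> e = inverse_arrow A (\<kappa> e)" using d e by (auto simp: \<iota>_def)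
    show "\<iota> e \<cdot>\<^bsub>A\<^esub> FAr \<Phi> (FAr \<nu>1 v) \<in> Hom A (FOb \<Phi> (FOb f_low d)) (FOb f_low e)"
      "FAr \<nu>2 v \<cdot>\<^bsub>A\<^esub> \<iota> d \<in> Hom A (FOb \<Phi> (FOb f_low d)) (FOb f_low e)"
      unfolding \<iota> using P.A.Comp_closed[OF \<Phi>v inv(1)[OF e e]] P.A.Comp_closed[OF inv(1)[OF d d] v2] .
    have "FAr \<Phi> (FAr \<nu>1 v) \<cdot>\<^bsub>A\<^esub> \<kappa> d = \<kappa> e \<cdot>\<^bsub>A\<^esub> FAr \<nu>2 v"
      using bspec[OF bspec[OF bspec[OF nat e] d] v1] low_twist[OF d e v] by simp
    then have "(\<iota> e \<cdot>\<^bsub>A\<^esub> FAr \<Phi> (FAr \<nu>1 v)) \<cdot>\<^bsub>A\<^esub> \<kappa> d = (\<iota> e \<cdot>\<^bsub>A\<^esub> \<kappa> e) \<cdot>\<^bsub>A\<^esub> FAr \<nu>2 v"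
      unfolding \<iota> using P.A.Comp_assoc[OF \<kappa>H[OF d] \<Phi>v inv(1)[OF e e]] P.A.Comp_assoc[OF v2 \<kappa>H[OF e] inv(1)[OF e e]]
      by simp
    also have "\<dots> = FAr \<nu>2 v \<cdot>\<^bsub>A\<^esub> (\<iota> d \<cdot>\<^bsub>A\<^esub> \<kappa> d)"
      unfolding \<iota> inv(2)[OF e e] inv(2)[OF d d] using P.A.Idn_left[OF v2] P.A.Idn_right[OF v2] by simp
    also have "\<dots> = (FAr \<nu>2 v \<cdot>\<^bsub>A\<^esub> \<iota> d) \<cdot>\<^bsub>A\<^esub> \<kappa> d"
      unfolding \<iota> using P.A.Comp_assoc[OF \<kappa>H[OF d] inv(1)[OF d d] v2] by simp
    finally show "(\<iota> e \<cdot>\<^bsub>A\<^esub> FAr \<Phi> (FAr \<nu>1 v)) \<cdot>\<^bsub>A\<^esub> \<kappa> d = (FAr \<nu>2 v \<cdot>\<^bsub>A\<^esub> \<iota> d) \<cdot>\<^bsub>A\<^esub> \<kappa> d" .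
  qed
  then have lc: "left_comparison \<Phi> \<iota>"
    using eq nat_iso_inverse[OF D_preadditive A_preadditive \<kappa>] by (simp add: left_comparison_def \<iota>_def)
  have "\<Phi> \<odot>\<^bsub>D\<^esub> f_low = f_low \<and> \<iota> = id_trans D A f_low"
    if fc: "fibre_compatible A D f_shriek f_low \<nu>1 \<nu>2"
  proof -
    have s: "\<Phi> \<odot>\<^bsub>D\<^esub> f_low = f_low" "\<kappa> = id_trans D A f_low"
      using strict low_twist_fibre_compatible[OF fc] by metis+
    have "\<iota> d = Idn A (FOb f_low d)" if d: "d \<in> Ob D" for d
    proof -
      have "FOb \<Phi> (FOb f_low d) = FOb f_low d" using FOb_fcomp[OF d, of \<Phi> f_low] s(1) by simp
      then show ?thesis
        using inv(1,2)[OF d d] s(2) d by (simp add: \<iota>_def id_trans_def Hom_iff)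
    qed
    then show ?thesis using s(1) by (auto simp: \<iota>_def id_trans_def fun_eq_iff)
  qed
  then show ?thesis using that[OF lc] by blast
qed

lemma ex1_left_comparison_iso:
  assumes lc: "left_comparison \<Phi> \<iota>"
  shows "\<exists>!\<xi>. nat_iso A A (\<Phi> \<odot>\<^bsub>A\<^esub> \<nu>1) \<nu>2 \<xi> \<and> precomp D \<xi> f_shriek = \<iota>"
proof -
  note l = left_comparisonD[OF lc]
  note eq = is_equivalence_properties[OF l(1)]
  have af: "additive_functor A A (\<Phi> \<odot>\<^bsub>A\<^esub> \<nu>1)"
    using additive_functor_fcomp[OF A_preadditive A_preadditive A_preadditive nu1(1) eq(1)] .
  have pc: "preserves_coequalizers A A (\<Phi> \<odot>\<^bsub>A\<^esub> \<nu>1)"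
    using preserves_coequalizers_fcomp[OF A_preadditive nu1(2) eq(2)] .
  show ?thesis
  proof (rule P.ex1_nat_iso_extending[OF A_preadditive af pc nu2(1,2) _ l(3,4)])
    show "\<iota> d \<in> Hom A (FOb (\<Phi> \<odot>\<^bsub>A\<^esub> \<nu>1) (FOb f_shriek d)) (FOb \<nu>2 (FOb f_shriek d))" if "d \<in> Ob D" for d
      using l(2)[OF that] that by (simp add: FOb_fcomp nu_shriek)
    show "\<iota> e \<cdot>\<^bsub>A\<^esub> FAr (\<Phi> \<odot>\<^bsub>A\<^esub> \<nu>1) w = FAr \<nu>2 w \<cdot>\<^bsub>A\<^esub> \<iota> d"
      if "d \<in> Ob D" "e \<in> Ob D" "w \<in> H_shriek d e" for d e w
      using l(5)[OF that] that(3) by (simp add: FAr_fcomp Hom_iff)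
  qed
qed

lemma left_comparisonI:
  assumes \<Psi>: "is_equivalence A A \<Psi>" and \<kappa>: "nat_iso D A (\<Psi> \<odot>\<^bsub>D\<^esub> f_low) f_low \<kappa>"
    and \<xi>: "nat_iso A A (\<Psi> \<odot>\<^bsub>A\<^esub> \<nu>1) \<nu>2 \<xi>" "precomp D \<xi> f_shriek = \<kappa>"
  shows "left_comparison \<Psi> \<kappa>"
proof -
  have "\<kappa> e \<cdot>\<^bsub>A\<^esub> FAr \<Psi> (FAr \<nu>1 v) = FAr \<nu>2 v \<cdot>\<^bsub>A\<^esub> \<kappa> d"
    if "d \<in> Ob D" "e \<in> Ob D" "v \<in> H_shriek d e" for d e v
    using precomp_Hom_natural[OF _ \<xi>(2) that, of "\<Psi> \<odot>\<^bsub>A\<^esub> \<nu>1" \<nu>2] \<xi>(1) that(3) by (simp add: nat_iso_def FAr_fcomp Hom_iff)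
  then show ?thesis using \<Psi> \<kappa> by (simp add: left_comparison_def)
qed

text \<open>The components at \<open>f_low d\<close> must be \<open>\<kappa>\<^sub>d\<^sup>-\<^sup>1 \<iota>\<^sub>d\<close>. They are natural for all arrows between the
  objects \<open>f_low d\<close>, since these arrows are the \<open>\<nu>1 v\<close>, and the extension theorem in the opposite
  category applies.\<close>

lemma ex1_left_equivalence_comparison:
  assumes \<Phi>: "left_comparison \<Phi> \<iota>" and \<Psi>: "left_comparison \<Psi> \<kappa>"
  shows "\<exists>!\<zeta>. nat_iso A A \<Phi> \<Psi> \<zeta> \<and> vcomp D A \<kappa> (precomp D \<zeta> f_low) = \<iota>"
proof -
  interpret op: free_presentation "opposite A" "opposite D" f_low f_star f_shriek \<epsilon>' \<eta>' \<epsilon> \<eta>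
    by (rule opposite_presentation)
  note l = left_comparisonD[OF \<Phi>] and k = left_comparisonD[OF \<Psi>]
  note e1 = is_equivalence_properties[OF l(1)] and e2 = is_equivalence_properties[OF k(1)]
  interpret Phi: afunctor A A \<Phi> by (rule e1)
  interpret Psi: afunctor A A \<Psi> by (rule e2)
  note inv = P.A.inverse_arrow[OF k(3,2)]
  define z where "z = (\<lambda>d\<in>Ob D. inverse_arrow A (\<kappa> d) \<cdot>\<^bsub>A\<^esub> \<iota> d)"
  have zd: "z d = inverse_arrow A (\<kappa> d) \<cdot>\<^bsub>A\<^esub> \<iota> d" if "d \<in> Ob D" for d using that by (simp add: z_def)
  have zH: "z d \<in> Hom A (FOb \<Phi> (FOb f_low d)) (FOb \<Psi> (FOb f_low d))" if d: "d \<in> Ob D" for d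
    using P.A.Comp_closed[OF l(2)[OF d] inv(1)[OF d d]] by (simp add: zd d)
  have zi: "is_iso A (z d)" if d: "d \<in> Ob D" for d
    using P.A.is_iso_Comp[OF l(3)[OF d] inv(4)[OF d d] l(2)[OF d] inv(1)[OF d d]] by (simp add: zd d)
  have \<kappa>z: "\<kappa> d \<cdot>\<^bsub>A\<^esub> z d = \<iota> d" if d: "d \<in> Ob D" for d
    using P.A.Comp_assoc[OF l(2)[OF d] inv(1)[OF d d] k(2)[OF d]] inv(3)[OF d d] P.A.Idn_left[OF l(2)[OF d]]
    by (simp add: zd d)
  have nat: "z e \<cdot>\<^bsub>A\<^esub> FAr \<Phi> w = FAr \<Psi> w \<cdot>\<^bsub>A\<^esub> z d"
    if d: "d \<in> Ob D" and e: "e \<in> Ob D" and w: "w \<in> H_low d e" for d e w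
  proof (rule P.A.iso_cancel_left[OF k(3)[OF e] k(2)[OF e]])
    obtain v where v: "v \<in> H_shriek d e" "w = FAr \<nu>1 v" using H_lowE[OF d e w] .
    note \<Phi>w = Phi.Hom_closed[OF w] and \<Psi>w = Psi.Hom_closed[OF w]
    have v2: "FAr \<nu>2 v \<in> H_low d e" using bij_betw_apply[OF nu_bij(2)[OF d e] v(1)] .
    show "z e \<cdot>\<^bsub>A\<^esub> FAr \<Phi> w \<in> Hom A (FOb \<Phi> (FOb f_low d)) (FOb \<Psi> (FOb f_low e))"
      "FAr \<Psi> w \<cdot>\<^bsub>A\<^esub> z d \<in> Hom A (FOb \<Phi> (FOb f_low d)) (FOb \<Psi> (FOb f_low e))"
      using P.A.Comp_closed[OF \<Phi>w zH[OF e]] P.A.Comp_closed[OF zH[OF d] \<Psi>w] .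
    have "\<kappa> e \<cdot>\<^bsub>A\<^esub> (z e \<cdot>\<^bsub>A\<^esub> FAr \<Phi> w) = \<iota> e \<cdot>\<^bsub>A\<^esub> FAr \<Phi> w"
      using P.A.Comp_assoc[OF \<Phi>w zH[OF e] k(2)[OF e]] \<kappa>z[OF e] by simp
    also have "\<dots> = FAr \<nu>2 v \<cdot>\<^bsub>A\<^esub> (\<kappa> d \<cdot>\<^bsub>A\<^esub> z d)" using l(5)[OF d e v(1)] v(2) \<kappa>z[OF d] by simp
    also have "\<dots> = (\<kappa> e \<cdot>\<^bsub>A\<^esub> FAr \<Psi> w) \<cdot>\<^bsub>A\<^esub> z d"
      using P.A.Comp_assoc[OF zH[OF d] k(2)[OF d] v2] k(5)[OF d e v(1)] v(2) by simp
    also have "\<dots> = \<kappa> e \<cdot>\<^bsub>A\<^esub> (FAr \<Psi> w \<cdot>\<^bsub>A\<^esub> z d)" using P.A.Comp_assoc[OF zH[OF d] \<Psi>w k(2)[OF e]] .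
    finally show "\<kappa> e \<cdot>\<^bsub>A\<^esub> (z e \<cdot>\<^bsub>A\<^esub> FAr \<Phi> w) = \<kappa> e \<cdot>\<^bsub>A\<^esub> (FAr \<Psi> w \<cdot>\<^bsub>A\<^esub> z d)" .
  qed
  have "\<exists>!\<zeta>. nat_iso (opposite A) (opposite A) \<Psi> \<Phi> \<zeta> \<and> precomp (opposite D) \<zeta> f_low = z"
    using e1(1,4) e2(1,4) zH zi nat
    by (intro op.ex1_nat_iso_extending[OF preadditive_opposite[OF A_preadditive]]) (auto simp: z_def)
  then have ex1: "\<exists>!\<zeta>. nat_iso A A \<Phi> \<Psi> \<zeta> \<and> precomp D \<zeta> f_low = z" by simp
  have "precomp D \<zeta> f_low = z \<longleftrightarrow> vcomp D A \<kappa> (precomp D \<zeta> f_low) = \<iota>" if \<zeta>: "nat_iso A A \<Phi> \<Psi> \<zeta>" for \<zeta>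
  proof
    assume "precomp D \<zeta> f_low = z"
    then show "vcomp D A \<kappa> (precomp D \<zeta> f_low) = \<iota>"
      using \<kappa>z l(4) by (auto simp: vcomp_def fun_eq_iff extensional_def)
  next
    assume v: "vcomp D A \<kappa> (precomp D \<zeta> f_low) = \<iota>"
    have "\<zeta> (FOb f_low d) = z d" if d: "d \<in> Ob D" for d
    proof (rule P.A.iso_cancel_left[OF k(3)[OF d] k(2)[OF d] _ zH[OF d]])
      show "\<zeta> (FOb f_low d) \<in> Hom A (FOb \<Phi> (FOb f_low d)) (FOb \<Psi> (FOb f_low d))"
        using \<zeta> nat_transD(3)[of A A \<Phi> \<Psi> \<zeta>] P.RS.R.Ob_closed[OF d] by (simp add: nat_iso_def)
      show "\<kappa> d \<cdot>\<^bsub>A\<^esub> \<zeta> (FOb f_low d) = \<kappa> d \<cdot>\<^bsub>A\<^esub> z d"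
        using fun_cong[OF v, of d] \<kappa>z[OF d] d by (simp add: vcomp_def precomp_def compose_def)
    qed
    then show "precomp D \<zeta> f_low = z" by (auto simp: precomp_def compose_def z_def fun_eq_iff)
  qed
  then show ?thesis using ex1 by metis
qed

lemma left_comparison_strict:
  assumes "is_equivalence A A \<Psi>" "\<Psi> \<odot>\<^bsub>D\<^esub> f_low = f_low"
    and "nat_iso A A (\<Psi> \<odot>\<^bsub>A\<^esub> \<nu>1) \<nu>2 \<xi>" "precomp D \<xi> f_shriek = id_trans D A f_low"
  shows "left_comparison \<Psi> (id_trans D A f_low)"
  using left_comparisonI[OF assms(1) _ assms(3,4)] assms(2)
    nat_iso_id_trans[OF D_preadditive A_preadditive functors(3)] by simp

lemma vcomp_id_trans:
  assumes \<zeta>: "nat_iso A A \<Phi> \<Psi> \<zeta>" and \<Psi>: "\<Psi> \<odot>\<^bsub>D\<^esub> f_low = f_low"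
  shows "vcomp D A (id_trans D A f_low) (precomp D \<zeta> f_low) = precomp D \<zeta> f_low"
proof -
  have "Idn A (FOb f_low d) \<cdot>\<^bsub>A\<^esub> \<zeta> (FOb f_low d) = \<zeta> (FOb f_low d)" if d: "d \<in> Ob D" for d
  proof -
    have "\<zeta> (FOb f_low d) \<in> Hom A (FOb \<Phi> (FOb f_low d)) (FOb \<Psi> (FOb f_low d))"
      using \<zeta> nat_transD(3)[of A A \<Phi> \<Psi> \<zeta>] P.RS.R.Ob_closed[OF d] by (simp add: nat_iso_def)
    moreover have "FOb \<Psi> (FOb f_low d) = FOb f_low d" using FOb_fcomp[OF d, of \<Psi> f_low] \<Psi> by simp
    ultimately show ?thesis using P.A.Idn_left by metis
  qed
  then show ?thesis by (auto simp: vcomp_def id_trans_def precomp_def compose_def fun_eq_iff)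
qed

end

theorem theorem3p3p4:
  fixes A :: "('o, 'a) precat" and D :: "('p, 'b) precat"
    and f_shriek f_low :: "('p, 'b, 'o, 'a) fctr"
    and f_star :: "('o, 'a, 'p, 'b) fctr"
    and \<nu>1 \<nu>2 :: "('o, 'a, 'o, 'a) fctr"
  assumes "abelian_category A" and "additive_category D"
    and "adjoint_pair D A f_shriek f_star" and "adjoint_pair A D f_star f_low"
    and "faithful A f_star"
    and "nakayama_functor A D f_shriek f_star \<nu>1"
    and "nakayama_functor A D f_shriek f_star \<nu>2"
    and "\<nu>1 \<odot>\<^bsub>D\<^esub> f_shriek = f_low" and "\<nu>2 \<odot>\<^bsub>D\<^esub> f_shriek = f_low"
  shows
    "(\<exists>\<Phi>. is_equivalence A A \<Phi> \<and> \<Phi> \<odot>\<^bsub>D\<^esub> f_shriek = f_shriek \<and>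
      (\<exists>!\<xi>. nat_iso A A (\<nu>1 \<odot>\<^bsub>A\<^esub> \<Phi>) \<nu>2 \<xi> \<and> precomp D \<xi> f_shriek = id_trans D A f_low) \<and>
      (\<forall>\<Psi>. is_equivalence A A \<Psi> \<and> \<Psi> \<odot>\<^bsub>D\<^esub> f_shriek = f_shriek \<and>
          (\<exists>\<xi>. nat_iso A A (\<nu>1 \<odot>\<^bsub>A\<^esub> \<Psi>) \<nu>2 \<xi> \<and> precomp D \<xi> f_shriek = id_trans D A f_low) \<longrightarrow>
        (\<exists>!\<zeta>. nat_iso A A \<Phi> \<Psi> \<zeta> \<and> precomp D \<zeta> f_shriek = id_trans D A f_shriek)))
    \<and>
    (fibre_compatible A D f_shriek f_low \<nu>1 \<nu>2 \<longrightarrow>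
      (\<exists>\<Phi>'. is_equivalence A A \<Phi>' \<and> \<Phi>' \<odot>\<^bsub>D\<^esub> f_low = f_low \<and>
        (\<exists>!\<xi>'. nat_iso A A (\<Phi>' \<odot>\<^bsub>A\<^esub> \<nu>1) \<nu>2 \<xi>' \<and> precomp D \<xi>' f_shriek = id_trans D A f_low) \<and>
        (\<forall>\<Psi>'. is_equivalence A A \<Psi>' \<and> \<Psi>' \<odot>\<^bsub>D\<^esub> f_low = f_low \<and>
            (\<exists>\<xi>'. nat_iso A A (\<Psi>' \<odot>\<^bsub>A\<^esub> \<nu>1) \<nu>2 \<xi>' \<and>
              precomp D \<xi>' f_shriek = id_trans D A f_low) \<longrightarrow>
          (\<exists>!\<zeta>. nat_iso A A \<Phi>' \<Psi>' \<zeta> \<and> precomp D \<zeta> f_low = id_trans D A f_low))))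
    \<and>
    (\<exists>\<Phi>' \<iota>. is_equivalence A A \<Phi>' \<and> nat_iso D A (\<Phi>' \<odot>\<^bsub>D\<^esub> f_low) f_low \<iota> \<and>
      (\<exists>!\<xi>'. nat_iso A A (\<Phi>' \<odot>\<^bsub>A\<^esub> \<nu>1) \<nu>2 \<xi>' \<and> precomp D \<xi>' f_shriek = \<iota>) \<and>
      (\<forall>\<Psi>' \<kappa>. is_equivalence A A \<Psi>' \<and> nat_iso D A (\<Psi>' \<odot>\<^bsub>D\<^esub> f_low) f_low \<kappa> \<and>
          (\<exists>\<xi>'. nat_iso A A (\<Psi>' \<odot>\<^bsub>A\<^esub> \<nu>1) \<nu>2 \<xi>' \<and> precomp D \<xi>' f_shriek = \<kappa>) \<longrightarrow>
        (\<exists>!\<zeta>. nat_iso A A \<Phi>' \<Psi>' \<zeta> \<and> vcomp D A \<kappa> (precomp D \<zeta> f_low) = \<iota>)))"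
proof -
  obtain \<eta> \<epsilon> where "adjunction D A f_shriek f_star \<eta> \<epsilon>"
    using assms(3) by (auto simp: adjoint_pair_def)
  moreover obtain \<eta>' \<epsilon>' where "adjunction A D f_star f_low \<eta>' \<epsilon>'"
    using assms(4) by (auto simp: adjoint_pair_def)
  moreover have "preadditive_category D" using assms(2) by (simp add: additive_category_def)
  ultimately interpret nakayama_pair A D f_shriek f_low f_star \<nu>1 \<nu>2 \<eta> \<epsilon> \<eta>' \<epsilon>'
    using assms by (intro nakayama_pair.intro)
  obtain \<Phi> where \<Phi>: "is_equivalence A A \<Phi>" "\<Phi> \<odot>\<^bsub>D\<^esub> f_shriek = f_shriek"
    and \<Phi>n: "\<And>d e w. \<lbrakk>d \<in> Ob D; e \<in> Ob D; w \<in> H_shriek d e\<rbrakk> \<Longrightarrow> FAr \<nu>1 (FAr \<Phi> w) = FAr \<nu>2 w"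
    using ex_right_equivalence by blast
  have part1: "\<exists>!\<xi>. nat_iso A A (\<nu>1 \<odot>\<^bsub>A\<^esub> \<Phi>) \<nu>2 \<xi> \<and> precomp D \<xi> f_shriek = id_trans D A f_low"
    using ex1_right_comparison[OF \<Phi> \<Phi>n] .
  have part1': "\<exists>!\<zeta>. nat_iso A A \<Phi> \<Psi> \<zeta> \<and> precomp D \<zeta> f_shriek = id_trans D A f_shriek"
    if other: "is_equivalence A A \<Psi> \<and> \<Psi> \<odot>\<^bsub>D\<^esub> f_shriek = f_shriek \<and>
        (\<exists>\<xi>. nat_iso A A (\<nu>1 \<odot>\<^bsub>A\<^esub> \<Psi>) \<nu>2 \<xi> \<and> precomp D \<xi> f_shriek = id_trans D A f_low)" for \<Psi>
  proof -
    obtain \<xi> where \<Psi>: "is_equivalence A A \<Psi>" "\<Psi> \<odot>\<^bsub>D\<^esub> f_shriek = f_shriek"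
      and \<xi>: "nat_iso A A (\<nu>1 \<odot>\<^bsub>A\<^esub> \<Psi>) \<nu>2 \<xi>" "precomp D \<xi> f_shriek = id_trans D A f_low"
      using other by blast
    show ?thesis
      using ex1_right_equivalence_comparison[OF \<Phi> \<Psi> \<Phi>n right_comparison_natural[OF \<Psi> \<xi>]] .
  qed
  \<comment> \<open>One equivalence serves the strict and the weak form of the second part.\<close>
  obtain \<Phi>' \<iota> where lc: "left_comparison \<Phi>' \<iota>"
    and strict: "fibre_compatible A D f_shriek f_low \<nu>1 \<nu>2 \<Longrightarrow> \<Phi>' \<odot>\<^bsub>D\<^esub> f_low = f_low \<and> \<iota> = id_trans D A f_low"
    using ex_left_comparison by blast
  have \<Phi>': "is_equivalence A A \<Phi>'" "nat_iso D A (\<Phi>' \<odot>\<^bsub>D\<^esub> f_low) f_low \<iota>"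
    using lc by (auto simp: left_comparison_def)
  note part3 = ex1_left_comparison_iso[OF lc]
  have part3': "\<exists>!\<zeta>. nat_iso A A \<Phi>' \<Psi>' \<zeta> \<and> vcomp D A \<kappa> (precomp D \<zeta> f_low) = \<iota>"
    if "is_equivalence A A \<Psi>' \<and> nat_iso D A (\<Psi>' \<odot>\<^bsub>D\<^esub> f_low) f_low \<kappa> \<and>
        (\<exists>\<xi>'. nat_iso A A (\<Psi>' \<odot>\<^bsub>A\<^esub> \<nu>1) \<nu>2 \<xi>' \<and> precomp D \<xi>' f_shriek = \<kappa>)" for \<Psi>' \<kappa>
    using that left_comparisonI ex1_left_equivalence_comparison[OF lc] by blast
  have part2: "\<exists>!\<zeta>. nat_iso A A \<Phi>' \<Psi>' \<zeta> \<and> precomp D \<zeta> f_low = id_trans D A f_low"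
    if fc: "fibre_compatible A D f_shriek f_low \<nu>1 \<nu>2"
      and "is_equivalence A A \<Psi>' \<and> \<Psi>' \<odot>\<^bsub>D\<^esub> f_low = f_low \<and>
        (\<exists>\<xi>'. nat_iso A A (\<Psi>' \<odot>\<^bsub>A\<^esub> \<nu>1) \<nu>2 \<xi>' \<and> precomp D \<xi>' f_shriek = id_trans D A f_low)" for \<Psi>'
  proof -
    have \<Psi>': "\<Psi>' \<odot>\<^bsub>D\<^esub> f_low = f_low" "left_comparison \<Psi>' (id_trans D A f_low)"
      using that(2) left_comparison_strict by blast+
    have "nat_iso A A \<Phi>' \<Psi>' \<zeta> \<and> precomp D \<zeta> f_low = id_trans D A f_low \<longleftrightarrow>
      nat_iso A A \<Phi>' \<Psi>' \<zeta> \<and> vcomp D A (id_trans D A f_low) (precomp D \<zeta> f_low) = \<iota>" for \<zeta>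
      using vcomp_id_trans[OF _ \<Psi>'(1)] strict[OF fc] by metis
    then show ?thesis using ex1_left_equivalence_comparison[OF lc \<Psi>'(2)] by simp
  qed
  show ?thesis
    using \<Phi> part1 part1' \<Phi>' part3 part3' strict part2 by (intro conjI impI exI[of _ \<Phi>] exI[of _ \<Phi>'] exI[of _ \<iota>] allI) auto
qed

end
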